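(* Let $p>1$ be odd and let $\epsilon\in\mathbb{C}$ be a primitive $p$th root of unity. Let $s>0$ be an integer, written $s=s_0+ps_1$ with integers $s_0,s_1$ and $0\le s_0<p$, and suppose $s_0\neq0$. Let $v_m=g(m,m+s)\in\mathcal{F}_\epsilon^2(2)$ for integers $m\ge0$, let $V^s=\mathrm{span}_{\mathbb{C}}\{v_m: m\ge0\}$ and $$V'=\mathrm{span}_{\mathbb{C}}\{v_m : m\ge 0,\ p>m_0\geq p-s_0\},$$ where $m=m_0+pm_1$ with integers $m_0,m_1$ and $0\le m_0<p$. Then the $U_\epsilon^{res}(sl_2)$-module $V^s/V'$ is isomorphic to $V_\epsilon^{res}(-(s+1))$.
   Context: Let $q$ be an indeterminate, $\mathcal{A}=\mathbb{C}[q,q^{-1}]$, $\mathbb{N}=\{1,2,\dots\}$, $\mathbb{Z}^+=\{0,1,2,\dots\}$. For $n\in\mathbb{Z}$, $m\in\mathbb{N}$: $[n]_q=\frac{q^n-q^{-n}}{q-q^{-1}}$, $[m]_q!=[m]_q\cdots[1]_q$, $\left[{n\atop m}\right]_q=\frac{[n]_q[n-1]_q\cdots[n-m+1]_q}{[m]_q!}$; also $\left[{n\atop 0}\right]_q=1$ and $\left[{n\atop m}\right]_q=0$ for $m<0$. These lie in $\mathcal{A}$, and $\left[{n\atop m}\right]_\epsilon$ denotes the value at $q=\epsilon$. $U_q(sl_2)$ is the associative $\mathbb{C}(q)$-algebra with generators $e,f,K^{\pm1}$ and relations $KK^{-1}=K^{-1}K=1$, $KeK^{-1}=q^2e$, $KfK^{-1}=q^{-2}f$,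 $[e,f]=\frac{K-K^{-1}}{q-q^{-1}}$. $U_{\mathcal{A}}^{res}(sl_2)$ is its $\mathcal{A}$-subalgebra generated by $K^{\pm1}$, $e^{(r)}=e^r/[r]_q!$, $f^{(r)}=f^r/[r]_q!$ ($r\in\mathbb{N}$). $U_\epsilon^{res}(sl_2)=U_{\mathcal{A}}^{res}(sl_2)\otimes_{\mathcal{A}}\mathbb{C}$ via $q\mapsto\epsilon$; elements $x\otimes1$ are written $x$. A $U_\epsilon^{res}(sl_2)$-module is of type 1 if $K$ is diagonalizable on it and $K^{\pm p}=1$. Let $\left[{K;0\atop p}\right]_q=\prod_{s=1}^p\frac{Kq^{1-s}-K^{-1}q^{s-1}}{q^s-q^{-s}}\in U_{\mathcal{A}}^{res}(sl_2)$. For $m\in\mathbb{Z}$, the weight space of weight $m$ of a type 1 module $V$ is $\{v\in V: Kv=\epsilon^m v,\ \left[{K;0\atop p}\right]_q v=\left[{m\atop p}\right]_\epsilon v\}$. A type 1 module is a highest weight module of highest weight $\lambda\in\mathbb{Z}$ if it is generated by a nonzero vector $v_\lambda$ of weight $\lambda$ with $ev_\lambda=e^{(p)}v_\lambda=0$. $V_\epsilon^{res}(\lambda)$ denotes the irreducible highest weight module of type 1 of highest weight $\lambda$ (unique up to isomorphism). The restricted q-Fock space $\mathcal{F}_\epsilon^2(2)$ is the complex vector space with basis $\{g(r_1,r_2): r_1,r_2\in\mathbb{Z}^+\}$ (specialization at $q=\epsilon$ of an $\mathcal{A}$-form of the q-Fock space of the rank-2 q-boson algebra, $g(r_1,r_2)=a_1^{+(r_1)}a_2^{+r_2}|0\rangle$).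 It is a type 1 $U_\epsilon^{res}(sl_2)$-module by (for $r\in\mathbb{N}$) $K^{\pm1}g(r_1,r_2)=\epsilon^{\mp(r_1+r_2+1)}g(r_1,r_2)$, $e^{(r)}g(r_1,r_2)=\left[{r_2\atop r_2-r}\right]_\epsilon g(r_1-r,r_2-r)$, $f^{(r)}g(r_1,r_2)=(-1)^r\left[{r+r_1\atop r}\right]_\epsilon g(r_1+r,r_2+r)$, where $g(\cdot,\cdot)$ with a negative index means $0$. The subspaces $V'\subset V^s$ are $U_\epsilon^{res}(sl_2)$-submodules of $\mathcal{F}_\epsilon^2(2)$. *)

theory Defs
  imports
    "HOL-Library.Poly_Mapping"
    "HOL-Computational_Algebra.Polynomial"
    "HOL-Computational_Algebra.Fraction_Field"
    "HOL-Algebra.Module"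
    "HOL-Algebra.QuotRing"
begin

section \<open>The field of rational functions and quantum binomials\<close>

type_synonym cq = "complex poly fract"

definition qq :: cq where
  "qq = Fract [:0, 1:] 1"

definition const_cq :: "complex \<Rightarrow> cq" where
  "const_cq c = Fract [:c:] 1"

text \<open>The Laurent polynomials, as a subring of the rational functions.\<close>

definition laurent :: "cq set" where
  "laurent = {Fract a 1 * qq powi k | a k. True}"

definition qint :: "int \<Rightarrow> cq" where
  "qint n = (qq powi n - qq powi (- n)) / (qq - inverse qq)"

definition qfact :: "nat \<Rightarrow> cq" where
  "qfact m = (\<Prod>i = 1..m. qint (int i))"

definition qbinom :: "int \<Rightarrow> int \<Rightarrow> cq" where
  "qbinom n m =
     (if m < 0 then 0 else (\<Prod>i<nat m. qint (n - int i)) / qfact (nat m))"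

text \<open>The value at \<open>q = \<epsilon>\<close> of a rational function without pole at \<open>\<epsilon>\<close>; in particular of a
  Laurent polynomial, if \<open>\<epsilon> \<noteq> 0\<close>. The cancellation has to be carried out before \<open>q\<close> is replaced
  by \<open>\<epsilon>\<close>: the quotient defining \<^const>\<open>qbinom\<close> may become \<open>0 / 0\<close>.\<close>

definition at_eps :: "complex \<Rightarrow> cq \<Rightarrow> complex" where
  "at_eps \<epsilon> x =
     (THE z. \<exists>a b. x = Fract a b \<and> poly b \<epsilon> \<noteq> 0 \<and> z = poly a \<epsilon> / poly b \<epsilon>)"

definition qbinom_eps :: "complex \<Rightarrow> int \<Rightarrow> int \<Rightarrow> complex" where
  "qbinom_eps \<epsilon> n m = at_eps \<epsilon> (qbinom n m)"


section \<open>The quantum group \<open>U\<^sub>q(sl\<^sub>2)\<close>\<close>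

datatype gen = GenE | GenF | GenK | GenKinv

text \<open>The free monoid on the generators. It is written additively because \<^typ>\<open>'a \<Rightarrow>\<^sub>0 'b\<close> is the
  monoid algebra of an additively written monoid \<^typ>\<open>'a\<close>, not assumed commutative.\<close>

datatype word = Word (letters: "gen list")

instantiation word :: monoid_add
begin

definition zero_word :: word where
  "zero_word = Word []"

definition plus_word :: "word \<Rightarrow> word \<Rightarrow> word" where
  "plus_word v w = Word (letters v @ letters w)"

instance
  by standard (simp_all add: zero_word_def plus_word_def)

end

type_synonym free_alg = "word \<Rightarrow>\<^sub>0 cq"

definition free_scal :: "cq \<Rightarrow> free_alg" where
  "free_scal c = Poly_Mapping.single 0 c"

definition free_gen :: "gen \<Rightarrow> free_alg" where
  "free_gen g = Poly_Mapping.single (Word [g]) 1"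

definition uq_relators :: "free_alg set" where
  "uq_relators =
    (let e = free_gen GenE; f = free_gen GenF; k = free_gen GenK; ki = free_gen GenKinv in
     {k * ki - 1,
      ki * k - 1,
      k * e * ki - free_scal (qq powi 2) * e,
      k * f * ki - free_scal (qq powi (- 2)) * f,
      e * f - f * e - free_scal (inverse (qq - inverse qq)) * (k - ki)})"

inductive_set uq_ideal :: "free_alg set" where
  zero: "0 \<in> uq_ideal"
| gen: "r \<in> uq_relators \<Longrightarrow> a * r * b \<in> uq_ideal"
| add: "x \<in> uq_ideal \<Longrightarrow> y \<in> uq_ideal \<Longrightarrow> x + y \<in> uq_ideal"

lemma uq_ideal_mult_left: "x \<in> uq_ideal \<Longrightarrow> a * x \<in> uq_ideal"
proof (induction rule: uq_ideal.induct)
  case (gen r b c)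
  then show ?case
    using uq_ideal.gen[of r "a * b" c] by (simp add: mult.assoc)
qed (simp_all add: uq_ideal.zero uq_ideal.add distrib_left)

lemma uq_ideal_mult_right: "x \<in> uq_ideal \<Longrightarrow> x * a \<in> uq_ideal"
proof (induction rule: uq_ideal.induct)
  case (gen r b c)
  then show ?case
    using uq_ideal.gen[of r b "c * a"] by (simp add: mult.assoc)
qed (simp_all add: uq_ideal.zero uq_ideal.add distrib_right)

lemma uq_ideal_uminus: "x \<in> uq_ideal \<Longrightarrow> - x \<in> uq_ideal"
  using uq_ideal_mult_left[of x "- 1"] by simp

lemma uq_ideal_diff: "x \<in> uq_ideal \<Longrightarrow> y \<in> uq_ideal \<Longrightarrow> x - y \<in> uq_ideal"
  using uq_ideal.add[of x "- y"] uq_ideal_uminus[of y] by simp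

definition uq_cong :: "free_alg \<Rightarrow> free_alg \<Rightarrow> bool" where
  "uq_cong x y \<longleftrightarrow> x - y \<in> uq_ideal"

quotient_type uq = free_alg / uq_cong
proof (rule equivpI)
  show "reflp uq_cong"
    by (simp add: reflp_def uq_cong_def uq_ideal.zero)
  show "symp uq_cong"
    using uq_ideal_uminus by (force simp: symp_def uq_cong_def)
  show "transp uq_cong"
    using uq_ideal.add by (force simp: transp_def uq_cong_def)
qed

instantiation uq :: "{ring, monoid_mult}"
begin

lift_definition zero_uq :: uq is 0 .

lift_definition one_uq :: uq is 1 .

lift_definition plus_uq :: "uq \<Rightarrow> uq \<Rightarrow> uq" is "(+)"
  unfolding uq_cong_def by (metis add_diff_add uq_ideal.add)

lift_definition uminus_uq :: "uq \<Rightarrow> uq" is uminus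
  unfolding uq_cong_def by (metis minus_diff_minus uq_ideal_uminus)

lift_definition minus_uq :: "uq \<Rightarrow> uq \<Rightarrow> uq" is "(-)"
proof -
  fix a b c d
  assume "uq_cong a b" "uq_cong c d"
  then have "(a - b) - (c - d) \<in> uq_ideal"
    unfolding uq_cong_def by (rule uq_ideal_diff)
  then show "uq_cong (a - c) (b - d)"
    by (simp add: uq_cong_def algebra_simps)
qed

lift_definition times_uq :: "uq \<Rightarrow> uq \<Rightarrow> uq" is "(*)"
proof -
  fix a b c d
  assume "uq_cong a b" "uq_cong c d"
  then have "(a - b) * c + b * (c - d) \<in> uq_ideal"
    unfolding uq_cong_def
    by (intro uq_ideal.add uq_ideal_mult_left uq_ideal_mult_right)
  then show "uq_cong (a * c) (b * d)"
    by (simp add: uq_cong_def algebra_simps)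
qed

instance
  by standard
    (transfer; simp add: uq_cong_def uq_ideal.zero algebra_simps)+

end

lift_definition scal :: "cq \<Rightarrow> uq" is free_scal .
lift_definition uE :: uq is "free_gen GenE" .
lift_definition uF :: uq is "free_gen GenF" .
lift_definition uK :: uq is "free_gen GenK" .
lift_definition uKinv :: uq is "free_gen GenKinv" .

definition divE :: "nat \<Rightarrow> uq" where
  "divE r = scal (inverse (qfact r)) * uE ^ r"

definition divF :: "nat \<Rightarrow> uq" where
  "divF r = scal (inverse (qfact r)) * uF ^ r"

text \<open>The factors of the following product commute with each other.\<close>

definition Kbinom :: "nat \<Rightarrow> uq" where
  "Kbinom p =
     prod_list (map (\<lambda>s. scal (inverse (qq powi int s - qq powi (- int s))) *
                    (scal (qq powi (1 - int s)) * uK - scal (qq powi (int s - 1)) * uKinv))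
                [1..<Suc p])"


section \<open>The restricted integral form and its specialization\<close>

inductive_set res_form :: "uq set" where
  scal: "a \<in> laurent \<Longrightarrow> scal a \<in> res_form"
| K: "uK \<in> res_form"
| Kinv: "uKinv \<in> res_form"
| divE: "r \<ge> 1 \<Longrightarrow> divE r \<in> res_form"
| divF: "r \<ge> 1 \<Longrightarrow> divF r \<in> res_form"
| add: "x \<in> res_form \<Longrightarrow> y \<in> res_form \<Longrightarrow> x + y \<in> res_form"
| mult: "x \<in> res_form \<Longrightarrow> y \<in> res_form \<Longrightarrow> x * y \<in> res_form"

definition UA :: "uq ring" where
  "UA = \<lparr>carrier = res_form, mult = (*), one = 1, zero = 0, add = (+)\<rparr>"

text \<open>For \<open>\<epsilon> \<noteq> 0\<close> the map \<open>q \<mapsto> \<epsilon>\<close> from the Laurent polynomials to the complex numbers is onto with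
  kernel generated by \<open>q - \<epsilon>\<close>. Tensoring with the complex numbers along this map is therefore
  dividing out the ideal generated by the central element \<open>q - \<epsilon>\<close>, and \<open>x \<otimes> 1\<close> is the
  coset of \<open>x\<close>.\<close>

definition eps_ideal :: "complex \<Rightarrow> uq set" where
  "eps_ideal \<epsilon> = Idl\<^bsub>UA\<^esub> {scal (qq - const_cq \<epsilon>)}"

definition U_eps :: "complex \<Rightarrow> uq set ring" where
  "U_eps \<epsilon> = UA Quot eps_ideal \<epsilon>"

definition cls :: "complex \<Rightarrow> uq \<Rightarrow> uq set" where
  "cls \<epsilon> x = eps_ideal \<epsilon> +>\<^bsub>UA\<^esub> x"

definition cscal :: "complex \<Rightarrow> complex \<Rightarrow> uq set" where
  "cscal \<epsilon> c = cls \<epsilon> (scal (const_cq c))"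


section \<open>Left modules\<close>

text \<open>The locale \<^locale>\<open>module\<close> of the library requires a commutative ring. As there, the fields
  \<open>mult\<close> and \<open>one\<close> of the module record play no role.\<close>

locale left_module = R?: ring R + M?: abelian_group M
  for R :: "('a, 'c) ring_scheme" (structure) and M :: "('a, 'b, 'd) module_scheme" (structure) +
  assumes smult_closed:
      "\<lbrakk>a \<in> carrier R; x \<in> carrier M\<rbrakk> \<Longrightarrow> a \<odot>\<^bsub>M\<^esub> x \<in> carrier M"
    and smult_l_distr:
      "\<lbrakk>a \<in> carrier R; b \<in> carrier R; x \<in> carrier M\<rbrakk> \<Longrightarrow>
      (a \<oplus>\<^bsub>R\<^esub> b) \<odot>\<^bsub>M\<^esub> x = a \<odot>\<^bsub>M\<^esub> x \<oplus>\<^bsub>M\<^esub> b \<odot>\<^bsub>M\<^esub> x"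
    and smult_r_distr:
      "\<lbrakk>a \<in> carrier R; x \<in> carrier M; y \<in> carrier M\<rbrakk> \<Longrightarrow>
      a \<odot>\<^bsub>M\<^esub> (x \<oplus>\<^bsub>M\<^esub> y) = a \<odot>\<^bsub>M\<^esub> x \<oplus>\<^bsub>M\<^esub> a \<odot>\<^bsub>M\<^esub> y"
    and smult_assoc1:
      "\<lbrakk>a \<in> carrier R; b \<in> carrier R; x \<in> carrier M\<rbrakk> \<Longrightarrow>
      (a \<otimes>\<^bsub>R\<^esub> b) \<odot>\<^bsub>M\<^esub> x = a \<odot>\<^bsub>M\<^esub> (b \<odot>\<^bsub>M\<^esub> x)"
    and smult_one:
      "x \<in> carrier M \<Longrightarrow> \<one>\<^bsub>R\<^esub> \<odot>\<^bsub>M\<^esub> x = x"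

definition module_iso ::
  "('a, 'c) ring_scheme \<Rightarrow> ('a, 'm) module \<Rightarrow> ('a, 'n) module \<Rightarrow> bool" where
  "module_iso R M N \<longleftrightarrow>
     (\<exists>h. bij_betw h (carrier M) (carrier N) \<and>
       (\<forall>x \<in> carrier M. \<forall>y \<in> carrier M. h (x \<oplus>\<^bsub>M\<^esub> y) = h x \<oplus>\<^bsub>N\<^esub> h y) \<and>
       (\<forall>a \<in> carrier R. \<forall>x \<in> carrier M. h (a \<odot>\<^bsub>M\<^esub> x) = a \<odot>\<^bsub>N\<^esub> h x))"

definition quot_module :: "('a, 'm) module \<Rightarrow> 'm set \<Rightarrow> ('a, 'm set) module" where
  "quot_module M N =
     \<lparr>carrier = a_rcosets\<^bsub>M\<^esub> N, mult = undefined, one = undefined,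
      zero = N, add = set_add M,
      smult = (\<lambda>a X. \<Union>x\<in>X. N +>\<^bsub>M\<^esub> (a \<odot>\<^bsub>M\<^esub> x))\<rparr>"

definition irreducible_module :: "('a, 'c) ring_scheme \<Rightarrow> ('a, 'm) module \<Rightarrow> bool" where
  "irreducible_module R M \<longleftrightarrow>
     carrier M \<noteq> {\<zero>\<^bsub>M\<^esub>} \<and>
     (\<forall>N. submodule N R M \<longrightarrow> N = {\<zero>\<^bsub>M\<^esub>} \<or> N = carrier M)"

definition generated_by :: "('a, 'c) ring_scheme \<Rightarrow> ('a, 'm) module \<Rightarrow> 'm \<Rightarrow> bool" where
  "generated_by R M v \<longleftrightarrow>
     v \<in> carrier M \<and> (\<forall>N. submodule N R M \<and> v \<in> N \<longrightarrow> N = carrier M)"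


section \<open>Modules of type 1\<close>

text \<open>The complex scalars act on a module through \<^const>\<open>cscal\<close>. That \<open>K\<close> is diagonalizable means
  that the eigenvectors of \<open>K\<close> span the module.\<close>

definition K_diagonalizable :: "complex \<Rightarrow> (uq set, 'm) module \<Rightarrow> bool" where
  "K_diagonalizable \<epsilon> M \<longleftrightarrow>
     (\<forall>x \<in> carrier M. \<exists>S. finite S \<and>
        S \<subseteq> {v \<in> carrier M. \<exists>c. cls \<epsilon> uK \<odot>\<^bsub>M\<^esub> v = cscal \<epsilon> c \<odot>\<^bsub>M\<^esub> v} \<and>
        x = (\<Oplus>\<^bsub>M\<^esub>v\<in>S. v))"

definition type_1 :: "complex \<Rightarrow> nat \<Rightarrow> (uq set, 'm) module \<Rightarrow> bool" where
  "type_1 \<epsilon> p M \<longleftrightarrow>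
     left_module (U_eps \<epsilon>) M \<and> K_diagonalizable \<epsilon> M \<and>
     (\<forall>x \<in> carrier M. cls \<epsilon> (uK ^ p) \<odot>\<^bsub>M\<^esub> x = x \<and> cls \<epsilon> (uKinv ^ p) \<odot>\<^bsub>M\<^esub> x = x)"

definition weight_space :: "complex \<Rightarrow> nat \<Rightarrow> (uq set, 'm) module \<Rightarrow> int \<Rightarrow> 'm set" where
  "weight_space \<epsilon> p M m =
     {v \<in> carrier M.
        cls \<epsilon> uK \<odot>\<^bsub>M\<^esub> v = cscal \<epsilon> (\<epsilon> powi m) \<odot>\<^bsub>M\<^esub> v \<and>
        cls \<epsilon> (Kbinom p) \<odot>\<^bsub>M\<^esub> v = cscal \<epsilon> (qbinom_eps \<epsilon> m (int p)) \<odot>\<^bsub>M\<^esub> v}"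

definition highest_weight_module ::
  "complex \<Rightarrow> nat \<Rightarrow> int \<Rightarrow> (uq set, 'm) module \<Rightarrow> bool" where
  "highest_weight_module \<epsilon> p l M \<longleftrightarrow>
     type_1 \<epsilon> p M \<and>
     (\<exists>v \<in> weight_space \<epsilon> p M l.
        v \<noteq> \<zero>\<^bsub>M\<^esub> \<and>
        cls \<epsilon> (divE 1) \<odot>\<^bsub>M\<^esub> v = \<zero>\<^bsub>M\<^esub> \<and> cls \<epsilon> (divE p) \<odot>\<^bsub>M\<^esub> v = \<zero>\<^bsub>M\<^esub> \<and>
        generated_by (U_eps \<epsilon>) M v)"

text \<open>For an odd \<open>p > 1\<close> and a primitive \<open>p\<close>-th root of unity \<open>\<epsilon>\<close>, the irreducible
  highest weight module of highest weight \<open>l\<close> is unique up to isomorphism. A module generated by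
  one element is a quotient of the algebra by a left ideal, so it has an isomorphic copy whose
  elements are sets of elements of the algebra.\<close>

definition V_res :: "complex \<Rightarrow> nat \<Rightarrow> int \<Rightarrow> (uq set, uq set set) module" where
  "V_res \<epsilon> p l =
     (SOME M. highest_weight_module \<epsilon> p l M \<and> irreducible_module (U_eps \<epsilon>) M)"


section \<open>The restricted q-Fock space\<close>

type_synonym fock = "nat \<times> nat \<Rightarrow>\<^sub>0 complex"

definition fock_scale :: "complex \<Rightarrow> fock \<Rightarrow> fock" where
  "fock_scale c x = Poly_Mapping.map ((*) c) x"

definition fock_g :: "int \<Rightarrow> int \<Rightarrow> fock" where
  "fock_g r1 r2 =
     (if r1 < 0 \<or> r2 < 0 then 0 else Poly_Mapping.single (nat r1, nat r2) 1)"

definition fock_module_of :: "(uq set \<Rightarrow> fock \<Rightarrow> fock) \<Rightarrow> (uq set, fock) module" where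
  "fock_module_of act =
     \<lparr>carrier = UNIV, mult = undefined, one = undefined, zero = 0, add = (+), smult = act\<rparr>"

text \<open>For \<open>\<epsilon> \<noteq> 0\<close> there is exactly one module structure, on the carrier of
  \<^term>\<open>U_eps \<epsilon>\<close>, with the properties below: the elements whose action is prescribed
  generate this algebra.\<close>

definition is_fock_action :: "complex \<Rightarrow> (uq set \<Rightarrow> fock \<Rightarrow> fock) \<Rightarrow> bool" where
  "is_fock_action \<epsilon> act \<longleftrightarrow>
     left_module (U_eps \<epsilon>) (fock_module_of act) \<and>
     (\<forall>c x. act (cscal \<epsilon> c) x = fock_scale c x) \<and>
     (\<forall>r1 \<ge> 0. \<forall>r2 \<ge> 0.
        act (cls \<epsilon> uK) (fock_g r1 r2) = fock_scale (\<epsilon> powi (- (r1 + r2 + 1))) (fock_g r1 r2) \<and>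
        act (cls \<epsilon> uKinv) (fock_g r1 r2) = fock_scale (\<epsilon> powi (r1 + r2 + 1)) (fock_g r1 r2) \<and>
        (\<forall>r \<ge> 1.
           act (cls \<epsilon> (divE r)) (fock_g r1 r2) =
             fock_scale (qbinom_eps \<epsilon> r2 (r2 - int r)) (fock_g (r1 - int r) (r2 - int r)) \<and>
           act (cls \<epsilon> (divF r)) (fock_g r1 r2) =
             fock_scale ((- 1) ^ r * qbinom_eps \<epsilon> (int r + r1) (int r))
               (fock_g (r1 + int r) (r2 + int r))))"

definition fock_module :: "complex \<Rightarrow> (uq set, fock) module" where
  "fock_module \<epsilon> = fock_module_of (SOME act. is_fock_action \<epsilon> act)"

definition fock_span :: "fock set \<Rightarrow> fock set" where
  "fock_span B = Modules.module.span fock_scale B"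

definition v_vec :: "nat \<Rightarrow> nat \<Rightarrow> fock" where
  "v_vec s m = fock_g (int m) (int m + int s)"

definition Vs :: "nat \<Rightarrow> fock set" where
  "Vs s = fock_span {v_vec s m | m. True}"

definition Vs' :: "nat \<Rightarrow> nat \<Rightarrow> fock set" where
  "Vs' p s = fock_span {v_vec s m | m. p - s mod p \<le> m mod p}"

definition Vs_quot :: "complex \<Rightarrow> nat \<Rightarrow> nat \<Rightarrow> (uq set, fock set) module" where
  "Vs_quot \<epsilon> p s = quot_module ((fock_module \<epsilon>)\<lparr>carrier := Vs s\<rparr>) (Vs' p s)"

end

theory Submission
  imports Defs
begin

text \<open>
  The module \<open>V^s\<close> is itself a highest weight module: \<open>v_0\<close> is killed by the divided powers of \<open>e\<close>
  and has weight \<open>-(s + 1)\<close>, and \<open>f^(m) v_0 = (-1)^m v_m\<close>. In general the divided powers of \<open>e\<close> and \<open>f\<close>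
  act by quantum binomials at \<open>\<epsilon>\<close>, up to sign, and these vanish exactly if a carry occurs in the addition
  of the lowest base-\<open>p\<close> digits (\<open>qbinom_eps_eq_0_iff\<close>). The basis of \<open>V'\<close> consists of the \<open>v_m\<close> for which
  \<open>m + s\<close> has such a carry, and one reads off that the coefficients leading out of \<open>V'\<close> vanish. Conversely, if the highest
  \<open>v_m\<close> in a vector has no carry, \<open>e^(m)\<close> takes this vector to a nonzero multiple of \<open>v_0\<close>
  (\<open>submodule_contains_v_0\<close>). So \<open>V^s/V'\<close> is an irreducible module of highest weight \<open>-(s + 1)\<close>.

  It remains to see that such a module is determined by its highest weight
  (\<open>highest_weight_module_unique\<close>). By the commutation formula of Kostant (\<open>divE_dF\<close>), every element \<open>x\<close>
  of the integral form acts on a highest weight vector like a combination of the \<open>f^(j)\<close>, where all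
  \<open>[K;n;t]\<close> act by the binomials that the weight prescribes (\<open>Kb_cong\<close>). A suitable \<open>[K;n;t]\<close> then projects
  to the highest weight (\<open>proj_scalar\<close>). If \<open>x\<close> annihilates the generator of one module but not that of
  the other, irreducibility of the latter provides an \<open>x\<close> that annihilates the one generator and fixes
  the other, and the projection leads to a contradiction (\<open>annihilator_subset\<close>).

  Both modules in the statement are obtained by choice, so that their existence has to be proved. The
  irreducible module is \<open>V^s/V'\<close> itself, copied to a type of sets (\<open>highest_weight_module_copy\<close>). For
  the Fock space, the quantum group acts on functions with values in \<open>\<complex>(q)\<close>; the integral form preserves
  the functions without a pole at \<open>\<epsilon>\<close>, and their values at \<open>\<epsilon>\<close> carry the specialized action
  (\<open>is_fock_action_fock_act\<close>).
\<close>

section \<open>Evaluation of rational functions at a point\<close>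

text \<open>The local ring of the affine line at \<open>\<epsilon>\<close>. On it \<^const>\<open>at_eps\<close> is a ring homomorphism, with kernel
  generated by \<open>q - \<epsilon>\<close>.\<close>

definition regular :: "complex \<Rightarrow> cq set" where
  "regular \<epsilon> = {Fract a b | a b. poly b \<epsilon> \<noteq> 0}"

lemma regularI: "poly b \<epsilon> \<noteq> 0 \<Longrightarrow> Fract a b \<in> regular \<epsilon>"
  by (auto simp: regular_def)

lemma at_eps_Fract:
  assumes "poly b \<epsilon> \<noteq> 0"
  shows "at_eps \<epsilon> (Fract a b) = poly a \<epsilon> / poly b \<epsilon>"
  unfolding at_eps_def
proof (rule the_equality)
  show "\<exists>a' b'. Fract a b = Fract a' b' \<and> poly b' \<epsilon> \<noteq> 0 \<and> poly a \<epsilon> / poly b \<epsilon> = poly a' \<epsilon> / poly b' \<epsilon>"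
    using assms by blast
next
  fix z
  assume "\<exists>a' b'. Fract a b = Fract a' b' \<and> poly b' \<epsilon> \<noteq> 0 \<and> z = poly a' \<epsilon> / poly b' \<epsilon>"
  then obtain a' b' where eq: "Fract a b = Fract a' b'" and b': "poly b' \<epsilon> \<noteq> 0"
    and z: "z = poly a' \<epsilon> / poly b' \<epsilon>"
    by blast
  have "b \<noteq> 0" "b' \<noteq> 0"
    using assms b' by auto
  then have "a * b' = a' * b"
    using eq by (simp add: eq_fract)
  then have "poly a \<epsilon> * poly b' \<epsilon> = poly a' \<epsilon> * poly b \<epsilon>"
    by (metis poly_mult)
  then show "z = poly a \<epsilon> / poly b \<epsilon>"
    using z assms b' by (simp add: frac_eq_eq)
qed

lemma regularE:
  assumes "x \<in> regular \<epsilon>"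
  obtains a b where "x = Fract a b" "poly b \<epsilon> \<noteq> 0" "b \<noteq> 0" "at_eps \<epsilon> x = poly a \<epsilon> / poly b \<epsilon>"
proof -
  obtain a b where "x = Fract a b" "poly b \<epsilon> \<noteq> 0"
    using assms unfolding regular_def by blast
  then show ?thesis
    using that[of a b] at_eps_Fract[of b \<epsilon> a] by force
qed

lemma regular_add:
  assumes "x \<in> regular \<epsilon>" "y \<in> regular \<epsilon>"
  shows "x + y \<in> regular \<epsilon>" and at_eps_add: "at_eps \<epsilon> (x + y) = at_eps \<epsilon> x + at_eps \<epsilon> y"
proof -
  obtain a b where x: "x = Fract a b" "poly b \<epsilon> \<noteq> 0" "b \<noteq> 0"
    using assms(1) by (rule regularE)
  obtain c d where y: "y = Fract c d" "poly d \<epsilon> \<noteq> 0" "d \<noteq> 0"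
    using assms(2) by (rule regularE)
  have eq: "x + y = Fract (a * d + c * b) (b * d)" and bd: "poly (b * d) \<epsilon> \<noteq> 0"
    using x y by simp_all
  show "x + y \<in> regular \<epsilon>"
    unfolding eq using bd by (rule regularI)
  show "at_eps \<epsilon> (x + y) = at_eps \<epsilon> x + at_eps \<epsilon> y"
    unfolding eq at_eps_Fract[OF bd] unfolding x(1) y(1) at_eps_Fract[OF x(2)] at_eps_Fract[OF y(2)]
    using x(2) y(2) by (simp add: add_frac_eq)
qed

lemma regular_mult:
  assumes "x \<in> regular \<epsilon>" "y \<in> regular \<epsilon>"
  shows "x * y \<in> regular \<epsilon>" and at_eps_mult: "at_eps \<epsilon> (x * y) = at_eps \<epsilon> x * at_eps \<epsilon> y"
proof -
  obtain a b where x: "x = Fract a b" "poly b \<epsilon> \<noteq> 0" "b \<noteq> 0"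
    using assms(1) by (rule regularE)
  obtain c d where y: "y = Fract c d" "poly d \<epsilon> \<noteq> 0" "d \<noteq> 0"
    using assms(2) by (rule regularE)
  have eq: "x * y = Fract (a * c) (b * d)" and bd: "poly (b * d) \<epsilon> \<noteq> 0"
    using x y by simp_all
  show "x * y \<in> regular \<epsilon>"
    unfolding eq using bd by (rule regularI)
  show "at_eps \<epsilon> (x * y) = at_eps \<epsilon> x * at_eps \<epsilon> y"
    unfolding eq at_eps_Fract[OF bd] unfolding x(1) y(1) at_eps_Fract[OF x(2)] at_eps_Fract[OF y(2)]
    using x(2) y(2) by (simp add: add_frac_eq)
qed

lemma const_cq_regular [simp]: "const_cq c \<in> regular \<epsilon>"
  and at_eps_const_cq [simp]: "at_eps \<epsilon> (const_cq c) = c"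
  by (auto simp: const_cq_def at_eps_Fract intro!: regularI)

lemma qq_regular [simp]: "qq \<in> regular \<epsilon>"
  and at_eps_qq [simp]: "at_eps \<epsilon> qq = \<epsilon>"
  by (auto simp: qq_def at_eps_Fract intro!: regularI)

lemma const_cq_0 [simp]: "const_cq 0 = 0"
  by (simp add: const_cq_def Zero_fract_def)

lemma const_cq_1 [simp]: "const_cq 1 = 1"
  by (simp add: const_cq_def One_fract_def one_pCons)

lemma const_cq_add: "const_cq (a + b) = const_cq a + const_cq b"
  by (simp add: const_cq_def)

lemma const_cq_mult: "const_cq (a * b) = const_cq a * const_cq b"
  by (simp add: const_cq_def mult.commute)

lemma const_cq_uminus: "const_cq (- a) = - const_cq a"
  by (simp add: const_cq_def)

lemma const_cq_eq_0_iff [simp]: "const_cq a = 0 \<longleftrightarrow> a = 0"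
  by (metis at_eps_const_cq const_cq_0)

lemma regular_0 [simp]: "0 \<in> regular \<epsilon>" and at_eps_0 [simp]: "at_eps \<epsilon> 0 = 0"
  and regular_1 [simp]: "1 \<in> regular \<epsilon>" and at_eps_1 [simp]: "at_eps \<epsilon> 1 = 1"
  using const_cq_regular[of 0] const_cq_regular[of 1] at_eps_const_cq[of _ 0] at_eps_const_cq[of _ 1]
  by simp_all

lemma regular_uminus:
  assumes "x \<in> regular \<epsilon>"
  shows "- x \<in> regular \<epsilon>" and at_eps_uminus: "at_eps \<epsilon> (- x) = - at_eps \<epsilon> x"
  using regular_mult[OF const_cq_regular[of "- 1"] assms] at_eps_mult[OF const_cq_regular[of "- 1"] assms]
  by (simp_all add: const_cq_uminus del: at_eps_const_cq) (simp add: const_cq_uminus[symmetric] const_cq_1[symmetric] del: const_cq_1)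

lemma regular_diff:
  assumes "x \<in> regular \<epsilon>" "y \<in> regular \<epsilon>"
  shows "x - y \<in> regular \<epsilon>" and at_eps_diff: "at_eps \<epsilon> (x - y) = at_eps \<epsilon> x - at_eps \<epsilon> y"
  using regular_add[OF assms(1) regular_uminus(1)[OF assms(2)]]
    at_eps_add[OF assms(1) regular_uminus(1)[OF assms(2)]] at_eps_uminus[OF assms(2)]
  by simp_all

lemma regular_inverse:
  assumes "x \<in> regular \<epsilon>" "at_eps \<epsilon> x \<noteq> 0"
  shows "inverse x \<in> regular \<epsilon>" and at_eps_inverse: "at_eps \<epsilon> (inverse x) = inverse (at_eps \<epsilon> x)"
proof -
  obtain a b where x: "x = Fract a b" "poly b \<epsilon> \<noteq> 0"
    using assms(1) by (rule regularE)
  have a: "poly a \<epsilon> \<noteq> 0"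
    using assms(2) x by (auto simp: at_eps_Fract)
  then show "inverse x \<in> regular \<epsilon>" "at_eps \<epsilon> (inverse x) = inverse (at_eps \<epsilon> x)"
    using x by (simp_all add: at_eps_Fract regularI)
qed

lemma regular_power:
  assumes "x \<in> regular \<epsilon>"
  shows "x ^ n \<in> regular \<epsilon>" and at_eps_power: "at_eps \<epsilon> (x ^ n) = at_eps \<epsilon> x ^ n"
  using assms by (induction n) (auto simp: regular_mult at_eps_mult)

lemma regular_powi:
  assumes "x \<in> regular \<epsilon>" "at_eps \<epsilon> x \<noteq> 0"
  shows "x powi n \<in> regular \<epsilon>" and at_eps_powi: "at_eps \<epsilon> (x powi n) = at_eps \<epsilon> x powi n"
  unfolding power_int_def
  using assms by (auto simp: regular_power at_eps_power regular_inverse at_eps_inverse)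

lemma at_eps_eq_0D:
  assumes "x \<in> regular \<epsilon>" "at_eps \<epsilon> x = 0"
  obtains y where "y \<in> regular \<epsilon>" "x = (qq - const_cq \<epsilon>) * y"
proof -
  obtain a b where x: "x = Fract a b" and b: "poly b \<epsilon> \<noteq> 0" and e: "at_eps \<epsilon> x = poly a \<epsilon> / poly b \<epsilon>"
    using assms(1) by (rule regularE)
  have "poly a \<epsilon> = 0"
    using e b assms(2) by simp
  then obtain c where "a = [:- \<epsilon>, 1:] * c"
    by (auto simp: poly_eq_0_iff_dvd)
  then have "x = (qq - const_cq \<epsilon>) * Fract c b"
    by (simp add: x qq_def const_cq_def)
  then show ?thesis
    using that b regularI by blast
qed

lemma qq_nonzero [simp]: "qq \<noteq> 0"
  using at_eps_qq[of 1] by force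

lemma qq_powi_eq_1_iff: "qq powi n = 1 \<longleftrightarrow> n = 0"
proof
  assume "qq powi n = 1"
  then have "(2::complex) powi n = 1"
    using at_eps_powi[of qq 2 n] by simp
  then have "norm ((2::complex) powi n) = 1"
    by simp
  then have *: "(2::real) powi n = 1"
    by (simp add: norm_power_int)
  show "n = 0"
    using power_int_strict_increasing[of 0 n "2::real"] power_int_strict_increasing[of n 0 "2::real"] *
    by (cases n "0::int" rule: linorder_cases) auto
qed auto

subsection \<open>Laurent polynomials\<close>

lemma laurent_poly: "Fract a 1 \<in> laurent"
  unfolding laurent_def by (rule CollectI, rule exI[of _ a], rule exI[of _ 0]) simp

lemma laurent_qq_powi: "qq powi k \<in> laurent"
  unfolding laurent_def by (rule CollectI, rule exI[of _ 1], rule exI[of _ k]) (simp add: One_fract_def)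

lemma Fract_qq_power: "qq ^ n = Fract (monom 1 n) 1"
  by (induction n) (simp_all add: One_fract_def qq_def monom_Suc)

lemma Fract_1_add: "Fract (a + b) 1 = Fract a 1 + Fract b 1"
  and Fract_1_mult: "Fract (a * b) 1 = Fract a 1 * Fract b 1"
  by simp_all

lemma laurent_add:
  assumes "x \<in> laurent" "y \<in> laurent"
  shows "x + y \<in> laurent"
proof -
  have *: "Fract a 1 * qq powi k + Fract b 1 * qq powi l \<in> laurent" if "k \<le> l" for a b k l
  proof -
    have "l = int (nat (l - k)) + k"
      using that by simp
    then have "qq powi l = Fract (monom 1 (nat (l - k))) 1 * qq powi k"
      unfolding Fract_qq_power[symmetric] by (metis power_int_add power_int_of_nat qq_nonzero)
    then have "Fract a 1 * qq powi k + Fract b 1 * qq powi l =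
        Fract (a + b * monom 1 (nat (l - k))) 1 * qq powi k"
      unfolding Fract_1_add Fract_1_mult by (simp add: distrib_right del: add_fract mult_fract)
    then show ?thesis
      unfolding laurent_def by blast
  qed
  obtain a k b l where "x = Fract a 1 * qq powi k" "y = Fract b 1 * qq powi l"
    using assms unfolding laurent_def by blast
  then show ?thesis
    using *[of k l a b] *[of l k b a] by (cases "k \<le> l") (simp_all only: add.commute not_le less_imp_le)
qed

lemma laurent_mult:
  assumes "x \<in> laurent" "y \<in> laurent"
  shows "x * y \<in> laurent"
proof -
  obtain a k b l where "x = Fract a 1 * qq powi k" "y = Fract b 1 * qq powi l"
    using assms unfolding laurent_def by blast
  then have "x * y = Fract (a * b) 1 * qq powi (k + l)"
    unfolding Fract_1_mult by (simp add: power_int_add mult_ac del: mult_fract)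
  then show ?thesis
    unfolding laurent_def by blast
qed

lemma const_cq_laurent [simp]: "const_cq c \<in> laurent"
  unfolding const_cq_def by (rule laurent_poly)

lemma qq_laurent [simp]: "qq \<in> laurent"
  unfolding qq_def by (rule laurent_poly)

lemma laurent_0 [simp]: "0 \<in> laurent" and laurent_1 [simp]: "1 \<in> laurent"
  using const_cq_laurent[of 0] const_cq_laurent[of 1] by simp_all

lemma laurent_uminus: "x \<in> laurent \<Longrightarrow> - x \<in> laurent"
  using laurent_mult[OF const_cq_laurent[of "- 1"]] by (fastforce simp: const_cq_uminus)

lemma laurent_diff: "x \<in> laurent \<Longrightarrow> y \<in> laurent \<Longrightarrow> x - y \<in> laurent"
  using laurent_add[of x "- y"] laurent_uminus[of y] by simp

lemma laurent_regular:
  assumes "\<epsilon> \<noteq> 0" "x \<in> laurent"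
  shows "x \<in> regular \<epsilon>"
proof -
  obtain a k where x: "x = Fract a 1 * qq powi k"
    using assms unfolding laurent_def by blast
  show ?thesis
    unfolding x using assms(1)
    by (intro regular_mult(1) regular_powi(1) regularI) simp_all
qed

text \<open>The kernel of evaluation on the Laurent polynomials is generated by \<open>q - \<epsilon>\<close> too: up to a power of \<open>q\<close>
  the difference is a polynomial with root \<open>\<epsilon>\<close>.\<close>

lemma laurent_at_eps:
  assumes "\<epsilon> \<noteq> 0" "x \<in> laurent"
  obtains y where "y \<in> laurent" "x = const_cq (at_eps \<epsilon> x) + (qq - const_cq \<epsilon>) * y"
proof -
  define z where "z = x - const_cq (at_eps \<epsilon> x)"
  have z: "z \<in> laurent" "at_eps \<epsilon> z = 0"
    using assms laurent_regular unfolding z_def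
    by (auto intro!: laurent_diff simp: at_eps_diff)
  obtain a k where a: "z = Fract a 1 * qq powi k"
    using z(1) unfolding laurent_def by blast
  have "at_eps \<epsilon> z = at_eps \<epsilon> (Fract a 1) * at_eps \<epsilon> (qq powi k)"
    unfolding a using assms(1)
    by (intro at_eps_mult[OF regularI[of 1 \<epsilon> a] regular_powi(1)[of qq \<epsilon> k]]) simp_all
  also have "\<dots> = poly a \<epsilon> * \<epsilon> powi k"
    using assms(1) by (simp add: at_eps_Fract at_eps_powi)
  finally have "poly a \<epsilon> = 0"
    using z(2) assms(1) by simp
  then obtain c where "a = [:- \<epsilon>, 1:] * c"
    by (auto simp: poly_eq_0_iff_dvd)
  then have "z = (qq - const_cq \<epsilon>) * (Fract c 1 * qq powi k)"
    by (simp add: a qq_def const_cq_def)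
  moreover have "Fract c 1 * qq powi k \<in> laurent"
    by (intro laurent_mult laurent_poly laurent_qq_powi)
  ultimately show ?thesis
    using that unfolding z_def by (metis add_diff_cancel_left' diff_add_cancel add.commute)
qed

section \<open>Quantum integers and quantum binomials\<close>

lemma qq_powi_add: "qq powi (m + n) = qq powi m * qq powi n"
  by (simp add: power_int_add)

lemma qq_powi_diff: "qq powi (m - n) = qq powi m * inverse (qq powi n)"
  by (simp add: power_int_diff divide_inverse)

lemma qq_powi_uminus: "qq powi (- m) = inverse (qq powi m)"
  by (simp add: power_int_minus)

lemma qq_minus_inverse_nonzero [simp]: "qq - inverse qq \<noteq> 0" "qq \<noteq> inverse qq" "qq * qq \<noteq> 1"
proof -
  show "qq * qq \<noteq> 1"
    using qq_powi_eq_1_iff[of 2] by (simp add: power2_eq_square)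
  then show "qq \<noteq> inverse qq"
    by (metis qq_nonzero right_inverse)
  then show "qq - inverse qq \<noteq> 0"
    by simp
qed

lemma qint_alt: "qint n = (qq powi n - inverse (qq powi n)) * inverse (qq - inverse qq)"
  by (simp add: qint_def qq_powi_uminus divide_inverse)

lemma qint_0 [simp]: "qint 0 = 0"
  by (simp add: qint_def)

lemma qint_1 [simp]: "qint 1 = 1"
  by (simp add: qint_def power_int_minus)

lemma qint_uminus: "qint (- n) = - qint n"
  by (simp add: qint_def minus_divide_left)

lemma qint_add: "qint (m + n) = qq powi n * qint m + qq powi (- m) * qint n"
proof -
  have "(u * v - inverse (u * v)) * d = v * ((u - inverse u) * d) + inverse u * ((v - inverse v) * d)"
    if "u \<noteq> 0" "v \<noteq> 0" for u v d :: cq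
    using that by (simp add: field_simps)
  then show ?thesis
    by (simp add: qint_alt qq_powi_add qq_powi_uminus)
qed

lemma qint_eq_0_iff [simp]: "qint n = 0 \<longleftrightarrow> n = 0"
proof
  assume "qint n = 0"
  then have "qq powi (2 * n) = 1"
    unfolding mult_2 qq_powi_add by (auto simp: qint_alt field_simps)
  then show "n = 0"
    using qq_powi_eq_1_iff[of "2 * n"] by simp
qed simp

lemma qfact_0 [simp]: "qfact 0 = 1"
  by (simp add: qfact_def)

lemma qfact_Suc: "qfact (Suc n) = qfact n * qint (int (Suc n))"
  by (simp add: qfact_def)

lemma qfact_nonzero [simp]: "qfact n \<noteq> 0"
  by (simp add: qfact_def)

lemma qint_laurent: "qint n \<in> laurent"
proof (induction n rule: int_induct[where k = 0])
  case (step1 i)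
  then show ?case
    unfolding qint_add[of i 1] by (auto intro!: laurent_add laurent_mult laurent_qq_powi)
next
  case (step2 i)
  have "qint (i - 1) = qq powi (- 1) * qint i + qq powi (- i) * qint (- 1)"
    using qint_add[of i "- 1"] by simp
  then show ?case
    unfolding qint_uminus[of 1]
    by (simp only:, intro laurent_add laurent_mult laurent_qq_powi laurent_uminus step2) simp
qed simp

text \<open>The elements \<open>[K;n;t] = [K;n] [K;n-1] \<dots> [K;n-t+1] / [t]!\<close> occur in the quantum group and, for
  \<open>K = q^m\<close>, in the field itself, where they are the quantum binomials of \<open>m + n\<close> over \<open>t\<close>. The identities
  between them are proved once, for an invertible element of an algebra over the rational functions,
  and the parallel recursions show that \<open>[K;n;t]\<close> acts on weight \<open>m\<close> by this binomial.\<close>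

locale torus =
  fixes c :: "cq \<Rightarrow> 'a :: {ring, monoid_mult}" and k ki :: 'a
  assumes c_add: "c (a + b) = c a + c b"
    and c_mult: "c (a * b) = c a * c b"
    and c_1: "c 1 = 1"
    and c_central: "x * c a = c a * x"
    and k_ki: "k * ki = 1"
    and ki_k: "ki * k = 1"
begin

lemma c_0: "c 0 = 0"
  using c_add[of 0 0] by simp

lemma c_uminus: "c (- a) = - c a"
  using c_add[of a "- a"] by (simp add: c_0 eq_neg_iff_add_eq_0 add.commute)

lemma c_diff: "c (a - b) = c a - c b"
  using c_add[of a "- b"] by (simp add: c_uminus)

lemma c_left_commute: "x * (c a * y) = c a * (x * y)"
  by (metis c_central mult.assoc)

definition lin :: "int \<Rightarrow> 'a" where
  "lin n = c (inverse (qq - inverse qq)) * (c (qq powi n) * k - c (qq powi (- n)) * ki)"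

definition fall :: "int \<Rightarrow> nat \<Rightarrow> 'a" where
  "fall n t = prod_list (map (\<lambda>i. lin (n - int i)) [0..<t])"

definition Kb :: "int \<Rightarrow> nat \<Rightarrow> 'a" where
  "Kb n t = c (inverse (qfact t)) * fall n t"

lemma lin_scaled:
  "c a * lin n = c (a * inverse (qq - inverse qq) * qq powi n) * k
     - c (a * inverse (qq - inverse qq) * qq powi (- n)) * ki"
  by (simp add: lin_def right_diff_distrib c_mult mult.assoc)

lemma c_c: "c a * (c b * x) = c (a * b) * x"
  by (simp add: c_mult mult.assoc)

lemma lin_c: "lin n * (c a * x) = c a * (lin n * x)"
  and ki_c: "ki * (c a * x) = c a * (ki * x)"
  by (rule c_left_commute)+

lemma lin_commute: "lin m * lin n = lin n * lin m"
proof -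
  have prod: "(c a * x) * (c b * y) = c (a * b) * (x * y)" for a b x y
    by (metis c_central c_mult mult.assoc)
  have "(c a * k - c b * ki) * (c a' * k - c b' * ki) = (c a' * k - c b' * ki) * (c a * k - c b * ki)"
    for a b a' b'
    by (simp only: left_diff_distrib right_diff_distrib prod k_ki ki_k) (simp add: mult.commute)
  then show ?thesis
    using lin_scaled[of 1] by (simp only: c_1 mult_1)
qed

lemma fall_0 [simp]: "fall n 0 = 1"
  by (simp add: fall_def)

lemma fall_Suc: "fall n (Suc t) = fall n t * lin (n - int t)"
  by (simp add: fall_def)

lemma fall_add: "fall n (a + b) = fall n a * fall (n - int a) b"
  by (induction b) (simp_all add: fall_Suc mult.assoc algebra_simps)

lemma fall_Suc_left: "fall n (Suc t) = lin n * fall (n - 1) t"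
  using fall_add[of n 1 t] fall_Suc[of n 0] by simp

lemma lin_fall: "lin m * fall n t = fall n t * lin m"
proof (induction t)
  case (Suc t)
  have "lin m * fall n (Suc t) = fall n t * (lin m * lin (n - int t))"
    unfolding fall_Suc by (metis Suc mult.assoc)
  then show ?case
    unfolding fall_Suc by (metis lin_commute mult.assoc)
qed simp

lemma fall_c: "fall n t * (c a * x) = c a * (fall n t * x)"
  by (rule c_left_commute)

lemmas c_normal = c_c lin_c ki_c fall_c mult.assoc

lemma Kb_0 [simp]: "Kb n 0 = 1"
  by (simp add: Kb_def c_1)

lemma Kb_1: "Kb n 1 = lin n"
  using fall_Suc[of n 0] qfact_Suc[of 0] by (simp add: Kb_def c_1)

text \<open>Identities that are linear in \<open>[K;n]\<close> amount to one identity in \<open>q\<close> for the coefficient of \<open>K\<close> and one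
  for the coefficient of its inverse.\<close>

lemma lin_pascal: "lin (n + 1) = c (qq powi (1 + int t)) * lin (n - int t) + c (qint (1 + int t) * qq powi (int t - n)) * ki"
proof -
  have "qq powi (n + 1) = qq powi (1 + int t) * qq powi (n - int t)"
    by (simp add: add.commute flip: qq_powi_add)
  moreover have "inverse (qq - inverse qq) * qq powi (- (n + 1)) =
    qq powi (1 + int t) * inverse (qq - inverse qq) * qq powi (- (n - int t)) -
       qint (1 + int t) * qq powi (int t - n)"
  proof -
    have "d * inverse (u * q) = w * q * d * (w * inverse u) - (w * q - inverse (w * q)) * d * (w * inverse u)"
      if "u \<noteq> 0" "w \<noteq> 0" "q \<noteq> 0" for u w q d :: cq
      using that by (simp add: field_simps)
    from this[of "qq powi n" "qq powi int t" qq "inverse (qq - inverse qq)"] show ?thesis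
      by (simp only: qint_alt qq_powi_add qq_powi_diff qq_powi_uminus) (simp add: mult_ac)
  qed
  ultimately show ?thesis
    unfolding lin_scaled[of 1 "n + 1", unfolded c_1 mult_1] lin_scaled
    by (simp only: c_diff mult_1 left_diff_distrib) (simp add: ac_simps)
qed

lemma Kb_pascal:
  "Kb (n + 1) (Suc t) =
     c (qq powi (1 + int t)) * Kb n (Suc t) + c (qq powi (int t - n)) * (ki * Kb n t)"
proof -
  let ?f = "c (inverse (qfact (Suc t)))"
  have f: "inverse (qfact (Suc t)) * qint (1 + int t) = inverse (qfact t)"
    by (simp add: qfact_Suc)
  have "Kb (n + 1) (Suc t) = ?f * (lin (n + 1) * fall n t)"
    unfolding Kb_def by (simp add: fall_Suc_left)
  also have "\<dots> = ?f * (c (qq powi (1 + int t)) * lin (n - int t) * fall n t) +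
     ?f * (c (qint (1 + int t) * qq powi (int t - n)) * ki * fall n t)"
    unfolding lin_pascal[of n t] by (simp add: distrib_left distrib_right mult.assoc)
  also have "?f * (c (qq powi (1 + int t)) * lin (n - int t) * fall n t) =
      c (qq powi (1 + int t)) * Kb n (Suc t)"
    by (simp add: Kb_def fall_Suc lin_fall c_normal ac_simps)
  also have "?f * (c (qint (1 + int t) * qq powi (int t - n)) * ki * fall n t) =
     c (inverse (qfact (Suc t)) * qint (1 + int t)) * c (qq powi (int t - n)) * ki * fall n t"
    by (simp add: c_mult mult.assoc)
  also have "\<dots> = c (qq powi (int t - n)) * (ki * Kb n t)"
    unfolding f by (simp add: Kb_def c_normal ac_simps)
  finally show ?thesis .
qed

lemma Kb_add:
  "c (qfact (a + b) / (qfact a * qfact b)) * Kb n (a + b) = Kb n a * Kb (n - int a) b"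
proof -
  have "Kb n a * Kb (n - int a) b = c (inverse (qfact a)) * (c (inverse (qfact b)) * fall n (a + b))"
    by (simp add: Kb_def fall_add c_normal ac_simps)
  also have "\<dots> = c (inverse (qfact a * qfact b)) * fall n (a + b)"
    by (simp add: c_mult mult.assoc)
  also have "\<dots> = c (qfact (a + b) / (qfact a * qfact b)) * Kb n (a + b)"
    unfolding Kb_def by (simp add: mult.assoc[symmetric] c_mult[symmetric] field_simps)
  finally show ?thesis ..
qed

lemma lin_kostant:
  "c (qint a) * lin x = c (qint (a - j)) * lin (x - j) + c (qint j) * lin (x - j + a)"
proof -
  have "(a - inverse a) * d * x = (a * inverse j - inverse (a * inverse j)) * d * (x * inverse j)
      + (j - inverse j) * d * (x * inverse j * a)"
    "(a - inverse a) * d * inverse x = (a * inverse j - inverse (a * inverse j)) * d * inverse (x * inverse j)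
      + (j - inverse j) * d * inverse (x * inverse j * a)"
    if "a \<noteq> 0" "j \<noteq> 0" "x \<noteq> 0" for a j x d :: cq
    using that by (simp_all add: field_simps)
  from this[of "qq powi a" "qq powi j" "qq powi x" "inverse (qq - inverse qq)"]
  have "qint a * qq powi x = qint (a - j) * qq powi (x - j) + qint j * qq powi (x - j + a)"
    "qint a * qq powi (- x) = qint (a - j) * qq powi (- (x - j)) + qint j * qq powi (- (x - j + a))"
    by (simp_all only: qint_alt qq_powi_add qq_powi_diff qq_powi_uminus qq_nonzero power_int_eq_0_iff simp_thms)
  then show ?thesis
    unfolding lin_scaled mult.assoc mult.left_commute[of _ "inverse (qq - inverse qq)"]
    by (simp add: c_add distrib_left algebra_simps)
qed

text \<open>This combines the two contributions to one monomial in the inductive step of the commutation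
  formula for divided powers. After cancelling the common factors it is \<open>lin_kostant\<close>, the \<open>q\<close>-analogue
  of \<open>a x = (a - j) (x - j) + j (x - j + a)\<close>.\<close>

lemma Kb_kostant:
  "c (qint a) * Kb (d + 1) (Suc j) =
     c (qint (a - int (Suc j))) * Kb d (Suc j) + lin (d - int j + a) * Kb d j"
proof -
  let ?f = "c (inverse (qfact (Suc j)))"
  have f: "inverse (qfact (Suc j)) * qint (int (Suc j)) = inverse (qfact j)"
    by (simp add: qfact_Suc)
  have "c (qint a) * Kb (d + 1) (Suc j) = ?f * (c (qint a) * lin (d + 1) * fall d j)"
    unfolding Kb_def by (simp add: fall_Suc_left c_normal ac_simps)
  also have "\<dots> = ?f * (c (qint (a - int (Suc j))) * lin (d - int j) * fall d j) +
     ?f * (c (qint (int (Suc j))) * lin (d - int j + a) * fall d j)"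
    unfolding lin_kostant[of a "d + 1" "int (Suc j)"] by (simp add: algebra_simps)
  also have "?f * (c (qint (a - int (Suc j))) * lin (d - int j) * fall d j) =
      c (qint (a - int (Suc j))) * Kb d (Suc j)"
    by (simp add: Kb_def fall_Suc lin_fall c_normal ac_simps)
  also have "?f * (c (qint (int (Suc j))) * lin (d - int j + a) * fall d j) =
     c (inverse (qfact (Suc j)) * qint (int (Suc j))) * lin (d - int j + a) * fall d j"
    by (simp add: c_mult mult.assoc)
  also have "\<dots> = lin (d - int j + a) * Kb d j"
    unfolding f by (simp add: Kb_def c_normal ac_simps)
  finally show ?thesis .
qed

end

lemma torus_field: "torus (\<lambda>x. x) (qq powi m) (qq powi (- m))"
  by standard (simp_all add: algebra_simps power_int_minus)

lemma lin_field: "torus.lin (\<lambda>x. x) (qq powi m) (qq powi (- m)) n = qint (m + n)"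
  unfolding torus.lin_def[OF torus_field]
  by (simp add: qint_def qq_powi_add qq_powi_diff power_int_minus field_simps)

lemma Kb_field: "torus.Kb (\<lambda>x. x) (qq powi m) (qq powi (- m)) n t = qbinom (m + n) (int t)"
proof -
  have "torus.fall (\<lambda>x. x) (qq powi m) (qq powi (- m)) n t = (\<Prod>i<t. qint (m + n - int i))"
    by (induction t) (simp_all add: torus.fall_0[OF torus_field] torus.fall_Suc[OF torus_field]
      lin_field algebra_simps)
  then show ?thesis
    unfolding torus.Kb_def[OF torus_field] by (simp add: qbinom_def field_simps)
qed

lemma qbinom_0 [simp]: "qbinom n 0 = 1"
  by (simp add: qbinom_def)

lemma qbinom_pascal:
  "qbinom (n + 1) (int (Suc t)) =
     qq powi (1 + int t) * qbinom n (int (Suc t)) + qq powi (int t - n) * qbinom n (int t)"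
  using torus.Kb_pascal[OF torus_field[of 0], of n t] unfolding Kb_field by simp

lemma qbinom_laurent: "qbinom n (int t) \<in> laurent"
proof (induction t arbitrary: n)
  case (Suc t)
  show ?case
  proof (induction n rule: int_induct[where k = 0])
    case base
    have "qbinom 0 (int (Suc t)) = 0"
      by (simp add: qbinom_def nat_add_distrib prod.lessThan_Suc_shift del: prod.lessThan_Suc)
    then show ?case
      by simp
  next
    case (step1 i)
    then show ?case
      unfolding qbinom_pascal
      by (intro laurent_add laurent_mult laurent_qq_powi Suc)
  next
    case (step2 i)
    have "qbinom (i - 1) (int (Suc t)) = qq powi (- (1 + int t)) *
       (qbinom i (int (Suc t)) - qq powi (int t - (i - 1)) * qbinom (i - 1) (int t))"
    proof -
      have "b = inverse a * (x - y)" if "x = a * b + y" "a \<noteq> 0" for a b x y :: cq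
        using that by simp
      from this[OF qbinom_pascal[of "i - 1" t, unfolded diff_add_cancel]] show ?thesis
        by (simp add: qq_powi_uminus del: of_nat_Suc minus_add_distrib)
    qed
    then show ?case
      by (simp only:, intro laurent_diff laurent_mult laurent_qq_powi Suc step2)
  qed
qed simp

lemma prod_qint: "(\<Prod>i<b. qint (int (a + b) - int i)) * qfact a = qfact (a + b)"
proof (induction b)
  case (Suc b)
  have "(\<Prod>i<Suc b. qint (int (a + Suc b) - int i)) = qint (int (a + Suc b)) * (\<Prod>i<b. qint (int (a + b) - int i))"
    by (subst prod.lessThan_Suc_shift) simp
  then show ?case
    using Suc by (simp add: qfact_Suc)
qed simp

lemma qbinom_nat: "qbinom (int (a + b)) (int b) = qfact (a + b) / (qfact a * qfact b)"
  using prod_qint[where a = a and b = b] by (simp add: qbinom_def field_simps)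

lemma qbinom_symmetric: "qbinom (int (a + b)) (int a) = qbinom (int (a + b)) (int b)"
  using qbinom_nat[of a b] qbinom_nat[of b a] by (simp add: ac_simps)

lemma qbinom_vanish: "a < b \<Longrightarrow> qbinom (int a) (int b) = 0"
  unfolding qbinom_def by (auto intro!: bexI[of _ a])

lemma qbinom_diag [simp]: "qbinom (int a) (int a) = 1"
  using qbinom_nat[of 0 a] by simp

lemma qbinom_uminus: "qbinom (- (int a + 1)) (int b) = (- 1) ^ b * qbinom (int (a + b)) (int b)"
proof -
  have "(\<Prod>i<b. qint (- (int a + 1) - int i)) = (\<Prod>i<b. - qint (int a + 1 + int i))"
    by (intro prod.cong refl) (simp add: algebra_simps flip: qint_uminus)
  also have "\<dots> = (- 1) ^ b * (\<Prod>i<b. qint (int a + 1 + int i))"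
    by (simp add: prod_uminus)
  also have "(\<Prod>i<b. qint (int a + 1 + int i)) = (\<Prod>i<b. qint (int (a + b) - int i))"
    by (subst prod.nat_diff_reindex[symmetric], intro prod.cong refl) (simp add: of_nat_diff algebra_simps)
  finally show ?thesis
    by (simp add: qbinom_def)
qed

section \<open>Quantum binomials at a root of unity\<close>

definition unit_at :: "complex \<Rightarrow> cq \<Rightarrow> bool" where
  "unit_at \<epsilon> x \<longleftrightarrow> x \<in> regular \<epsilon> \<and> at_eps \<epsilon> x \<noteq> 0"

lemma unit_at_mult: "unit_at \<epsilon> x \<Longrightarrow> unit_at \<epsilon> y \<Longrightarrow> unit_at \<epsilon> (x * y)"
  by (simp add: unit_at_def regular_mult at_eps_mult)

lemma unit_at_inverse: "unit_at \<epsilon> x \<Longrightarrow> unit_at \<epsilon> (inverse x)"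
  by (simp add: unit_at_def regular_inverse at_eps_inverse)

locale odd_root_of_unity =
  fixes p :: nat and \<epsilon> :: complex
  assumes p_gt_1: "p > 1" and odd_p: "odd p"
    and root: "\<epsilon> ^ p = 1" and primitive: "\<And>k. 0 < k \<Longrightarrow> k < p \<Longrightarrow> \<epsilon> ^ k \<noteq> 1"
begin

lemma eps_nonzero [simp]: "\<epsilon> \<noteq> 0"
  using root p_gt_1 by (auto simp: power_0_left)

lemma eps_power_eq_1_iff: "\<epsilon> ^ n = 1 \<longleftrightarrow> p dvd n"
proof -
  have "\<epsilon> ^ n = \<epsilon> ^ (p * (n div p) + n mod p)"
    by simp
  also have "\<dots> = (\<epsilon> ^ p) ^ (n div p) * \<epsilon> ^ (n mod p)"
    by (simp only: power_add power_mult)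
  finally have "\<epsilon> ^ n = \<epsilon> ^ (n mod p)"
    by (simp add: root)
  then have "\<epsilon> ^ n = 1 \<longleftrightarrow> \<epsilon> ^ (n mod p) = 1"
    by (rule arg_cong)
  also have "\<dots> \<longleftrightarrow> n mod p = 0"
    using primitive[of "n mod p"] p_gt_1 by (cases "n mod p = 0") simp_all
  finally show ?thesis
    by (simp add: dvd_eq_mod_eq_0)
qed

lemma eps_powi_root: "\<epsilon> powi (int p * n) = 1"
  by (simp add: power_int_mult root)

lemma qq_powi_unit: "unit_at \<epsilon> (qq powi n)"
  by (simp add: unit_at_def regular_powi at_eps_powi)

lemma qint_regular: "qint n \<in> regular \<epsilon>"
  by (simp add: laurent_regular qint_laurent)

lemma qbinom_regular: "qbinom n (int t) \<in> regular \<epsilon>"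
  by (simp add: laurent_regular qbinom_laurent)

lemma at_eps_qint:
  "at_eps \<epsilon> (qint (int n)) = (\<epsilon> ^ n - inverse (\<epsilon> ^ n)) / (\<epsilon> - inverse \<epsilon>)"
  and eps_minus_inverse: "\<epsilon> - inverse \<epsilon> \<noteq> 0"
proof -
  have "\<epsilon> ^ 2 \<noteq> 1"
    unfolding eps_power_eq_1_iff
    using odd_p p_gt_1 dvd_imp_le[of p 2] by (cases "p = 2") auto
  then show d: "\<epsilon> - inverse \<epsilon> \<noteq> 0"
    by (simp add: field_simps power2_eq_square)
  let ?d = "qq - inverse qq"
  have *: "inverse qq \<in> regular \<epsilon>" "at_eps \<epsilon> (inverse qq) = inverse \<epsilon>"
    by (simp_all add: regular_inverse at_eps_inverse)
  have D: "?d \<in> regular \<epsilon>" "at_eps \<epsilon> ?d = \<epsilon> - inverse \<epsilon>"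
    using * by (simp_all add: regular_diff at_eps_diff)
  have "at_eps \<epsilon> (qint (int n)) * (\<epsilon> - inverse \<epsilon>) = at_eps \<epsilon> (qint (int n) * ?d)"
    using D qint_regular by (simp add: at_eps_mult)
  also have "qint (int n) * ?d = qq powi int n - qq powi (- int n)"
    by (simp add: qint_def)
  also have "at_eps \<epsilon> \<dots> = \<epsilon> ^ n - inverse (\<epsilon> ^ n)"
    using regular_powi(1)[of qq \<epsilon>] by (simp only: at_eps_diff at_eps_powi at_eps_qq qq_regular eps_nonzero
      not_False_eq_True simp_thms power_int_minus[of \<epsilon>] power_int_of_nat[of \<epsilon>])
  finally show "at_eps \<epsilon> (qint (int n)) = (\<epsilon> ^ n - inverse (\<epsilon> ^ n)) / (\<epsilon> - inverse \<epsilon>)"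
    using d by (simp add: field_simps)
qed

lemma at_eps_qint_eq_0_iff: "at_eps \<epsilon> (qint (int n)) = 0 \<longleftrightarrow> p dvd n"
proof -
  have "at_eps \<epsilon> (qint (int n)) = 0 \<longleftrightarrow> \<epsilon> ^ (2 * n) = 1"
    using eps_minus_inverse by (simp add: at_eps_qint field_simps power_mult power2_eq_square)
  also have "\<dots> \<longleftrightarrow> p dvd n"
    unfolding eps_power_eq_1_iff using odd_p coprime_dvd_mult_right_iff[of p 2 n] by auto
  finally show ?thesis .
qed

text \<open>The quotient of \<open>[a p]\<close> by \<open>[p]\<close> has the value \<open>a\<close> at \<open>\<epsilon>\<close>, by induction with the addition formula, since
  \<open>q^p\<close> has the value \<open>1\<close>.\<close>

lemma qint_multiple:
  assumes "a > 0"
  obtains u where "unit_at \<epsilon> u" "qint (int (a * p)) = qint (int p) * u"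
proof -
  define r where "r a = qint (int (a * p)) / qint (int p)" for a
  have p0: "qint (int p) \<noteq> 0"
    using p_gt_1 by simp
  have "r a \<in> regular \<epsilon> \<and> at_eps \<epsilon> (r a) = of_nat a" for a
  proof (induction a)
    case (Suc a)
    have "r (Suc a) = qq powi int p * r a + qq powi (- int (a * p))"
      using qint_add[of "int (a * p)" "int p"] p0 unfolding r_def
      by (simp add: field_simps)
    moreover have "at_eps \<epsilon> (qq powi int p) = 1" "at_eps \<epsilon> (qq powi (- int (a * p))) = 1"
      using eps_powi_root[of 1] eps_powi_root[of "- int a"]
      by (simp_all add: at_eps_powi ac_simps del: power_int_of_nat)
    ultimately show ?case
      using Suc qq_powi_unit[of "int p"] qq_powi_unit[of "- int (a * p)"]
      by (simp add: unit_at_def regular_add regular_mult at_eps_add at_eps_mult)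
  qed (simp add: r_def)
  then have "unit_at \<epsilon> (r a)"
    using assms by (simp add: unit_at_def)
  moreover have "qint (int (a * p)) = qint (int p) * r a"
    using p0 by (simp add: r_def)
  ultimately show ?thesis
    using that by blast
qed

text \<open>Each multiple of \<open>p\<close> up to \<open>n\<close> contributes one factor \<open>[p]\<close>; everything else is
  a unit at \<open>\<epsilon>\<close>.\<close>

lemma qfact_order:
  obtains u where "unit_at \<epsilon> u" "qfact n = qint (int p) ^ (n div p) * u"
proof -
  have "\<exists>u. unit_at \<epsilon> u \<and> qfact n = qint (int p) ^ (n div p) * u"
  proof (induction n)
    case 0
    then show ?case
      by (auto intro!: exI[of _ 1] simp: unit_at_def)
  next
    case (Suc n)
    then obtain u where u: "unit_at \<epsilon> u" "qfact n = qint (int p) ^ (n div p) * u"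
      by blast
    show ?case
    proof (cases "p dvd Suc n")
      case True
      then obtain a where a: "Suc n = a * p"
        by (metis dvd_def mult.commute)
      then have "a > 0"
        by (cases a) auto
      then obtain v where v: "unit_at \<epsilon> v" "qint (int (a * p)) = qint (int p) * v"
        by (rule qint_multiple)
      have "Suc n div p = Suc (n div p)"
        using True by (simp add: div_Suc dvd_eq_mod_eq_0)
      then have "qfact (Suc n) = qint (int p) ^ (Suc n div p) * (u * v)"
        unfolding qfact_Suc using u(2) v(2) by (simp only: a power_Suc ac_simps)
      then show ?thesis
        using u v unit_at_mult by blast
    next
      case False
      then have "Suc n div p = n div p"
        by (simp add: div_Suc dvd_eq_mod_eq_0)
      moreover have "unit_at \<epsilon> (qint (int (Suc n)))"
        using False at_eps_qint_eq_0_iff qint_regular unfolding unit_at_def by blast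
      ultimately show ?thesis
        using u unit_at_mult[of \<epsilon> u] unfolding qfact_Suc by (auto simp: mult.assoc)
    qed
  qed
  then show ?thesis
    using that by blast
qed

text \<open>The number of factors \<open>[p]\<close> in the binomial is \<open>(a + b) div p - a div p - b div p\<close>, which is the carry
  from the lowest digit in base \<open>p\<close>.\<close>

lemma qbinom_eps_eq_0_iff:
  "qbinom_eps \<epsilon> (int (a + b)) (int b) = 0 \<longleftrightarrow> p \<le> a mod p + b mod p"
proof -
  let ?t = "qint (int p)"
  have p0: "?t \<noteq> 0"
    using p_gt_1 by simp
  obtain u where u: "unit_at \<epsilon> u" "qfact (a + b) = ?t ^ ((a + b) div p) * u"
    by (rule qfact_order)
  obtain v where v: "unit_at \<epsilon> v" "qfact a = ?t ^ (a div p) * v"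
    by (rule qfact_order)
  obtain w where w: "unit_at \<epsilon> w" "qfact b = ?t ^ (b div p) * w"
    by (rule qfact_order)
  define z where "z = u * (inverse v * inverse w)"
  have z: "z \<in> regular \<epsilon>" "at_eps \<epsilon> z \<noteq> 0"
    using unit_at_mult[OF u(1) unit_at_mult[OF unit_at_inverse[OF v(1)] unit_at_inverse[OF w(1)]]] unfolding z_def by (simp_all add: unit_at_def)
  define d where "d = (a mod p + b mod p) div p"
  have d: "(a + b) div p = a div p + b div p + d"
    unfolding d_def by (rule div_add1_eq)
  have "qbinom (int (a + b)) (int b) = ?t ^ d * z"
    unfolding qbinom_nat u(2) v(2) w(2) d power_add z_def using p0 by (simp add: field_simps)
  then have "qbinom_eps \<epsilon> (int (a + b)) (int b) = at_eps \<epsilon> ?t ^ d * at_eps \<epsilon> z"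
    unfolding qbinom_eps_def using z(1) qint_regular[of "int p"]
    by (simp add: at_eps_mult at_eps_power regular_power)
  moreover have "at_eps \<epsilon> ?t = 0"
    using at_eps_qint_eq_0_iff[of p] by simp
  ultimately have "qbinom_eps \<epsilon> (int (a + b)) (int b) = 0 \<longleftrightarrow> d \<noteq> 0"
    using z(2) by simp
  also have "\<dots> \<longleftrightarrow> p \<le> a mod p + b mod p"
    using p_gt_1 by (simp add: d_def div_eq_0_iff not_less)
  finally show ?thesis .
qed

end

section \<open>Divided powers in the quantum group\<close>

abbreviation "lookup \<equiv> Poly_Mapping.lookup"
abbreviation "keys \<equiv> Poly_Mapping.keys"
abbreviation "single \<equiv> Poly_Mapping.single"

lemma poly_mapping_sum_single:
  fixes x :: "'a \<Rightarrow>\<^sub>0 'b :: comm_monoid_add"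
  shows "x = (\<Sum>k\<in>keys x. single k (lookup x k))"
  by (rule poly_mapping_eqI) (simp add: lookup_sum lookup_single when_def not_in_keys_iff_lookup_eq_zero)

lemma poly_mapping_additive_induct [case_names single add]:
  fixes x :: "'a \<Rightarrow>\<^sub>0 'b :: comm_monoid_add"
  assumes single: "\<And>k c. P (single k c)"
    and add: "\<And>x y. P x \<Longrightarrow> P y \<Longrightarrow> P (x + y)"
  shows "P x"
proof -
  have "P (\<Sum>k\<in>S. single k (lookup x k))" if "finite S" for S
    using that
  proof (induction S)
    case empty
    then show ?case
      using single[of _ 0] by simp
  qed (simp add: single add)
  then show ?thesis
    by (subst poly_mapping_sum_single) simp
qed

lemma free_scal_central: "x * free_scal a = free_scal a * x"
  by (induction x rule: poly_mapping_additive_induct)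
     (simp_all add: free_scal_def mult_single distrib_left distrib_right mult.commute)

lemma uq_congI: "r \<in> uq_relators \<Longrightarrow> r = x - y \<Longrightarrow> uq_cong x y"
  using uq_ideal.gen[of r 1 1] by (simp add: uq_cong_def)

lemma uq_cong_refl: "uq_cong x x"
  by (simp add: uq_cong_def uq_ideal.zero)

interpretation U: torus scal uK uKinv
proof
  show "scal (a + b) = scal a + scal b" for a b
    by transfer (simp add: free_scal_def single_add uq_cong_refl)
  show "scal (a * b) = scal a * scal b" for a b
    by transfer (simp add: free_scal_def mult_single uq_cong_refl)
  show "scal 1 = 1"
    by transfer (simp add: free_scal_def uq_cong_refl)
  show "x * scal a = scal a * x" for x a
    by transfer (simp add: free_scal_central uq_cong_refl)
  show "uK * uKinv = 1"
    by transfer (rule uq_congI, auto simp: uq_relators_def Let_def)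
  show "uKinv * uK = 1"
    by transfer (rule uq_congI, auto simp: uq_relators_def Let_def)
qed

lemma uK_conj: "uK * x * uKinv = y \<Longrightarrow> uK * x = y * uK"
  by (metis U.ki_k mult.assoc mult_1_right)

lemma uK_uE: "uK * uE = scal (qq powi 2) * uE * uK"
  by (rule uK_conj, transfer) (rule uq_congI, auto simp: uq_relators_def Let_def)

lemma uK_uF: "uK * uF = scal (qq powi (- 2)) * uF * uK"
  by (rule uK_conj, transfer) (rule uq_congI, auto simp: uq_relators_def Let_def)

lemma uE_uF: "uE * uF = uF * uE + U.lin 0"
proof -
  have "uE * uF - uF * uE = scal (inverse (qq - inverse qq)) * (uK - uKinv)"
    by transfer (rule uq_congI, auto simp: uq_relators_def Let_def)
  then show ?thesis
    by (simp add: U.lin_def U.c_1 algebra_simps)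
qed

text \<open>If conjugation by \<open>K\<close> multiplies \<open>x\<close> by \<open>q^d\<close>, then moving \<open>K\<close> past \<open>x\<close> amounts to the substitution
  of \<open>q^(-d) K\<close> for \<open>K\<close>.\<close>

lemma weight_lin:
  assumes "uK * x = scal (qq powi d) * x * uK"
  shows "x * U.lin n = U.lin (n - d) * x"
proof -
  have K: "x * uK = scal (qq powi (- d)) * (uK * x)"
    unfolding assms by (simp add: U.c_c U.c_1 mult.assoc qq_powi_uminus)
  have "uKinv * (x * uK) * uKinv = uKinv * (scal (qq powi (- d)) * (uK * x)) * uKinv"
    unfolding K ..
  also have "uKinv * (scal (qq powi (- d)) * (uK * x)) * uKinv = scal (qq powi (- d)) * ((uKinv * uK) * (x * uKinv))"
    by (simp only: U.ki_c mult.assoc)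
  finally have "uKinv * x * (uK * uKinv) = scal (qq powi (- d)) * ((uKinv * uK) * (x * uKinv))"
    by (simp only: mult.assoc)
  then have "uKinv * x = scal (qq powi (- d)) * (x * uKinv)"
    by (simp add: U.k_ki U.ki_k)
  then have "scal (qq powi d) * (uKinv * x) = x * uKinv"
    by (simp add: U.c_c U.c_1 mult.assoc qq_powi_uminus)
  then have Ki: "x * uKinv = scal (qq powi d) * (uKinv * x)"
    ..
  show ?thesis
    unfolding U.lin_def
    by (simp add: right_diff_distrib left_diff_distrib U.c_left_commute[of x] K Ki U.c_c mult.assoc
      qq_powi_diff qq_powi_uminus ac_simps)
qed

lemma weight_Kb:
  assumes "uK * x = scal (qq powi d) * x * uK"
  shows "x * U.Kb n t = U.Kb (n - d) t * x"
proof -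
  have "x * U.fall n t = U.fall (n - d) t * x"
  proof (induction t)
    case (Suc t)
    have "x * U.fall n (Suc t) = (x * U.fall n t) * U.lin (n - int t)"
      by (simp add: U.fall_Suc mult.assoc)
    also have "\<dots> = U.fall (n - d) t * (x * U.lin (n - int t))"
      unfolding Suc by (simp add: mult.assoc)
    also have "\<dots> = U.fall (n - d) (Suc t) * x"
      unfolding weight_lin[OF assms] by (simp add: U.fall_Suc mult.assoc algebra_simps)
    finally show ?case .
  qed simp
  then show ?thesis
    unfolding U.Kb_def by (simp add: U.c_left_commute mult.assoc)
qed

lemma weight_power:
  assumes "uK * x = scal (qq powi d) * x * uK"
  shows "uK * x ^ r = scal (qq powi (int r * d)) * x ^ r * uK"
proof (induction r)
  case (Suc r)
  have "uK * x ^ Suc r = (uK * x) * x ^ r"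
    by (simp add: mult.assoc)
  also have "\<dots> = scal (qq powi d) * x * (uK * x ^ r)"
    unfolding assms by (simp add: mult.assoc)
  also have "\<dots> = scal (qq powi (int (Suc r) * d)) * x ^ Suc r * uK"
    unfolding Suc by (simp add: U.c_left_commute[of x] U.c_c mult.assoc distrib_right qq_powi_add)
  finally show ?case .
qed (simp add: U.c_1)

lemma weight_scal:
  assumes "uK * x = scal (qq powi d) * x * uK"
  shows "uK * (scal a * x) = scal (qq powi d) * (scal a * x) * uK"
  using assms by (simp add: U.c_left_commute[of uK] U.c_c mult.assoc mult.commute)

lemma weight_divF: "uK * divF r = scal (qq powi (- 2 * int r)) * divF r * uK"
  using weight_scal[OF weight_power[OF uK_uF]] by (simp add: divF_def mult.commute)

lemma divE_0 [simp]: "divE 0 = 1" and divF_0 [simp]: "divF 0 = 1"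
  by (simp_all add: divE_def divF_def U.c_1)

lemma uE_divE: "uE * divE r = scal (qint (int (Suc r))) * divE (Suc r)"
proof -
  have "qint (int (Suc r)) * inverse (qfact (Suc r)) = inverse (qfact r)"
    by (simp add: qfact_Suc)
  then show ?thesis
    by (simp only: divE_def U.c_left_commute[of uE] U.c_c power_Suc)
qed

text \<open>With zero for a negative exponent, sums in the commutation formula need no side conditions
  on the indices.\<close>

definition dF :: "int \<Rightarrow> uq" where
  "dF k = (if k < 0 then 0 else divF (nat k))"

lemma dF_of_nat [simp]: "dF (int k) = divF k"
  by (simp add: dF_def)

lemma uE_uF_power: "uE * uF ^ Suc k = uF ^ Suc k * uE + scal (qint (int (Suc k))) * (uF ^ k * U.lin (- int k))"
proof (induction k)
  case 0
  then show ?case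
    by (simp add: uE_uF U.c_1)
next
  case (Suc k)
  have lin_uF: "U.lin n * uF = uF * U.lin (n - 2)" for n
    using weight_lin[OF uK_uF, of "n - 2"] by simp
  have "uE * uF ^ Suc (Suc k) = (uE * uF ^ Suc k) * uF"
    by (simp only: power_Suc2[of _ "Suc k"] mult.assoc)
  also have "\<dots> = uF ^ Suc k * (uE * uF) + scal (qint (int (Suc k))) * (uF ^ k * (U.lin (- int k) * uF))"
    unfolding Suc by (simp add: distrib_right mult.assoc)
  also have "\<dots> = uF ^ Suc (Suc k) * uE + uF ^ Suc k * U.lin 0
      + scal (qint (int (Suc k))) * (uF ^ Suc k * U.lin (- int (Suc k) - 1))"
  proof -
    have "uF ^ Suc k * uF = uF ^ Suc (Suc k)" "uF ^ k * uF = uF ^ Suc k"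
      by (rule power_Suc2[symmetric])+
    moreover have "- int k - 2 = - int (Suc k) - 1"
      by simp
    ultimately show ?thesis
      unfolding lin_uF uE_uF distrib_left by (simp only: mult.assoc[symmetric])
  qed
  also have "\<dots> = uF ^ Suc (Suc k) * uE + uF ^ Suc k *
     (scal (qint (int (Suc k))) * U.lin (- int (Suc k) - 1) + U.lin 0)"
    by (simp only: distrib_left U.c_left_commute[of "uF ^ Suc k"] add.assoc add.commute[of "uF ^ Suc k * U.lin 0"])
  also have "scal (qint (int (Suc k))) * U.lin (- int (Suc k) - 1) + U.lin 0
      = scal (qint (int (Suc (Suc k)))) * U.lin (- int (Suc k))"
    using U.lin_kostant[of "int (Suc (Suc k))" "- int (Suc k)" 1] by (simp add: U.c_1)
  finally show ?case
    by (simp add: U.c_left_commute)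
qed

lemma uE_dF: "uE * dF k = dF k * uE + dF (k - 1) * U.lin (1 - k)"
proof (cases "k \<le> 0")
  case True
  then show ?thesis
    by (cases "k = 0") (auto simp: dF_def)
next
  case False
  define m where "m = nat (k - 1)"
  have k: "k = int (Suc m)"
    using False by (simp add: m_def)
  have k1: "k - 1 = int m" "1 - k = - int m"
    by (simp_all add: k)
  have q: "inverse (qfact (Suc m)) * qint (int (Suc m)) = inverse (qfact m)"
    by (simp add: qfact_Suc)
  have "uE * divF (Suc m) = scal (inverse (qfact (Suc m))) * (uE * uF ^ Suc m)"
    by (simp only: divF_def U.c_left_commute[of uE])
  also have "\<dots> = divF (Suc m) * uE + divF m * U.lin (- int m)"
    by (simp only: uE_uF_power divF_def distrib_left U.c_c mult.assoc q)
  finally show ?thesis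
    by (simp only: k1) (simp only: k dF_of_nat)
qed

text \<open>The commutation formula of Kostant. In the inductive step \<open>e\<close> is moved past \<open>f^(k-j)\<close> in each term,
  which leaves the monomial unchanged or raises \<open>j\<close> by one. After a shift of the summation index the
  two coefficients of each monomial are combined by \<open>Kb_kostant\<close>.\<close>

lemma divE_dF:
  "divE r * dF k = (\<Sum>j\<le>r. dF (k - int j) * U.Kb (2 * int j - int r - k) j * divE (r - j))"
proof (induction r)
  case (Suc r)
  let ?b = "qint (int (Suc r))"
  define d where "d j = 2 * int j - int r - k" for j
  define g where "g j = dF (k - int j) * (scal (qint (int (Suc r) - int j)) * U.Kb (d j - 2) j) * divE (Suc r - j)" for j
  define h where "h j = dF (k - int j - 1) * (U.lin (d j - int j + int (Suc r)) * U.Kb (d j) j) * divE (r - j)" for j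
  have step: "uE * (dF (k - int j) * U.Kb (d j) j * divE (r - j)) = g j + h j" if "j \<le> r" for j
  proof -
    have Suc_diff: "Suc r - j = Suc (r - j)" "int (Suc r) - int j = int (Suc (r - j))"
      using that by auto
    have "uE * (dF (k - int j) * U.Kb (d j) j * divE (r - j)) =
       dF (k - int j) * ((uE * U.Kb (d j) j) * divE (r - j)) +
       dF (k - int j - 1) * (U.lin (1 - (k - int j)) * U.Kb (d j) j) * divE (r - j)"
      by (simp add: mult.assoc[symmetric] uE_dF distrib_right)
    also have "(uE * U.Kb (d j) j) * divE (r - j) =
        scal (qint (int (Suc r) - int j)) * U.Kb (d j - 2) j * divE (Suc r - j)"
      unfolding weight_Kb[OF uK_uE] mult.assoc uE_divE Suc_diff by (simp add: U.c_left_commute mult.assoc)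
    also have "1 - (k - int j) = d j - int j + int (Suc r)"
      by (simp add: d_def)
    finally show ?thesis
      by (simp add: g_def h_def mult.assoc)
  qed
  have "scal ?b * (divE (Suc r) * dF k) = uE * (divE r * dF k)"
    by (simp only: mult.assoc[symmetric] uE_divE)
  also have "\<dots> = (\<Sum>j\<le>r. g j) + (\<Sum>j\<le>r. h j)"
    unfolding Suc.IH sum_distrib_left sum.distrib[symmetric] using step by (simp add: d_def)
  also have "(\<Sum>j\<le>r. g j) = (\<Sum>j\<le>Suc r. g j)"
    by (simp add: g_def U.c_0)
  also have "\<dots> = g 0 + (\<Sum>j\<le>r. g (Suc j))"
    by (rule sum.atMost_Suc_shift)
  also have "g 0 + (\<Sum>j\<le>r. g (Suc j)) + (\<Sum>j\<le>r. h j) = g 0 + (\<Sum>j\<le>r. g (Suc j) + h j)"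
    by (simp add: sum.distrib add.assoc)
  also have "g 0 = scal ?b * (dF k * divE (Suc r))"
    by (simp add: g_def U.c_left_commute mult.assoc)
  also have "(\<Sum>j\<le>r. g (Suc j) + h j) =
     (\<Sum>j\<le>r. scal ?b * (dF (k - int (Suc j)) * U.Kb (d j + 1) (Suc j) * divE (r - j)))"
  proof (rule sum.cong[OF refl])
    fix j
    have d2: "d (Suc j) - 2 = d j"
      by (simp add: d_def)
    have k1: "k - int j - 1 = k - int (Suc j)"
      by simp
    have "g (Suc j) + h j = dF (k - int (Suc j)) * (scal ?b * U.Kb (d j + 1) (Suc j)) * divE (r - j)"
      unfolding U.Kb_kostant g_def h_def d2 k1 by (simp add: distrib_left distrib_right)
    then show "g (Suc j) + h j = scal ?b * (dF (k - int (Suc j)) * U.Kb (d j + 1) (Suc j) * divE (r - j))"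
      by (simp add: U.c_left_commute mult.assoc)
  qed
  also have "scal ?b * (dF k * divE (Suc r)) + \<dots> =
     scal ?b * (\<Sum>j\<le>Suc r. dF (k - int j) * U.Kb (2 * int j - int (Suc r) - k) j * divE (Suc r - j))"
  proof -
    define e where "e j = dF (k - int j) * U.Kb (2 * int j - int (Suc r) - k) j * divE (Suc r - j)" for j
    have "e (Suc j) = dF (k - int (Suc j)) * U.Kb (d j + 1) (Suc j) * divE (r - j)" for j
    proof -
      have "2 * int (Suc j) - int (Suc r) - k = d j + 1"
        by (simp add: d_def)
      then show ?thesis
        by (simp only: e_def diff_Suc_Suc)
    qed
    moreover have "e 0 = dF k * divE (Suc r)"
      by (simp add: e_def)
    ultimately show ?thesis
      unfolding e_def[symmetric] by (simp only: sum.atMost_Suc_shift sum_distrib_left distrib_left)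
  qed
  finally have "scal (inverse ?b) * (scal ?b * (divE (Suc r) * dF k)) = scal (inverse ?b) * (scal ?b *
      (\<Sum>j\<le>Suc r. dF (k - int j) * U.Kb (2 * int j - int (Suc r) - k) j * divE (Suc r - j)))"
    by (rule arg_cong)
  then show ?case
    by (simp only: U.c_c left_inverse qint_eq_0_iff of_nat_eq_0_iff nat.distinct U.c_1 mult_1
        simp_thms)
qed simp

lemma divE_divF_same:
  "divE t * divF t = (\<Sum>j<t. dF (int t - int j) * U.Kb (2 * int j - int t - int t) j * divE (t - j)) + U.Kb 0 t"
  using divE_dF[of t "int t"] unfolding lessThan_Suc_atMost[symmetric] sum.lessThan_Suc
  by (simp add: dF_def)

lemma Kbinom_eq_Kb: "Kbinom t = U.Kb 0 t"
proof (induction t)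
  case 0
  then show ?case
    by (simp add: Kbinom_def)
next
  case (Suc t)
  let ?d = "inverse (qq - inverse qq)"
  have d: "inverse (qq powi int (Suc t) - qq powi (- int (Suc t))) = inverse (qint (int (Suc t))) * ?d"
  proof -
    have "inverse x = inverse (x / y) * inverse y" if "y \<noteq> 0" for x y :: cq
      using that by (simp add: inverse_eq_divide)
    from this[OF qq_minus_inverse_nonzero(1)] show ?thesis
      unfolding qint_def .
  qed
  define F where "F s = scal (inverse (qq powi int s - qq powi (- int s))) *
      (scal (qq powi (1 - int s)) * uK - scal (qq powi (int s - 1)) * uKinv)" for s
  have "F (Suc t) = scal (inverse (qint (int (Suc t)))) * U.lin (- int t)"
    unfolding F_def d U.lin_def U.c_mult by (simp add: mult.assoc)
  moreover have "Kbinom (Suc t) = Kbinom t * F (Suc t)"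
    unfolding Kbinom_def F_def[symmetric] by simp
  ultimately have "Kbinom (Suc t) = U.Kb 0 t * (scal (inverse (qint (int (Suc t)))) * U.lin (- int t))"
    by (simp only: Suc)
  also have "\<dots> = scal (inverse (qint (int (Suc t))) * inverse (qfact t)) * (U.fall 0 t * U.lin (- int t))"
    by (simp only: U.Kb_def U.c_left_commute[of "U.fall 0 t"] U.c_left_commute[of "scal (inverse (qfact t))"]
      U.c_c mult.assoc mult.commute[of "inverse (qfact t)"])
  also have "\<dots> = U.Kb 0 (Suc t)"
    by (simp add: U.Kb_def U.fall_Suc qfact_Suc mult.commute)
  finally show ?case .
qed

section \<open>The restricted integral form\<close>

lemma res_form_0 [simp]: "0 \<in> res_form" and res_form_1 [simp]: "1 \<in> res_form"
  using res_form.scal[of 0] res_form.scal[of 1] by (simp_all add: U.c_0 U.c_1)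

lemma res_form_uminus: "x \<in> res_form \<Longrightarrow> - x \<in> res_form"
  using res_form.mult[OF res_form.scal[of "- 1"], of x] laurent_uminus[of 1] by (simp add: U.c_uminus U.c_1)

lemma res_form_diff: "x \<in> res_form \<Longrightarrow> y \<in> res_form \<Longrightarrow> x - y \<in> res_form"
  using res_form.add[of x "- y"] res_form_uminus[of y] by simp

lemma res_form_sum: "(\<And>i. i \<in> S \<Longrightarrow> f i \<in> res_form) \<Longrightarrow> sum f S \<in> res_form"
  by (induction S rule: infinite_finite_induct) (auto intro: res_form.add)

lemma res_form_divE: "divE r \<in> res_form" and res_form_divF: "divF r \<in> res_form"
  by (cases "r = 0"; simp add: res_form.divE res_form.divF)+

lemma res_form_dF: "dF k \<in> res_form"
  by (simp add: dF_def res_form_divF)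

text \<open>By \<open>divE_divF_same\<close>, \<open>[K;0;t]\<close> lies in the integral form if the \<open>[K;n;j]\<close> for \<open>j < t\<close> do. The
  Pascal rule, read in both directions, passes to other \<open>n\<close>.\<close>

lemma res_form_Kb: "U.Kb n t \<in> res_form"
proof (induction t arbitrary: n rule: less_induct)
  case (less t)
  show ?case
  proof (cases t)
    case (Suc t')
    have base: "U.Kb 0 t \<in> res_form"
    proof -
      define S where "S = (\<Sum>j<t. dF (int t - int j) * U.Kb (2 * int j - int t - int t) j * divE (t - j))"
      have "U.Kb 0 t = divE t * divF t - S"
        unfolding divE_divF_same S_def by simp
      moreover have "S \<in> res_form"
        unfolding S_def by (intro res_form_sum res_form.mult res_form_dF res_form_divE less) simp
      ultimately show ?thesis
        by (simp only: res_form_diff res_form.mult res_form_divE res_form_divF)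
    qed
    have t': "U.Kb m t' \<in> res_form" for m
      using less Suc by simp
    show ?thesis
    proof (induction n rule: int_induct[where k = 0])
      case base
      show ?case by fact
    next
      case (step1 i)
      then show ?case
        unfolding Suc U.Kb_pascal
        by (intro res_form.add res_form.mult res_form.scal laurent_qq_powi res_form.Kinv t')
    next
      case (step2 i)
      have "scal (qq powi (1 + int t')) * U.Kb (i - 1) t =
          U.Kb i t - scal (qq powi (int t' - (i - 1))) * (uKinv * U.Kb (i - 1) t')"
        using U.Kb_pascal[of "i - 1" t'] by (simp add: Suc)
      then have "scal (qq powi (1 + int t')) * U.Kb (i - 1) t \<in> res_form"
        using step2 by (auto intro!: res_form_diff res_form.mult res_form.scal laurent_qq_powi res_form.Kinv t')
      then have "scal (qq powi (- (1 + int t'))) * (scal (qq powi (1 + int t')) * U.Kb (i - 1) t) \<in> res_form"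
        by (rule res_form.mult[OF res_form.scal[OF laurent_qq_powi]])
      then show ?case
        unfolding U.c_c qq_powi_uminus by (simp add: U.c_1)
    qed
  qed simp
qed

section \<open>Specialization\<close>

lemma UA_simps [simp]:
  "carrier UA = res_form" "x \<otimes>\<^bsub>UA\<^esub> y = x * y" "x \<oplus>\<^bsub>UA\<^esub> y = x + y" "\<one>\<^bsub>UA\<^esub> = 1" "\<zero>\<^bsub>UA\<^esub> = 0"
  by (simp_all add: UA_def)

lemma ring_UA: "ring UA"
proof (rule ringI)
  show "abelian_group UA"
  proof (rule abelian_groupI)
    fix x assume "x \<in> carrier UA"
    then show "\<exists>y\<in>carrier UA. y \<oplus>\<^bsub>UA\<^esub> x = \<zero>\<^bsub>UA\<^esub>"
      by (auto intro!: bexI[of _ "- x"] res_form_uminus)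
  qed (auto intro: res_form.add simp: add_ac)
  show "monoid UA"
    by (rule monoidI) (auto intro: res_form.mult simp: mult.assoc)
qed (auto simp: algebra_simps)

lemma a_minus_UA: "x \<in> res_form \<Longrightarrow> y \<in> res_form \<Longrightarrow> x \<ominus>\<^bsub>UA\<^esub> y = x - y"
proof -
  interpret ring UA by (rule ring_UA)
  assume x: "x \<in> res_form" and y: "y \<in> res_form"
  have "\<ominus>\<^bsub>UA\<^esub> y = - y"
    using y res_form_uminus by (intro minus_equality) auto
  then show ?thesis
    by (simp add: a_minus_def)
qed

abbreviation shifted_q :: "complex \<Rightarrow> uq" where
  "shifted_q \<epsilon> \<equiv> scal (qq - const_cq \<epsilon>)"

lemma shifted_q_res_form [simp]: "shifted_q \<epsilon> \<in> res_form"
  by (intro res_form.scal laurent_diff) simp_all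

text \<open>Since \<open>q - \<epsilon>\<close> is central, its multiples already form a two-sided ideal.\<close>

lemma eps_ideal_eq: "eps_ideal \<epsilon> = {shifted_q \<epsilon> * y | y. y \<in> res_form}"
proof -
  interpret ring UA by (rule ring_UA)
  let ?I = "{shifted_q \<epsilon> * y | y. y \<in> res_form}"
  have "ideal ?I UA"
  proof (rule idealI[OF ring_UA])
    show "subgroup ?I (add_monoid UA)"
    proof
      show "?I \<subseteq> carrier (add_monoid UA)"
        by (auto intro: res_form.mult)
      fix x y assume "x \<in> ?I" "y \<in> ?I"
      then obtain a b where "x = shifted_q \<epsilon> * a" "y = shifted_q \<epsilon> * b" "a \<in> res_form" "b \<in> res_form"
        by blast
      then show "x \<otimes>\<^bsub>add_monoid UA\<^esub> y \<in> ?I"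
        by (auto simp: distrib_left[symmetric] intro!: exI[of _ "a + b"] res_form.add)
    next
      show "\<one>\<^bsub>add_monoid UA\<^esub> \<in> ?I"
        by (auto intro!: exI[of _ 0])
    next
      fix x assume "x \<in> ?I"
      then obtain a where a: "x = shifted_q \<epsilon> * a" "a \<in> res_form"
        by blast
      have "\<ominus>\<^bsub>UA\<^esub> x = shifted_q \<epsilon> * - a"
        using a by (intro minus_equality) (auto intro!: res_form.mult res_form_uminus)
      then show "inv\<^bsub>add_monoid UA\<^esub> x \<in> ?I"
        unfolding a_inv_def[symmetric]
        using res_form_uminus[OF a(2)] by (simp only:) blast
    qed
  next
    fix a x assume "a \<in> ?I" "x \<in> carrier UA"
    then obtain b where b: "a = shifted_q \<epsilon> * b" "b \<in> res_form" "x \<in> res_form"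
      by auto
    show "x \<otimes>\<^bsub>UA\<^esub> a \<in> ?I"
      using b by (auto simp: U.c_left_commute[of x] intro!: exI[of _ "x * b"] res_form.mult)
    show "a \<otimes>\<^bsub>UA\<^esub> x \<in> ?I"
      using b by (auto simp: mult.assoc intro!: exI[of _ "b * x"] res_form.mult)
  qed
  moreover have "{shifted_q \<epsilon>} \<subseteq> ?I"
    by (auto intro!: exI[of _ 1])
  ultimately have "eps_ideal \<epsilon> \<subseteq> ?I"
    unfolding eps_ideal_def by (rule genideal_minimal)
  moreover have "?I \<subseteq> eps_ideal \<epsilon>"
  proof -
    have "ideal (eps_ideal \<epsilon>) UA"
      unfolding eps_ideal_def by (rule genideal_ideal) simp
    then interpret I: ideal "eps_ideal \<epsilon>" UA .
    have "shifted_q \<epsilon> \<in> eps_ideal \<epsilon>"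
      unfolding eps_ideal_def by (rule genideal_self') simp
    then show ?thesis
      using I.I_r_closed by auto
  qed
  ultimately show ?thesis ..
qed

lemma ideal_eps_ideal: "ideal (eps_ideal \<epsilon>) UA"
  unfolding eps_ideal_def by (rule ring.genideal_ideal[OF ring_UA]) simp

lemma ring_U_eps: "ring (U_eps \<epsilon>)"
  unfolding U_eps_def by (rule ideal.quotient_is_ring[OF ideal_eps_ideal])

lemma cls_hom: "cls \<epsilon> \<in> ring_hom UA (U_eps \<epsilon>)"
  unfolding U_eps_def cls_def by (rule ideal.rcos_ring_hom[OF ideal_eps_ideal])

lemma cls_closed [simp]: "x \<in> res_form \<Longrightarrow> cls \<epsilon> x \<in> carrier (U_eps \<epsilon>)"
  and cls_mult: "x \<in> res_form \<Longrightarrow> y \<in> res_form \<Longrightarrow> cls \<epsilon> (x * y) = cls \<epsilon> x \<otimes>\<^bsub>U_eps \<epsilon>\<^esub> cls \<epsilon> y"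
  and cls_add: "x \<in> res_form \<Longrightarrow> y \<in> res_form \<Longrightarrow> cls \<epsilon> (x + y) = cls \<epsilon> x \<oplus>\<^bsub>U_eps \<epsilon>\<^esub> cls \<epsilon> y"
  and cls_1: "cls \<epsilon> 1 = \<one>\<^bsub>U_eps \<epsilon>\<^esub>"
  using ring_hom_closed[OF cls_hom] ring_hom_mult[OF cls_hom] ring_hom_add[OF cls_hom]
    ring_hom_one[OF cls_hom] by simp_all

lemma cls_surj:
  assumes "a \<in> carrier (U_eps \<epsilon>)"
  obtains x where "x \<in> res_form" "a = cls \<epsilon> x"
  using assms unfolding U_eps_def FactRing_def A_RCOSETS_def' cls_def by auto

lemma cls_eq_iff:
  assumes "x \<in> res_form" "y \<in> res_form"
  shows "cls \<epsilon> x = cls \<epsilon> y \<longleftrightarrow> (\<exists>z\<in>res_form. x = y + shifted_q \<epsilon> * z)"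
proof -
  have "cls \<epsilon> x = cls \<epsilon> y \<longleftrightarrow> x - y \<in> eps_ideal \<epsilon>"
    using ring.quotient_eq_iff_same_a_r_cos[OF ring_UA ideal_eps_ideal, of x y \<epsilon>] assms
    unfolding cls_def by (simp add: a_minus_UA)
  also have "\<dots> \<longleftrightarrow> (\<exists>z\<in>res_form. x = y + shifted_q \<epsilon> * z)"
    unfolding eps_ideal_eq by (auto simp: algebra_simps)
  finally show ?thesis .
qed

lemma cls_shifted_q:
  assumes "x \<in> res_form"
  shows "cls \<epsilon> (shifted_q \<epsilon> * x) = \<zero>\<^bsub>U_eps \<epsilon>\<^esub>"
proof -
  have "cls \<epsilon> (shifted_q \<epsilon> * x) = cls \<epsilon> 0"
    using assms by (subst cls_eq_iff) (auto intro: res_form.mult)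
  also have "\<dots> = \<zero>\<^bsub>U_eps \<epsilon>\<^esub>"
    using ring_hom_zero[OF cls_hom ring_UA ring_U_eps] by simp
  finally show ?thesis .
qed

lemma cls_scal:
  assumes "\<epsilon> \<noteq> 0" "a \<in> laurent"
  shows "cls \<epsilon> (scal a) = cscal \<epsilon> (at_eps \<epsilon> a)"
proof -
  obtain b where "b \<in> laurent" "a = const_cq (at_eps \<epsilon> a) + (qq - const_cq \<epsilon>) * b"
    using laurent_at_eps[OF assms] .
  then have "scal a = scal (const_cq (at_eps \<epsilon> a)) + shifted_q \<epsilon> * scal b" "scal b \<in> res_form"
    by (metis U.c_add U.c_mult, simp add: res_form.scal)
  then show ?thesis
    using cls_eq_iff[OF res_form.scal[OF assms(2)] res_form.scal[OF const_cq_laurent]]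
    unfolding cscal_def by blast
qed

section \<open>Modules over the specialization\<close>

locale eps_module = left_module "U_eps \<epsilon>" M for \<epsilon> :: complex and M :: "(uq set, 'm) module" (structure)
begin

abbreviation act :: "uq \<Rightarrow> 'm \<Rightarrow> 'm" where
  "act x m \<equiv> cls \<epsilon> x \<odot> m"

lemma act_closed [simp]: "x \<in> res_form \<Longrightarrow> m \<in> carrier M \<Longrightarrow> act x m \<in> carrier M"
  by (simp add: smult_closed)

lemma act_mult: "x \<in> res_form \<Longrightarrow> y \<in> res_form \<Longrightarrow> m \<in> carrier M \<Longrightarrow> act (x * y) m = act x (act y m)"
  by (simp add: cls_mult smult_assoc1)

lemma act_add: "x \<in> res_form \<Longrightarrow> y \<in> res_form \<Longrightarrow> m \<in> carrier M \<Longrightarrow> act (x + y) m = act x m \<oplus> act y m"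
  by (simp add: cls_add smult_l_distr)

lemma act_1: "m \<in> carrier M \<Longrightarrow> act 1 m = m"
  by (simp add: cls_1 smult_one)

lemma smult_zero_left:
  assumes "m \<in> carrier M"
  shows "\<zero>\<^bsub>U_eps \<epsilon>\<^esub> \<odot> m = \<zero>"
proof -
  have "\<zero>\<^bsub>U_eps \<epsilon>\<^esub> \<odot> m \<oplus> \<zero>\<^bsub>U_eps \<epsilon>\<^esub> \<odot> m = \<zero>\<^bsub>U_eps \<epsilon>\<^esub> \<odot> m"
    using assms by (simp flip: smult_l_distr)
  then show ?thesis
    using assms by (metis M.add.l_cancel_one R.zero_closed smult_closed)
qed

lemma smult_zero_right:
  assumes "a \<in> carrier (U_eps \<epsilon>)"
  shows "a \<odot> \<zero> = \<zero>"
proof -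
  have "a \<odot> \<zero> \<oplus> a \<odot> \<zero> = a \<odot> \<zero>"
    using assms by (simp flip: smult_r_distr)
  then show ?thesis
    using assms by (metis M.add.l_cancel_one M.zero_closed smult_closed)
qed

lemma act_0: "m \<in> carrier M \<Longrightarrow> act 0 m = \<zero>"
  using cls_shifted_q[of 0 \<epsilon>] smult_zero_left by simp

lemma act_zero: "x \<in> res_form \<Longrightarrow> act x \<zero> = \<zero>"
  by (simp add: smult_zero_right)

lemma act_shifted_q: "x \<in> res_form \<Longrightarrow> m \<in> carrier M \<Longrightarrow> act (x * shifted_q \<epsilon>) m = \<zero>"
  by (simp add: U.c_central cls_shifted_q smult_zero_left)

lemma act_diff:
  assumes "x \<in> res_form" "y \<in> res_form" "m \<in> carrier M"
  shows "act (x - y) m = \<zero> \<longleftrightarrow> act x m = act y m"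
proof -
  have "act (x - y) m \<oplus> act y m = act x m"
    using assms res_form_diff act_add[of "x - y" y m] by simp
  then show ?thesis
    using assms res_form_diff by (metis M.add.r_cancel_one act_closed M.l_zero)
qed

lemma act_uminus:
  assumes "x \<in> res_form" "m \<in> carrier M"
  shows "act (- x) m = \<ominus> (act x m)"
proof -
  have "act (- x) m \<oplus> act x m = \<zero>"
    using assms act_add[of "- x" x m] res_form_uminus act_0 by simp
  then show ?thesis
    using assms res_form_uminus by (intro M.minus_equality[symmetric]) auto
qed

lemma submoduleI:
  assumes "N \<subseteq> carrier M" "\<zero> \<in> N" "\<And>x y. x \<in> N \<Longrightarrow> y \<in> N \<Longrightarrow> x \<oplus> y \<in> N"
    and "\<And>x n. x \<in> res_form \<Longrightarrow> n \<in> N \<Longrightarrow> act x n \<in> N"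
  shows "submodule N (U_eps \<epsilon>) M"
proof -
  have "\<ominus> n \<in> N" if "n \<in> N" for n
    using that assms(1) assms(4)[of "- 1" n] act_uminus[of 1 n] res_form_uminus[of 1] act_1 by auto
  then have "subgroup N (add_monoid M)"
    using assms(1-3) by (intro subgroup.intro) (auto simp: a_inv_def[symmetric])
  moreover have "a \<odot> n \<in> N" if "a \<in> carrier (U_eps \<epsilon>)" "n \<in> N" for a n
    using that assms(4) by (metis cls_surj)
  ultimately show ?thesis
    by (intro submodule.intro submodule_axioms.intro) auto
qed

end

section \<open>Highest weight vectors\<close>

text \<open>The annihilator of a highest weight vector is such a left ideal, and so is the intersection of two
  of them, which allows computations with two modules at once. Congruence modulo \<open>J\<close> takes place in
  the integral form over the Laurent polynomials, so that no module has to be mentioned.\<close>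

locale highest_weight_ideal = odd_root_of_unity +
  fixes l :: int and J :: "uq set"
  assumes J_add: "x \<in> J \<Longrightarrow> y \<in> J \<Longrightarrow> x + y \<in> J"
    and J_left: "x \<in> res_form \<Longrightarrow> y \<in> J \<Longrightarrow> x * y \<in> J"
    and J_shifted_q: "shifted_q \<epsilon> \<in> J"
    and J_E: "divE 1 \<in> J" "divE p \<in> J"
    and J_K: "uK - scal (const_cq (\<epsilon> powi l)) \<in> J"
    and J_Kbinom: "Kbinom p - scal (const_cq (qbinom_eps \<epsilon> l (int p))) \<in> J"

lemma highest_weight_ideal_Int:
  "highest_weight_ideal p \<epsilon> l I \<Longrightarrow> highest_weight_ideal p \<epsilon> l J \<Longrightarrow> highest_weight_ideal p \<epsilon> l (I \<inter> J)"
  unfolding highest_weight_ideal_def highest_weight_ideal_axioms_def by auto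

lemma divE_mult: "divE a * divE b = scal (qfact (a + b) / (qfact a * qfact b)) * divE (a + b)"
  by (simp add: divE_def U.c_left_commute[of "uE ^ a"] U.c_c mult.assoc power_add field_simps)

lemma divF_mult: "divF a * divF b = scal (qfact (a + b) / (qfact a * qfact b)) * divF (a + b)"
  by (simp add: divF_def U.c_left_commute[of "uF ^ a"] U.c_c mult.assoc power_add field_simps)

context odd_root_of_unity
begin

text \<open>Splitting off \<open>1\<close> from a number not divisible by \<open>p\<close>, or \<open>p\<close> from a multiple of \<open>p\<close>, causes no carry,
  and the quantum binomial in question can be divided by. This is why \<open>e\<close> and \<open>e^(p)\<close> control all
  divided powers of \<open>e\<close>, and \<open>K\<close> and \<open>[K;0;p]\<close> all \<open>[K;0;t]\<close>.\<close>

lemma no_carry_split: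
  assumes "t > 0" "t \<noteq> p"
  obtains a b where "t = a + b" "b = 1 \<or> b = p" "a < t" "b < t \<or> t = 1"
    "at_eps \<epsilon> (qfact t / (qfact a * qfact b)) \<noteq> 0" "qfact t / (qfact a * qfact b) \<in> laurent"
proof -
  have *: "at_eps \<epsilon> (qfact (a + b) / (qfact a * qfact b)) \<noteq> 0 \<and>
      qfact (a + b) / (qfact a * qfact b) \<in> laurent" if "a mod p + b mod p < p" for a b
    using qbinom_eps_eq_0_iff[of a b] qbinom_laurent[of "int (a + b)" b] that
    unfolding qbinom_eps_def qbinom_nat by auto
  show ?thesis
  proof (cases "p dvd t")
    case True
    then have "t > p"
      using assms dvd_imp_le by (metis le_neq_implies_less)
    moreover have "(t - p) mod p = 0"
      using True by auto
    ultimately show ?thesis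
      using that[of "t - p" p] *[of "t - p" p] p_gt_1 by auto
  next
    case False
    have "Suc ((t - 1) mod p) \<noteq> p"
    proof
      assume "Suc ((t - 1) mod p) = p"
      then have "t mod p = 0"
        using mod_Suc[of "t - 1" p] assms(1) by simp
      then show False
        using False by (simp add: dvd_eq_mod_eq_0)
    qed
    moreover have "(t - 1) mod p < p"
      using p_gt_1 by simp
    ultimately have "(t - 1) mod p + 1 < p"
      by linarith
    then show ?thesis
      using that[of "t - 1" 1] *[of "t - 1" 1] p_gt_1 assms(1)
      by (cases "t = 1") auto
  qed
qed

end

context highest_weight_ideal
begin

definition cong :: "uq \<Rightarrow> uq \<Rightarrow> bool" (infix "\<approx>" 50) where
  "x \<approx> y \<longleftrightarrow> x - y \<in> J"

lemma J_0: "0 \<in> J"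
  using J_left[OF res_form_0 J_shifted_q] by simp

lemma J_uminus: "x \<in> J \<Longrightarrow> - x \<in> J"
  using J_left[OF res_form_uminus[OF res_form_1]] by fastforce

lemma cong_0: "x \<approx> 0 \<longleftrightarrow> x \<in> J"
  by (simp add: cong_def)

lemma cong_refl: "x \<approx> x"
  by (simp add: cong_def J_0)

lemma cong_sym: "x \<approx> y \<Longrightarrow> y \<approx> x"
  using J_uminus unfolding cong_def by fastforce

lemma cong_trans [trans]: "x \<approx> y \<Longrightarrow> y \<approx> z \<Longrightarrow> x \<approx> z"
  using J_add[of "x - y" "y - z"] by (simp add: cong_def)

lemma cong_add: "x \<approx> x' \<Longrightarrow> y \<approx> y' \<Longrightarrow> x + y \<approx> x' + y'"
  using J_add[of "x - x'" "y - y'"] by (simp add: cong_def algebra_simps)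

lemma cong_uminus: "x \<approx> y \<Longrightarrow> - x \<approx> - y"
  using J_uminus[of "x - y"] by (simp add: cong_def)

lemma cong_diff: "x \<approx> x' \<Longrightarrow> y \<approx> y' \<Longrightarrow> x - y \<approx> x' - y'"
  using cong_add[of x x' "- y" "- y'"] cong_uminus[of y y'] by simp

lemma cong_left: "z \<in> res_form \<Longrightarrow> x \<approx> y \<Longrightarrow> z * x \<approx> z * y"
  using J_left[of z "x - y"] by (simp add: cong_def right_diff_distrib)

lemma cong_scal: "x \<in> res_form \<Longrightarrow> x' \<approx> scal b \<Longrightarrow> x * x' \<approx> scal b * x"
  using cong_left[of x x' "scal b"] by (simp add: U.c_central)

lemma shifted_q_mult: "x \<in> res_form \<Longrightarrow> shifted_q \<epsilon> * x \<in> J"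
  using J_left[OF _ J_shifted_q] by (simp add: U.c_central)

lemma scal_eps: "a \<in> laurent \<Longrightarrow> scal a \<approx> scal (const_cq (at_eps \<epsilon> a))"
proof -
  assume a: "a \<in> laurent"
  obtain b where b: "b \<in> laurent" "a = const_cq (at_eps \<epsilon> a) + (qq - const_cq \<epsilon>) * b"
    using laurent_at_eps[OF eps_nonzero a] .
  have "scal a - scal (const_cq (at_eps \<epsilon> a)) = shifted_q \<epsilon> * scal b"
    by (subst b(2)) (simp only: U.c_add U.c_mult add_diff_cancel_left')
  then show ?thesis
    using shifted_q_mult[OF res_form.scal[OF b(1)]] by (simp add: cong_def)
qed

text \<open>Modulo \<open>q - \<epsilon>\<close> a Laurent polynomial is its value, which is invertible if it is not zero.\<close>

lemma J_cancel:
  assumes "a \<in> laurent" "at_eps \<epsilon> a \<noteq> 0" "x \<in> res_form" "scal a * x \<in> J"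
  shows "x \<in> J"
proof -
  obtain b where b: "b \<in> laurent" "a = const_cq (at_eps \<epsilon> a) + (qq - const_cq \<epsilon>) * b"
    using laurent_at_eps[OF eps_nonzero assms(1)] .
  let ?c = "scal (const_cq (inverse (at_eps \<epsilon> a)))"
  have "scal a * x = scal (const_cq (at_eps \<epsilon> a)) * x + shifted_q \<epsilon> * (scal b * x)"
    by (subst b(2)) (simp only: U.c_add U.c_mult distrib_right mult.assoc)
  moreover have "shifted_q \<epsilon> * (scal b * x) \<in> J"
    using b assms by (intro shifted_q_mult res_form.mult res_form.scal)
  ultimately have "scal (const_cq (at_eps \<epsilon> a)) * x \<in> J"
    using J_add[OF assms(4) J_uminus] by fastforce
  then have "?c * (scal (const_cq (at_eps \<epsilon> a)) * x) \<in> J"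
    by (rule J_left[OF res_form.scal[OF const_cq_laurent]])
  then show ?thesis
    using assms(2) by (simp add: U.c_c U.c_1 flip: const_cq_mult)
qed

lemma cong_cancel:
  assumes "scal a * x \<approx> scal a * y" "a \<in> laurent" "at_eps \<epsilon> a \<noteq> 0" "x \<in> res_form" "y \<in> res_form"
  shows "x \<approx> y"
  using J_cancel[OF assms(2,3) res_form_diff[OF assms(4,5)]] assms(1)
  by (simp add: cong_def right_diff_distrib)

lemma divE_J: "r > 0 \<Longrightarrow> divE r \<in> J"
proof (induction r rule: less_induct)
  case (less r)
  show ?case
  proof (cases "r = p")
    case False
    then obtain a b where ab: "r = a + b" "b = 1 \<or> b = p"
      "at_eps \<epsilon> (qfact r / (qfact a * qfact b)) \<noteq> 0" "qfact r / (qfact a * qfact b) \<in> laurent"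
      using no_carry_split less.prems by metis
    have "divE a * divE b \<in> J"
      using ab(2) J_E by (intro J_left res_form_divE) auto
    then show ?thesis
      unfolding divE_mult ab(1)[symmetric] using ab res_form_divE J_cancel by blast
  qed (use J_E in simp)
qed

lemma uK_cong: "uK \<approx> scal (qq powi l)"
proof -
  have "uK \<approx> scal (const_cq (at_eps \<epsilon> (qq powi l)))"
    using J_K by (simp add: cong_def at_eps_powi)
  also have "\<dots> \<approx> scal (qq powi l)"
    by (intro cong_sym[OF scal_eps] laurent_qq_powi)
  finally show ?thesis .
qed

lemma uKinv_cong: "uKinv \<approx> scal (qq powi (- l))"
proof -
  have "uKinv * uK \<approx> scal (qq powi l) * uKinv"
    using uK_cong by (intro cong_scal res_form.Kinv)
  then have "scal (qq powi (- l)) * 1 \<approx> scal (qq powi (- l)) * (scal (qq powi l) * uKinv)"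
    unfolding U.ki_k by (intro cong_left res_form.scal laurent_qq_powi)
  then show ?thesis
    by (simp add: U.c_c U.c_1 qq_powi_uminus cong_sym)
qed

text \<open>The denominator \<open>q - q^(-1)\<close> of \<open>[K;n]\<close> is not a unit of the Laurent polynomials, but has a nonzero
  value at \<open>\<epsilon>\<close> and is cancelled after multiplying it out.\<close>

lemma lin_cong: "U.lin n \<approx> scal (qint (l + n))"
proof -
  let ?d = "qq - inverse qq"
  have inv: "inverse qq \<in> laurent" "at_eps \<epsilon> (inverse qq) = inverse \<epsilon>"
    using laurent_qq_powi[of "- 1"] by (simp_all add: at_eps_inverse)
  then have d: "?d \<in> laurent" "at_eps \<epsilon> ?d \<noteq> 0"
    using eps_minus_inverse laurent_regular[of \<epsilon> "inverse qq"] by (simp_all add: laurent_diff at_eps_diff)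
  have "scal ?d * U.lin n = scal (qq powi n) * uK - scal (qq powi (- n)) * uKinv"
    using U.lin_scaled[of ?d n] by (simp add: right_inverse)
  also have "\<dots> \<approx> scal (qq powi n) * scal (qq powi l) - scal (qq powi (- n)) * scal (qq powi (- l))"
    using uK_cong uKinv_cong by (intro cong_diff cong_left res_form.scal laurent_qq_powi)
  also have "\<dots> = scal ?d * scal (qint (l + n))"
  proof -
    have "?d * qint (l + n) = qq powi n * qq powi l - qq powi (- n) * qq powi (- l)"
      unfolding qint_def add.commute[of l n] minus_add_distrib qq_powi_add by simp
    then show ?thesis
      by (simp only: U.c_mult[symmetric] U.c_diff[symmetric])
  qed
  finally show ?thesis
    using d res_form_Kb[of n 1] unfolding U.Kb_1
    by (rule cong_cancel) (intro res_form.scal qint_laurent)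
qed

text \<open>For \<open>n = 0\<close>, \<open>no_carry_split\<close> reduces \<open>[K;0;t]\<close> to a product of two shorter ones, down to \<open>[K;0;1]\<close> and
  \<open>[K;0;p]\<close>, where the hypotheses on the weight apply. The Pascal rule, read in both directions, passes to
  other \<open>n\<close>. The binomials satisfy the same recursions.\<close>

lemma Kb_cong: "U.Kb n t \<approx> scal (qbinom (l + n) (int t))"
proof (induction t arbitrary: n rule: less_induct)
  case (less t)
  show ?case
  proof (cases t)
    case 0
    then show ?thesis
      by (simp add: U.c_1 cong_refl)
  next
    case (Suc t')
    have zero: "U.Kb 0 t \<approx> scal (qbinom l (int t))"
    proof (cases "t = p \<or> t = 1")
      case True
      then show ?thesis
      proof
        assume "t = p"
        have "U.Kb 0 p \<approx> scal (const_cq (at_eps \<epsilon> (qbinom l (int p))))"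
          using J_Kbinom unfolding Kbinom_eq_Kb qbinom_eps_def cong_def .
        also have "\<dots> \<approx> scal (qbinom l (int p))"
          by (intro cong_sym[OF scal_eps] qbinom_laurent)
        finally show ?thesis
          using \<open>t = p\<close> by simp
      next
        assume "t = 1"
        then show ?thesis
          using lin_cong[of 0] U.Kb_1[of 0] by (simp add: qbinom_def qfact_def)
      qed
    next
      case False
      have "t > 0" "t \<noteq> p"
        using Suc False by auto
      then obtain a b where ab: "t = a + b" "a < t" "b < t \<or> t = 1"
        and c: "at_eps \<epsilon> (qfact t / (qfact a * qfact b)) \<noteq> 0" "qfact t / (qfact a * qfact b) \<in> laurent"
        using no_carry_split by metis
      let ?c = "qfact t / (qfact a * qfact b)"
      let ?b = "qbinom (l - int a) (int b)"
      have "b < t"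
        using ab False by simp
      have "scal ?c * U.Kb 0 t = U.Kb 0 a * U.Kb (- int a) b"
        using U.Kb_add[of a b 0] ab(1) by simp
      also have "\<dots> \<approx> scal ?b * U.Kb 0 a"
        using less[OF \<open>b < t\<close>, of "- int a"] by (intro cong_scal res_form_Kb) simp
      also have "\<dots> \<approx> scal ?b * scal (qbinom l (int a))"
        using less[OF ab(2), of 0] by (intro cong_left res_form.scal qbinom_laurent) simp
      also have "\<dots> = scal ?c * scal (qbinom l (int t))"
      proof -
        have "?c * qbinom l (int t) = qbinom l (int a) * ?b"
          using torus.Kb_add[OF torus_field[of l], of a b 0] unfolding Kb_field ab(1) by simp
        then show ?thesis
          by (simp only: U.c_mult[symmetric] mult.commute)
      qed
      finally show ?thesis
        using c(2,1) by (rule cong_cancel) (intro res_form_Kb res_form.scal qbinom_laurent)+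
    qed
    have lower: "scal (qq powi (int t' - n)) * (uKinv * U.Kb n t')
      \<approx> scal (qq powi (int t' - (l + n)) * qbinom (l + n) (int t'))" for n
    proof -
      let ?b = "qbinom (l + n) (int t')"
      have "uKinv * U.Kb n t' \<approx> scal ?b * uKinv"
        using less[of t' n] Suc by (intro cong_scal res_form.Kinv) simp
      also have "\<dots> \<approx> scal ?b * scal (qq powi (- l))"
        using uKinv_cong by (intro cong_left res_form.scal qbinom_laurent)
      finally have "scal (qq powi (int t' - n)) * (uKinv * U.Kb n t') \<approx>
          scal (qq powi (int t' - n)) * (scal ?b * scal (qq powi (- l)))"
        by (intro cong_left res_form.scal laurent_qq_powi)
      also have "\<dots> = scal (qq powi (int t' - (l + n)) * ?b)"
        by (simp add: qq_powi_add qq_powi_diff qq_powi_uminus U.c_mult[symmetric] mult_ac)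
      finally show ?thesis .
    qed
    have pascal: "qbinom (l + (n + 1)) (int t) = qq powi (1 + int t') * qbinom (l + n) (int t)
       + qq powi (int t' - (l + n)) * qbinom (l + n) (int t')" for n
      using qbinom_pascal[of "l + n" t'] unfolding Suc by (simp only: add.assoc)
    show ?thesis
    proof (induction n rule: int_induct[where k = 0])
      case base
      show ?case
        using zero by simp
    next
      case (step1 i)
      have "scal (qq powi (1 + int t')) * U.Kb i t + scal (qq powi (int t' - i)) * (uKinv * U.Kb i t') \<approx>
         scal (qq powi (1 + int t')) * scal (qbinom (l + i) (int t)) + scal (qq powi (int t' - (l + i)) * qbinom (l + i) (int t'))"
        using step1 by (intro cong_add cong_left res_form.scal laurent_qq_powi lower)
      then show ?case
        unfolding pascal by (simp only: Suc U.Kb_pascal U.c_add U.c_mult)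
    next
      case (step2 i)
      have i: "i - 1 + 1 = i"
        by simp
      have "scal (qq powi (1 + int t')) * U.Kb (i - 1) t =
         U.Kb i t - scal (qq powi (int t' - (i - 1))) * (uKinv * U.Kb (i - 1) t')"
        using U.Kb_pascal[of "i - 1" t', unfolded i] by (simp only: Suc add_diff_cancel_right')
      also have "\<dots> \<approx> scal (qbinom (l + i) (int t)) - scal (qq powi (int t' - (l + (i - 1))) * qbinom (l + (i - 1)) (int t'))"
        using step2 by (intro cong_diff lower)
      also have "\<dots> = scal (qq powi (1 + int t')) * scal (qbinom (l + (i - 1)) (int t))"
        using pascal[of "i - 1", unfolded i] by (simp only: U.c_diff[symmetric] U.c_mult[symmetric] add_diff_cancel_right')
      finally show ?case
        by (rule cong_cancel)
           (simp_all add: laurent_qq_powi at_eps_powi res_form_Kb res_form.scal qbinom_laurent)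
    qed
  qed
qed

end

text \<open>The negative part of the triangular decomposition.\<close>

inductive_set neg_part :: "uq set" where
  divF: "a \<in> laurent \<Longrightarrow> scal a * divF j \<in> neg_part"
| add: "x \<in> neg_part \<Longrightarrow> y \<in> neg_part \<Longrightarrow> x + y \<in> neg_part"

lemma neg_part_0: "0 \<in> neg_part"
  using neg_part.divF[of 0 0] by (simp add: U.c_0)

lemma neg_part_res_form: "x \<in> neg_part \<Longrightarrow> x \<in> res_form"
  by (induction rule: neg_part.induct) (auto intro: res_form.mult res_form.scal res_form_divF res_form.add)

lemma neg_part_scal: "x \<in> neg_part \<Longrightarrow> b \<in> laurent \<Longrightarrow> scal b * x \<in> neg_part"
  by (induction rule: neg_part.induct)
     (auto simp: distrib_left U.c_c intro: neg_part.intros laurent_mult)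

lemma neg_part_dF: "a \<in> laurent \<Longrightarrow> scal a * dF k \<in> neg_part"
  by (auto simp: dF_def neg_part_0 neg_part.divF)

context highest_weight_ideal
begin

definition reducible_to_neg :: "uq set" where
  "reducible_to_neg = {x. \<exists>y\<in>neg_part. x \<approx> y}"

lemma reducible_scal: "b \<in> laurent \<Longrightarrow> x \<in> reducible_to_neg \<Longrightarrow> scal b * x \<in> reducible_to_neg"
  unfolding reducible_to_neg_def using neg_part_scal cong_left res_form.scal by blast

lemma reducible_add: "x \<in> reducible_to_neg \<Longrightarrow> y \<in> reducible_to_neg \<Longrightarrow> x + y \<in> reducible_to_neg"
  unfolding reducible_to_neg_def using neg_part.add cong_add by blast

lemma reducible_cong: "x \<approx> y \<Longrightarrow> y \<in> reducible_to_neg \<Longrightarrow> x \<in> reducible_to_neg"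
  unfolding reducible_to_neg_def using cong_trans by blast

lemma neg_part_reducible: "x \<in> neg_part \<Longrightarrow> x \<in> reducible_to_neg"
  unfolding reducible_to_neg_def using cong_refl by blast

lemma dF_reducible: "a \<in> laurent \<Longrightarrow> scal a * dF k \<in> reducible_to_neg"
  by (intro neg_part_reducible neg_part_dF)

lemma uK_divF_cong: "uK * divF j \<approx> scal (qq powi (l - 2 * int j)) * divF j"
proof -
  have "uK * divF j = scal (qq powi (- 2 * int j)) * (divF j * uK)"
    using weight_divF[of j] by (simp only: mult.assoc)
  also have "\<dots> \<approx> scal (qq powi (- 2 * int j)) * (scal (qq powi l) * divF j)"
    using uK_cong by (intro cong_left res_form.scal laurent_qq_powi cong_scal res_form_divF)
  also have "\<dots> = scal (qq powi (l - 2 * int j)) * divF j"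
    by (simp only: U.c_c qq_powi_add[symmetric]) (simp add: algebra_simps)
  finally show ?thesis .
qed

lemma uKinv_divF_cong: "uKinv * divF j \<approx> scal (qq powi (- (l - 2 * int j))) * divF j"
proof -
  let ?a = "qq powi (l - 2 * int j)"
  have "uKinv * (uK * divF j) \<approx> uKinv * (scal ?a * divF j)"
    using uK_divF_cong by (intro cong_left res_form.Kinv)
  also have "\<dots> = scal ?a * (uKinv * divF j)"
    by (rule U.ki_c)
  also have "uKinv * (uK * divF j) = divF j"
    by (simp only: mult.assoc[symmetric] U.ki_k mult_1)
  finally have "scal (inverse ?a) * divF j \<approx> scal (inverse ?a) * (scal ?a * (uKinv * divF j))"
    unfolding qq_powi_uminus[symmetric] by (intro cong_left res_form.scal laurent_qq_powi)
  then have "scal (inverse ?a) * divF j \<approx> uKinv * divF j"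
    by (simp add: U.c_c U.c_1)
  then show ?thesis
    unfolding qq_powi_uminus by (rule cong_sym)
qed

text \<open>In the commutation formula all terms but the last end in a positive divided power of \<open>e\<close>.\<close>

lemma divE_divF_cong:
  assumes "r > 0"
  shows "divE r * divF k \<approx> scal (qbinom (l + (int r - int k)) (int r)) * dF (int k - int r)"
proof -
  define g where "g j = dF (int k - int j) * U.Kb (2 * int j - int r - int k) j * divE (r - j)" for j
  have "(\<Sum>j<r. g j) \<in> J"
  proof -
    have "(\<Sum>j<n. g j) \<in> J" if "n \<le> r" for n
      using that
    proof (induction n)
      case (Suc n)
      have "g n \<in> J"
        unfolding g_def using Suc.prems by (intro J_left res_form.mult res_form_dF res_form_Kb divE_J) simp
      then show ?case
        using Suc by (simp add: J_add)
    qed (simp add: J_0)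
    then show ?thesis
      by simp
  qed
  moreover have "divE r * divF k = (\<Sum>j<r. g j) + g r"
    using divE_dF[of r "int k"] unfolding dF_of_nat g_def lessThan_Suc_atMost[symmetric] sum.lessThan_Suc .
  ultimately have "divE r * divF k \<approx> g r"
    by (simp add: cong_def)
  also have "g r = dF (int k - int r) * U.Kb (int r - int k) r"
    by (simp add: g_def)
  also have "\<dots> \<approx> scal (qbinom (l + (int r - int k)) (int r)) * dF (int k - int r)"
    by (intro cong_scal res_form_dF Kb_cong)
  finally show ?thesis .
qed

text \<open>The \<open>x\<close> that map the negative part into itself modulo \<open>J\<close> are closed under sums and products and
  include the generators.\<close>

lemma res_form_reducible:
  assumes "x \<in> res_form"
  shows "x \<in> reducible_to_neg"
proof -
  have extend: "\<forall>y\<in>neg_part. x * y \<in> reducible_to_neg"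
    if "\<And>j. x * divF j \<in> reducible_to_neg" for x
  proof
    fix y assume "y \<in> neg_part"
    then show "x * y \<in> reducible_to_neg"
      using that by (induction) (auto simp: U.c_left_commute[of x] distrib_left intro: reducible_scal reducible_add)
  qed
  have "\<forall>y\<in>neg_part. x * y \<in> reducible_to_neg"
    using assms
  proof (induction)
    case (scal a)
    then show ?case
      using neg_part_scal neg_part_reducible by blast
  next
    case K
    show ?case
      using dF_reducible[OF laurent_qq_powi, of _ "int j" for j]
      by (intro extend reducible_cong[OF uK_divF_cong]) (simp only: dF_of_nat)
  next
    case Kinv
    show ?case
      using dF_reducible[OF laurent_qq_powi, of _ "int j" for j]
      by (intro extend reducible_cong[OF uKinv_divF_cong]) (simp only: dF_of_nat)
  next
    case (divE r)
    then show ?case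
      by (intro extend reducible_cong[OF divE_divF_cong] dF_reducible qbinom_laurent) simp
  next
    case (divF r)
    have "scal (qfact (r + j) / (qfact r * qfact j)) * divF (r + j) \<in> reducible_to_neg" for j
      using qbinom_laurent[of "int (r + j)" j] dF_reducible[of _ "int (r + j)", unfolded dF_of_nat]
      unfolding qbinom_nat by blast
    then show ?case
      by (intro extend) (simp only: divF_mult)
  next
    case (add x y)
    then show ?case
      by (simp add: distrib_right reducible_add)
  next
    case (mult x y)
    show ?case
    proof
      fix z assume "z \<in> neg_part"
      then obtain z' where z': "z' \<in> neg_part" "y * z \<approx> z'"
        using mult.IH unfolding reducible_to_neg_def by blast
      then have "x * (y * z) \<approx> x * z'"
        using mult.hyps by (intro cong_left)
      then show "x * y * z \<in> reducible_to_neg"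
        unfolding mult.assoc by (rule reducible_cong) (use mult.IH(1) z'(1) in blast)
    qed
  qed
  moreover have "1 \<in> neg_part"
    using neg_part.divF[of 1 0] by (simp add: U.c_1)
  ultimately show ?thesis
    by force
qed

text \<open>On vectors of weight \<open>l - 2j\<close> the element \<open>[K;2n-l;2n]\<close> acts as the binomial of \<open>2n - 2j\<close> over \<open>2n\<close>,
  which is \<open>1\<close> for \<open>j = 0\<close> and \<open>0\<close> for \<open>0 < j \<le> n\<close>. For large \<open>n\<close> it is the projection
  to the highest weight.\<close>

definition proj :: "nat \<Rightarrow> uq" where
  "proj n = U.Kb (2 * int n - l) (2 * n)"

lemma proj_res_form: "proj n \<in> res_form"
  by (simp add: proj_def res_form_Kb)

lemma proj_1: "proj n \<approx> 1"
  using Kb_cong[of "2 * int n - l" "2 * n"] qbinom_diag[of "2 * n"] by (simp add: proj_def U.c_1)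

lemma proj_divF:
  assumes "0 < j" "j \<le> n"
  shows "proj n * divF j \<in> J"
proof -
  let ?m = "2 * int n - l - 2 * int j"
  have m: "l + ?m = int (2 * n - 2 * j)"
    using assms by simp
  have q: "qbinom (int (2 * n - 2 * j)) (int (2 * n)) = 0"
    using assms by (intro qbinom_vanish) simp
  have "divF j * U.Kb ?m (2 * n) = proj n * divF j"
    unfolding proj_def using weight_Kb[OF weight_divF, of j ?m "2 * n"] by simp
  moreover have "divF j * U.Kb ?m (2 * n) \<approx> scal (qbinom (l + ?m) (int (2 * n))) * divF j"
    by (intro cong_scal res_form_divF Kb_cong)
  ultimately have "proj n * divF j \<approx> 0"
    unfolding m q by (simp only: U.c_0 mult_zero_left)
  then show ?thesis
    by (simp only: cong_0)
qed

lemma proj_scalar: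
  assumes "x \<in> res_form"
  obtains a n where "a \<in> laurent" "proj n * x \<approx> scal a"
proof -
  obtain y where y: "y \<in> neg_part" "x \<approx> y"
    using res_form_reducible[OF assms] unfolding reducible_to_neg_def by blast
  have "\<exists>a\<in>laurent. \<exists>N. \<forall>n\<ge>N. proj n * y \<approx> scal a"
    using y(1)
  proof (induction)
    case (divF a j)
    show ?case
    proof (cases "j = 0")
      case True
      have "proj n * scal a \<approx> scal a" for n
        using cong_left[OF res_form.scal[OF divF] proj_1[of n]] by (simp add: U.c_central)
      then show ?thesis
        using True divF by auto
    next
      case False
      have "proj n * (scal a * divF j) \<in> J" if "n \<ge> j" for n
        using that False divF proj_divF[of j n] J_left[OF res_form.scal] by (simp add: U.c_left_commute[of "proj n"])
      then show ?thesis
        by (intro bexI[of _ 0] exI[of _ j]) (simp_all add: U.c_0 cong_0)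
    qed
  next
    case (add x y)
    then obtain a b k m where "a \<in> laurent" "b \<in> laurent"
      "\<forall>n\<ge>k. proj n * x \<approx> scal a" "\<forall>n\<ge>m. proj n * y \<approx> scal b"
      by blast
    then show ?case
      by (intro bexI[of _ "a + b"] exI[of _ "max k m"])
         (auto simp: distrib_left U.c_add laurent_add intro!: cong_add)
  qed
  then obtain a n where "a \<in> laurent" "proj n * y \<approx> scal a"
    by blast
  moreover have "proj n * x \<approx> proj n * y"
    using y(2) by (intro cong_left proj_res_form)
  ultimately show ?thesis
    using that cong_trans by blast
qed

end

section \<open>Irreducible highest weight modules\<close>

definition highest_weight_generator :: "complex \<Rightarrow> nat \<Rightarrow> int \<Rightarrow> (uq set, 'm) module \<Rightarrow> 'm \<Rightarrow> bool" where
  "highest_weight_generator \<epsilon> p l M v \<longleftrightarrow>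
     v \<in> weight_space \<epsilon> p M l \<and> v \<noteq> \<zero>\<^bsub>M\<^esub> \<and>
     cls \<epsilon> (divE 1) \<odot>\<^bsub>M\<^esub> v = \<zero>\<^bsub>M\<^esub> \<and> cls \<epsilon> (divE p) \<odot>\<^bsub>M\<^esub> v = \<zero>\<^bsub>M\<^esub> \<and>
     generated_by (U_eps \<epsilon>) M v"

lemma highest_weight_module_iff:
  "highest_weight_module \<epsilon> p l M \<longleftrightarrow> type_1 \<epsilon> p M \<and> (\<exists>v. highest_weight_generator \<epsilon> p l M v)"
  unfolding highest_weight_module_def highest_weight_generator_def by blast

definition annihilator :: "complex \<Rightarrow> (uq set, 'm) module \<Rightarrow> 'm \<Rightarrow> uq set" where
  "annihilator \<epsilon> M v = {x \<in> res_form. cls \<epsilon> x \<odot>\<^bsub>M\<^esub> v = \<zero>\<^bsub>M\<^esub>}"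

context eps_module
begin

lemma submoduleD:
  assumes "submodule N (U_eps \<epsilon>) M"
  shows "N \<subseteq> carrier M" "\<zero> \<in> N" "x \<in> N \<Longrightarrow> y \<in> N \<Longrightarrow> x \<oplus> y \<in> N"
    "a \<in> carrier (U_eps \<epsilon>) \<Longrightarrow> x \<in> N \<Longrightarrow> a \<odot> x \<in> N"
proof -
  interpret N: submodule N "U_eps \<epsilon>" M by fact
  show "N \<subseteq> carrier M" "\<zero> \<in> N" "x \<in> N \<Longrightarrow> y \<in> N \<Longrightarrow> x \<oplus> y \<in> N"
    "a \<in> carrier (U_eps \<epsilon>) \<Longrightarrow> x \<in> N \<Longrightarrow> a \<odot> x \<in> N"
    using N.subset N.one_closed N.m_closed N.smult_closed by auto
qed

lemma annihilator_cong:
  assumes "x - y \<in> annihilator \<epsilon> M v" "x \<in> res_form" "y \<in> res_form" "v \<in> carrier M"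
  shows "act x v = act y v"
  using assms act_diff unfolding annihilator_def by blast

lemma generator_carrier: "highest_weight_generator \<epsilon> p l M v \<Longrightarrow> v \<in> carrier M"
  by (simp add: highest_weight_generator_def generated_by_def)

lemma annihilator_highest_weight_ideal:
  assumes "odd_root_of_unity p \<epsilon>" "highest_weight_generator \<epsilon> p l M v"
  shows "highest_weight_ideal p \<epsilon> l (annihilator \<epsilon> M v)"
proof -
  have v: "v \<in> carrier M"
    using assms(2) by (rule generator_carrier)
  note hw = assms(2)[unfolded highest_weight_generator_def weight_space_def]
  have Kb: "Kbinom p \<in> res_form"
    by (simp add: Kbinom_eq_Kb res_form_Kb)
  show ?thesis
  proof (intro highest_weight_ideal.intro highest_weight_ideal_axioms.intro)
    show "uK - scal (const_cq (\<epsilon> powi l)) \<in> annihilator \<epsilon> M v"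
      using hw v by (auto simp: annihilator_def act_diff cscal_def res_form.K res_form.scal res_form_diff)
    show "Kbinom p - scal (const_cq (qbinom_eps \<epsilon> l (int p))) \<in> annihilator \<epsilon> M v"
      using hw v Kb by (auto simp: annihilator_def act_diff cscal_def res_form.scal res_form_diff)
    show "shifted_q \<epsilon> \<in> annihilator \<epsilon> M v"
      using act_shifted_q[OF res_form_1 v] by (simp add: annihilator_def)
    show "divE 1 \<in> annihilator \<epsilon> M v" "divE p \<in> annihilator \<epsilon> M v"
      using hw by (auto simp: annihilator_def res_form_divE)
  next
    fix x y assume "x \<in> annihilator \<epsilon> M v" "y \<in> annihilator \<epsilon> M v"
    then show "x + y \<in> annihilator \<epsilon> M v"
      using v by (auto simp: annihilator_def act_add res_form.add)
  next
    fix x y assume "x \<in> res_form" "y \<in> annihilator \<epsilon> M v"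
    then show "x * y \<in> annihilator \<epsilon> M v"
      using v by (auto simp: annihilator_def act_mult res_form.mult act_zero)
  qed (rule assms(1))
qed

lemma submodule_orbit:
  assumes v: "v \<in> carrier M" and L: "L \<subseteq> res_form" "0 \<in> L" "\<And>x y. x \<in> L \<Longrightarrow> y \<in> L \<Longrightarrow> x + y \<in> L"
    and left: "\<And>x y. x \<in> res_form \<Longrightarrow> y \<in> L \<Longrightarrow> x * y \<in> L"
  shows "submodule {act x v | x. x \<in> L} (U_eps \<epsilon>) M"
proof (rule submoduleI)
  have res: "x \<in> res_form" if "x \<in> L" for x
    using L(1) that by blast
  show "{act x v | x. x \<in> L} \<subseteq> carrier M"
    using v res by auto
  show "\<zero> \<in> {act x v | x. x \<in> L}"
    using L(2) by (intro CollectI exI[of _ 0]) (simp add: act_0[OF v])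
  show "x \<oplus> y \<in> {act x v | x. x \<in> L}" if "x \<in> {act x v | x. x \<in> L}" "y \<in> {act x v | x. x \<in> L}" for x y
    using that v res by (auto simp flip: act_add intro: L(3))
  show "act x y \<in> {act x v | x. x \<in> L}" if "x \<in> res_form" "y \<in> {act x v | x. x \<in> L}" for x y
    using that v res by (auto simp flip: act_mult intro: left)
qed

lemma generator_orbit:
  assumes "generated_by (U_eps \<epsilon>) M v" "m \<in> carrier M"
  obtains x where "x \<in> res_form" "m = act x v"
proof -
  let ?N = "{act x v | x. x \<in> res_form}"
  have v: "v \<in> carrier M"
    using assms(1) by (simp add: generated_by_def)
  then have "submodule ?N (U_eps \<epsilon>) M"
    by (rule submodule_orbit) (auto intro: res_form.add res_form.mult)
  moreover have "v \<in> ?N"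
    by (rule CollectI, rule exI[of _ 1]) (simp add: act_1[OF v])
  ultimately have "?N = carrier M"
    using assms(1) unfolding generated_by_def by blast
  then show ?thesis
    using that assms(2) by blast
qed

text \<open>Reduction to the negative part modulo the annihilator shows that the \<open>f^(j) v\<close> span the module.\<close>

lemma generator_induct:
  assumes "odd_root_of_unity p \<epsilon>" "highest_weight_generator \<epsilon> p l M v"
    and divF: "\<And>a j. a \<in> laurent \<Longrightarrow> P (act (scal a * divF j) v)"
    and add: "\<And>x y. x \<in> carrier M \<Longrightarrow> y \<in> carrier M \<Longrightarrow> P x \<Longrightarrow> P y \<Longrightarrow> P (x \<oplus> y)"
    and m: "m \<in> carrier M"
  shows "P m"
proof -
  interpret J: highest_weight_ideal p \<epsilon> l "annihilator \<epsilon> M v"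
    using assms(1,2) by (rule annihilator_highest_weight_ideal)
  have v: "v \<in> carrier M"
    using assms(2) by (rule generator_carrier)
  obtain x where x: "x \<in> res_form" "m = act x v"
    using assms(2) m generator_orbit unfolding highest_weight_generator_def by blast
  obtain y where y: "y \<in> neg_part" "x - y \<in> annihilator \<epsilon> M v"
    using J.res_form_reducible[OF x(1)] unfolding J.reducible_to_neg_def J.cong_def by blast
  have "P (act y v)"
    using y(1)
  proof (induction)
    case (add y z)
    then show ?case
      using assms(4) neg_part_res_form v by (simp add: act_add)
  qed (rule divF)
  then show ?thesis
    using annihilator_cong[OF y(2) x(1) neg_part_res_form[OF y(1)] v] x(2) by simp
qed

lemma cscal_mult:
  assumes "m \<in> carrier M"
  shows "cscal \<epsilon> a \<odot> (cscal \<epsilon> b \<odot> m) = cscal \<epsilon> (a * b) \<odot> m"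
  using assms by (simp add: cscal_def const_cq_mult U.c_mult act_mult res_form.scal)

lemma cscal_1: "m \<in> carrier M \<Longrightarrow> cscal \<epsilon> 1 \<odot> m = m"
  by (simp add: cscal_def U.c_1 act_1)

lemma cscal_carrier [simp]: "cscal \<epsilon> a \<in> carrier (U_eps \<epsilon>)"
  by (simp add: cscal_def res_form.scal)

lemma act_cscal_commute:
  assumes "x \<in> res_form" "m \<in> carrier M"
  shows "act x (cscal \<epsilon> a \<odot> m) = cscal \<epsilon> a \<odot> (act x m)"
proof -
  have "act x (cscal \<epsilon> a \<odot> m) = act (x * scal (const_cq a)) m"
    using assms by (simp add: cscal_def act_mult res_form.scal)
  also have "\<dots> = act (scal (const_cq a) * x) m"
    by (simp add: U.c_central)
  finally show ?thesis
    using assms by (simp add: cscal_def act_mult res_form.scal)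
qed

lemma eigenvector_power:
  assumes "x \<in> res_form" "m \<in> carrier M" "act x m = cscal \<epsilon> a \<odot> m"
  shows "act (x ^ n) m = cscal \<epsilon> (a ^ n) \<odot> m"
    and "x ^ n \<in> res_form"
proof -
  show r: "x ^ n \<in> res_form" for n
    using assms(1) by (induction n) (auto intro: res_form.mult)
  show "act (x ^ n) m = cscal \<epsilon> (a ^ n) \<odot> m"
    using assms r by (induction n) (simp_all add: act_1 cscal_1 act_mult act_cscal_commute cscal_mult mult.commute)
qed

definition eigenvectors :: "uq \<Rightarrow> 'm set" where
  "eigenvectors k = {v \<in> carrier M. \<exists>c. act k v = cscal \<epsilon> c \<odot> v}"

definition eigen_sum :: "uq \<Rightarrow> 'm \<Rightarrow> bool" where
  "eigen_sum k m \<longleftrightarrow> (\<exists>F. finite F \<and> F \<subseteq> eigenvectors k \<and> m = (\<Oplus>v\<in>F. v))"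

lemma eigenvectors_carrier: "F \<subseteq> eigenvectors k \<Longrightarrow> F \<subseteq> carrier M"
  by (auto simp: eigenvectors_def)

lemma eigen_finsum_insert:
  assumes "finite F" "F \<subseteq> eigenvectors k" "w \<in> eigenvectors k" "w \<notin> F"
  shows "(\<Oplus>v\<in>F. v) \<in> carrier M" "w \<in> carrier M" "(\<Oplus>v\<in>insert w F. v) = (\<Oplus>v\<in>F. v) \<oplus> w"
proof -
  show F: "(\<Oplus>v\<in>F. v) \<in> carrier M" and w: "w \<in> carrier M"
    using assms(2,3) by (auto simp: eigenvectors_def intro!: M.finsum_closed)
  have "(\<Oplus>v\<in>insert w F. v) = w \<oplus> (\<Oplus>v\<in>F. v)"
    using assms eigenvectors_carrier[OF assms(2)] w by (intro M.finsum_insert) auto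
  then show "(\<Oplus>v\<in>insert w F. v) = (\<Oplus>v\<in>F. v) \<oplus> w"
    using F w by (simp add: M.a_comm)
qed

text \<open>A sum over a set \<open>F\<close> of eigenvectors cannot count a vector twice. If \<open>w\<close> already lies in \<open>F\<close>, it
  is removed and the eigenvector \<open>w + w\<close> is added instead, which may again lie in the smaller set.\<close>

lemma eigen_sum_insert:
  assumes k: "k \<in> res_form" and F: "finite F" "F \<subseteq> eigenvectors k" "w \<in> eigenvectors k"
  shows "eigen_sum k ((\<Oplus>v\<in>F. v) \<oplus> w)"
  using F
proof (induction "card F" arbitrary: F w rule: less_induct)
  case less
  show ?case
  proof (cases "w \<in> F")
    case False
    then show ?thesis
      using less.prems eigen_finsum_insert(3)[OF less.prems False] unfolding eigen_sum_def
      by (intro exI[of _ "insert w F"]) auto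
  next
    case True
    define G where "G = F - {w}"
    have G: "F = insert w G" "w \<notin> G" "finite G" "G \<subseteq> eigenvectors k"
      using True less.prems by (auto simp: G_def)
    have "(\<Oplus>v\<in>F. v) \<oplus> w = (\<Oplus>v\<in>G. v) \<oplus> (w \<oplus> w)"
      unfolding G(1) using eigen_finsum_insert[OF G(3,4) less.prems(3) G(2)] by (simp add: M.a_assoc)
    moreover have "w \<oplus> w \<in> eigenvectors k"
      using less.prems(3) k by (auto simp: eigenvectors_def smult_r_distr)
    moreover have "card G < card F"
      using G by simp
    ultimately show ?thesis
      using less.hyps[of G "w \<oplus> w"] G by simp
  qed
qed

lemma eigen_sum_add:
  assumes k: "k \<in> res_form" and x: "eigen_sum k x" "x \<in> carrier M" and y: "eigen_sum k y"
  shows "eigen_sum k (x \<oplus> y)"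
proof -
  obtain G where G: "finite G" "G \<subseteq> eigenvectors k" "y = (\<Oplus>v\<in>G. v)"
    using y unfolding eigen_sum_def by blast
  have "eigen_sum k (x \<oplus> (\<Oplus>v\<in>G. v))"
    using G(1,2)
  proof (induction G)
    case (insert w G)
    then have w: "w \<in> eigenvectors k" "G \<subseteq> eigenvectors k"
      by auto
    note ins = eigen_finsum_insert[OF insert.hyps(1) w(2,1) insert.hyps(2)]
    obtain H where "finite H" "H \<subseteq> eigenvectors k" "x \<oplus> (\<Oplus>v\<in>G. v) = (\<Oplus>v\<in>H. v)"
      using insert.IH[OF w(2)] unfolding eigen_sum_def by blast
    then have "eigen_sum k ((x \<oplus> (\<Oplus>v\<in>G. v)) \<oplus> w)"
      using eigen_sum_insert[OF k _ _ w(1)] by simp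
    then show ?case
      unfolding ins(3) using ins(1,2) x(2) by (simp add: M.a_assoc)
  qed (use x in simp)
  then show ?thesis
    unfolding G(3) .
qed

text \<open>The vectors \<open>f^(j) v\<close> are eigenvectors of \<open>K\<close> with eigenvalue \<open>\<epsilon>^(l-2j)\<close>, a \<open>p\<close>-th root of unity. As they
  span the module, it is of type 1.\<close>

lemma generator_type_1:
  assumes "odd_root_of_unity p \<epsilon>" "highest_weight_generator \<epsilon> p l M v"
  shows "type_1 \<epsilon> p M"
proof -
  interpret odd_root_of_unity p \<epsilon> by fact
  interpret J: highest_weight_ideal p \<epsilon> l "annihilator \<epsilon> M v"
    using assms by (rule annihilator_highest_weight_ideal)
  have v: "v \<in> carrier M"
    using assms(2) by (rule generator_carrier)
  let ?u = "\<lambda>a j. act (scal a * divF j) v"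
  have eigen: "act x (?u a j) = cscal \<epsilon> (\<epsilon> powi n) \<odot> ?u a j"
    if a: "a \<in> laurent" and x: "x \<in> res_form" "J.cong (x * divF j) (scal (qq powi n) * divF j)" for a j x n
  proof -
    have r: "scal a * divF j \<in> res_form" "scal (qq powi n) \<in> res_form"
      using a laurent_qq_powi by (auto intro: res_form.mult res_form.scal res_form_divF)
    have "J.cong (scal a * (x * divF j)) (scal a * (scal (qq powi n) * divF j))"
      using x a by (intro J.cong_left res_form.scal)
    then have "J.cong (x * (scal a * divF j)) (scal (qq powi n) * (scal a * divF j))"
      by (simp add: U.c_left_commute[of x] U.c_c mult.commute)
    then have "act (x * (scal a * divF j)) v = act (scal (qq powi n) * (scal a * divF j)) v"
      using r x v unfolding J.cong_def by (intro annihilator_cong) (auto intro: res_form.mult)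
    then show ?thesis
      using r x v laurent_qq_powi by (simp add: act_mult cls_scal at_eps_powi)
  qed
  have K: "act uK (?u a j) = cscal \<epsilon> (\<epsilon> powi (l - 2 * int j)) \<odot> ?u a j"
    "act uKinv (?u a j) = cscal \<epsilon> (\<epsilon> powi (- (l - 2 * int j))) \<odot> ?u a j"
    if "a \<in> laurent" for a j
    using that eigen J.uK_divF_cong J.uKinv_divF_cong res_form.K res_form.Kinv by blast+
  have closed: "?u a j \<in> carrier M" if "a \<in> laurent" for a j
    using that v by (intro act_closed res_form.mult res_form.scal res_form_divF)
  have "eigen_sum uK m" if "m \<in> carrier M" for m
    using assms _ _ that
  proof (rule generator_induct)
    fix a j assume a: "a \<in> laurent"
    then have "?u a j \<in> eigenvectors uK"
      using K closed unfolding eigenvectors_def by blast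
    then show "eigen_sum uK (?u a j)"
      using closed[OF a] unfolding eigen_sum_def by (intro exI[of _ "{?u a j}"]) auto
  qed (rule eigen_sum_add[OF res_form.K])
  then have "K_diagonalizable \<epsilon> M"
    unfolding K_diagonalizable_def eigen_sum_def eigenvectors_def by blast
  moreover have "act (uK ^ p) m = m \<and> act (uKinv ^ p) m = m" if "m \<in> carrier M" for m
    using assms _ _ that
  proof (rule generator_induct)
    have root: "(\<epsilon> powi n) ^ p = 1" for n
      using eps_powi_root[of n] by (simp add: power_int_power' mult.commute)
    fix a j assume a: "a \<in> laurent"
    then show "act (uK ^ p) (?u a j) = ?u a j \<and> act (uKinv ^ p) (?u a j) = ?u a j"
      using eigenvector_power(1)[OF res_form.K closed K(1)] eigenvector_power(1)[OF res_form.Kinv closed K(2)]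
      by (simp add: root cscal_1 closed)
  next
    have r: "uK ^ n \<in> res_form" "uKinv ^ n \<in> res_form" for n
      by (induction n) (auto intro: res_form.intros)
    fix x y assume "x \<in> carrier M" "y \<in> carrier M"
      and "act (uK ^ p) x = x \<and> act (uKinv ^ p) x = x"
      and "act (uK ^ p) y = y \<and> act (uKinv ^ p) y = y"
    then show "act (uK ^ p) (x \<oplus> y) = x \<oplus> y \<and> act (uKinv ^ p) (x \<oplus> y) = x \<oplus> y"
      using r by (simp add: smult_r_distr)
  qed
  ultimately show ?thesis
    unfolding type_1_def using left_module_axioms by blast
qed

end

lemma eps_moduleI: "left_module (U_eps \<epsilon>) M \<Longrightarrow> eps_module \<epsilon> M"
  by (simp add: eps_module_def)

text \<open>If the annihilator of \<open>v\<close> did not annihilate \<open>w\<close>, it would by irreducibility of \<open>N\<close> contain an \<open>x\<close> with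
  \<open>x w = w\<close>. Modulo the common annihilator of \<open>v\<close> and \<open>w\<close> the projection of \<open>x\<close> to the highest weight is a
  scalar, which would have to be \<open>0\<close> because of \<open>v\<close> and \<open>1\<close> because of \<open>w\<close>.\<close>

lemma annihilator_subset:
  assumes root: "odd_root_of_unity p \<epsilon>"
    and M: "left_module (U_eps \<epsilon>) M" and v: "highest_weight_generator \<epsilon> p l M v"
    and N: "left_module (U_eps \<epsilon>) N" and w: "highest_weight_generator \<epsilon> p l N w"
    and irr: "irreducible_module (U_eps \<epsilon>) N"
  shows "annihilator \<epsilon> M v \<subseteq> annihilator \<epsilon> N w"
proof
  interpret M: eps_module \<epsilon> M using M by (rule eps_moduleI)
  interpret N: eps_module \<epsilon> N using N by (rule eps_moduleI)
  interpret odd_root_of_unity p \<epsilon> by fact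
  interpret JM: highest_weight_ideal p \<epsilon> l "annihilator \<epsilon> M v"
    using assms(1) v by (rule M.annihilator_highest_weight_ideal)
  interpret J: highest_weight_ideal p \<epsilon> l "annihilator \<epsilon> M v \<inter> annihilator \<epsilon> N w"
    by (intro highest_weight_ideal_Int M.annihilator_highest_weight_ideal[OF assms(1) v]
        N.annihilator_highest_weight_ideal[OF assms(1) w])
  have vc: "v \<in> carrier M" "v \<noteq> \<zero>\<^bsub>M\<^esub>" and wc: "w \<in> carrier N" "w \<noteq> \<zero>\<^bsub>N\<^esub>"
    using v w by (auto simp: highest_weight_generator_def weight_space_def)
  let ?I = "{N.act x w | x. x \<in> annihilator \<epsilon> M v}"
  have "w \<notin> ?I"
  proof
    assume "w \<in> ?I"
    then obtain x where x: "x \<in> res_form" "M.act x v = \<zero>\<^bsub>M\<^esub>" "N.act x w = w"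
      by (auto simp: annihilator_def)
    obtain a n where a: "a \<in> laurent" "J.cong (J.proj n * x) (scal a)"
      using J.proj_scalar[OF x(1)] .
    have r: "J.proj n \<in> res_form" "J.proj n * x \<in> res_form" "scal a \<in> res_form"
      using J.proj_res_form x(1) a(1) by (auto intro: res_form.mult res_form.scal)
    have "M.act (scal a) v = M.act (J.proj n * x) v"
      using a(2) r vc by (intro M.annihilator_cong[symmetric]) (auto simp: J.cong_def)
    also have "\<dots> = \<zero>\<^bsub>M\<^esub>"
      using r x vc by (simp add: M.act_mult M.act_zero)
    finally have av: "cscal \<epsilon> (at_eps \<epsilon> a) \<odot>\<^bsub>M\<^esub> v = \<zero>\<^bsub>M\<^esub>"
      using a(1) by (simp add: cls_scal)
    have "at_eps \<epsilon> a = 0"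
    proof (rule ccontr)
      assume "at_eps \<epsilon> a \<noteq> 0"
      then have "v = cscal \<epsilon> (inverse (at_eps \<epsilon> a)) \<odot>\<^bsub>M\<^esub> (cscal \<epsilon> (at_eps \<epsilon> a) \<odot>\<^bsub>M\<^esub> v)"
        using vc by (simp add: M.cscal_mult M.cscal_1)
      then show False
        unfolding av using vc M.smult_zero_right M.cscal_carrier by simp
    qed
    have "w = N.act 1 w"
      using wc by (simp add: N.act_1)
    also have "\<dots> = N.act (J.proj n) w"
      using J.proj_1[of n] r wc by (intro N.annihilator_cong[symmetric]) (auto simp: J.cong_def)
    also have "\<dots> = N.act (J.proj n * x) w"
      using r x wc by (simp add: N.act_mult)
    also have "\<dots> = N.act (scal a) w"
      using a(2) r wc by (intro N.annihilator_cong) (auto simp: J.cong_def)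
    also have "\<dots> = \<zero>\<^bsub>N\<^esub>"
      using a(1) wc \<open>at_eps \<epsilon> a = 0\<close> N.act_0 by (simp add: cls_scal) (simp add: cscal_def U.c_0)
    finally show False
      using wc by simp
  qed
  moreover have "submodule ?I (U_eps \<epsilon>) N"
    using wc(1) by (rule N.submodule_orbit) (simp_all add: JM.J_0 JM.J_add JM.J_left, simp add: annihilator_def)
  ultimately have I: "?I = {\<zero>\<^bsub>N\<^esub>}"
    using irr wc(1) unfolding irreducible_module_def by blast
  fix x assume "x \<in> annihilator \<epsilon> M v"
  then have "N.act x w \<in> ?I" "x \<in> res_form"
    by (auto simp: annihilator_def)
  then show "x \<in> annihilator \<epsilon> N w"
    unfolding I by (simp add: annihilator_def)
qed

text \<open>Both modules are isomorphic to the quotient of the algebra by the common annihilator of their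
  generators.\<close>

lemma module_iso_if_annihilator_eq:
  assumes M: "left_module (U_eps \<epsilon>) M" and v: "generated_by (U_eps \<epsilon>) M v"
    and N: "left_module (U_eps \<epsilon>) N" and w: "generated_by (U_eps \<epsilon>) N w"
    and ann: "annihilator \<epsilon> M v = annihilator \<epsilon> N w"
  shows "module_iso (U_eps \<epsilon>) M N"
proof -
  interpret M: eps_module \<epsilon> M using M by (rule eps_moduleI)
  interpret N: eps_module \<epsilon> N using N by (rule eps_moduleI)
  have vc: "v \<in> carrier M" and wc: "w \<in> carrier N"
    using v w by (simp_all add: generated_by_def)
  define h where "h m = N.act (SOME x. x \<in> res_form \<and> m = M.act x v) w" for m
  have eq: "M.act x v = M.act y v \<longleftrightarrow> N.act x w = N.act y w"
    if "x \<in> res_form" "y \<in> res_form" for x y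
    using ann M.act_diff[OF that vc] N.act_diff[OF that wc] res_form_diff[OF that]
    unfolding annihilator_def by blast
  have h: "h (M.act x v) = N.act x w" if "x \<in> res_form" for x
  proof -
    let ?y = "SOME y. y \<in> res_form \<and> M.act x v = M.act y v"
    have "?y \<in> res_form \<and> M.act x v = M.act ?y v"
      by (rule someI[of _ x]) (simp add: that)
    then show ?thesis
      unfolding h_def using eq[OF that, of ?y] by metis
  qed
  have "bij_betw h (carrier M) (carrier N)"
    unfolding bij_betw_def
  proof
    show "inj_on h (carrier M)"
    proof (rule inj_onI)
      fix x y assume xy: "x \<in> carrier M" "y \<in> carrier M" "h x = h y"
      obtain a where a: "a \<in> res_form" "x = M.act a v"
        using xy(1) by (rule M.generator_orbit[OF v])
      obtain b where b: "b \<in> res_form" "y = M.act b v"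
        using xy(2) by (rule M.generator_orbit[OF v])
      show "x = y"
        using xy(3) eq[OF a(1) b(1)] h[OF a(1)] h[OF b(1)] unfolding a(2) b(2) by simp
    qed
    show "h ` carrier M = carrier N"
    proof
      show "h ` carrier M \<subseteq> carrier N"
      proof
        fix n assume "n \<in> h ` carrier M"
        then obtain m where m: "m \<in> carrier M" "n = h m"
          by blast
        obtain x where "x \<in> res_form" "m = M.act x v"
          using m(1) by (rule M.generator_orbit[OF v])
        then show "n \<in> carrier N"
          using m(2) h wc by simp
      qed
      show "carrier N \<subseteq> h ` carrier M"
      proof
        fix n assume "n \<in> carrier N"
        then obtain x where "x \<in> res_form" "n = N.act x w"
          by (rule N.generator_orbit[OF w])
        then show "n \<in> h ` carrier M"
          using h vc by (intro image_eqI[of _ _ "M.act x v"]) simp_all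
      qed
    qed
  qed
  moreover have "h (x \<oplus>\<^bsub>M\<^esub> y) = h x \<oplus>\<^bsub>N\<^esub> h y" if xy: "x \<in> carrier M" "y \<in> carrier M" for x y
  proof -
    obtain a where a: "a \<in> res_form" "x = M.act a v"
      using xy(1) by (rule M.generator_orbit[OF v])
    obtain b where b: "b \<in> res_form" "y = M.act b v"
      using xy(2) by (rule M.generator_orbit[OF v])
    show ?thesis
      using a b vc wc h[of "a + b"] h[of a] h[of b] res_form.add[of a b] by (simp add: M.act_add N.act_add)
  qed
  moreover have "h (a \<odot>\<^bsub>M\<^esub> x) = a \<odot>\<^bsub>N\<^esub> h x" if ax: "a \<in> carrier (U_eps \<epsilon>)" "x \<in> carrier M" for a x
  proof -
    obtain a' where a: "a' \<in> res_form" "a = cls \<epsilon> a'"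
      using ax(1) by (rule cls_surj)
    obtain b where b: "b \<in> res_form" "x = M.act b v"
      using ax(2) by (rule M.generator_orbit[OF v])
    show ?thesis
      using a b vc wc h[of "a' * b"] h[of b] res_form.mult[of a' b] by (simp add: M.act_mult N.act_mult)
  qed
  ultimately show ?thesis
    unfolding module_iso_def by blast
qed

lemma highest_weight_module_unique:
  assumes root: "odd_root_of_unity p \<epsilon>"
    and M: "highest_weight_module \<epsilon> p l M" "irreducible_module (U_eps \<epsilon>) M"
    and N: "highest_weight_module \<epsilon> p l N" "irreducible_module (U_eps \<epsilon>) N"
  shows "module_iso (U_eps \<epsilon>) M N"
proof -
  obtain v where v: "highest_weight_generator \<epsilon> p l M v" and M': "left_module (U_eps \<epsilon>) M"
    using M(1) unfolding highest_weight_module_iff type_1_def by blast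
  obtain w where w: "highest_weight_generator \<epsilon> p l N w" and N': "left_module (U_eps \<epsilon>) N"
    using N(1) unfolding highest_weight_module_iff type_1_def by blast
  have "annihilator \<epsilon> M v = annihilator \<epsilon> N w"
    using annihilator_subset[OF root M' v N' w N(2)] annihilator_subset[OF root N' w M' v M(2)] by blast
  then show ?thesis
    using v w M' N' unfolding highest_weight_generator_def by (intro module_iso_if_annihilator_eq) auto
qed

subsection \<open>Transport of structure\<close>

text \<open>A quotient, or a copy, of a module is seen to be a module by means of the map onto it.\<close>

locale eps_epimorphism = M: eps_module \<epsilon> M for \<epsilon> :: complex and M :: "(uq set, 'm) module" +
  fixes N :: "(uq set, 'n) module" and h :: "'m \<Rightarrow> 'n"
  assumes surj: "h ` carrier M = carrier N"
    and h_add: "x \<in> carrier M \<Longrightarrow> y \<in> carrier M \<Longrightarrow> h (x \<oplus>\<^bsub>M\<^esub> y) = h x \<oplus>\<^bsub>N\<^esub> h y"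
    and h_smult: "a \<in> carrier (U_eps \<epsilon>) \<Longrightarrow> x \<in> carrier M \<Longrightarrow> h (a \<odot>\<^bsub>M\<^esub> x) = a \<odot>\<^bsub>N\<^esub> h x"
    and h_zero: "h \<zero>\<^bsub>M\<^esub> = \<zero>\<^bsub>N\<^esub>"
begin

lemma h_closed: "x \<in> carrier M \<Longrightarrow> h x \<in> carrier N"
  using surj by auto

lemma h_surj:
  assumes "y \<in> carrier N"
  obtains x where "x \<in> carrier M" "y = h x"
  using assms surj by auto

lemma left_module_image: "left_module (U_eps \<epsilon>) N"
proof (intro left_module.intro left_module_axioms.intro)
  show "ring (U_eps \<epsilon>)"
    by (rule ring_U_eps)
  show "abelian_group N"
  proof (rule abelian_groupI)
    show "\<zero>\<^bsub>N\<^esub> \<in> carrier N"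
      using h_closed[of "\<zero>\<^bsub>M\<^esub>"] h_zero by simp
  next
    fix x y assume "x \<in> carrier N" "y \<in> carrier N"
    then obtain a b where ab: "a \<in> carrier M" "b \<in> carrier M" "x = h a" "y = h b"
      by (metis h_surj)
    show "x \<oplus>\<^bsub>N\<^esub> y \<in> carrier N"
      using ab h_closed[of "a \<oplus>\<^bsub>M\<^esub> b"] by (simp add: h_add)
    show "x \<oplus>\<^bsub>N\<^esub> y = y \<oplus>\<^bsub>N\<^esub> x"
      using ab by (simp add: h_add[symmetric] M.a_comm)
  next
    fix x y z assume "x \<in> carrier N" "y \<in> carrier N" "z \<in> carrier N"
    then obtain a b c where "a \<in> carrier M" "b \<in> carrier M" "c \<in> carrier M" "x = h a" "y = h b" "z = h c"
      by (metis h_surj)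
    then show "x \<oplus>\<^bsub>N\<^esub> y \<oplus>\<^bsub>N\<^esub> z = x \<oplus>\<^bsub>N\<^esub> (y \<oplus>\<^bsub>N\<^esub> z)"
      by (simp add: h_add[symmetric] M.M.a_assoc)
  next
    fix x assume "x \<in> carrier N"
    then obtain a where a: "a \<in> carrier M" "x = h a"
      by (metis h_surj)
    show "\<zero>\<^bsub>N\<^esub> \<oplus>\<^bsub>N\<^esub> x = x"
      using a by (simp add: h_add[symmetric] h_zero[symmetric])
    show "\<exists>y\<in>carrier N. y \<oplus>\<^bsub>N\<^esub> x = \<zero>\<^bsub>N\<^esub>"
      using a h_closed by (intro bexI[of _ "h (\<ominus>\<^bsub>M\<^esub> a)"]) (simp_all add: h_add[symmetric] h_zero[symmetric] M.M.l_neg)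
  qed
next
  fix a x assume "a \<in> carrier (U_eps \<epsilon>)" "x \<in> carrier N"
  then show "a \<odot>\<^bsub>N\<^esub> x \<in> carrier N"
    by (metis h_surj h_smult h_closed M.smult_closed)
next
  fix a b x assume ab: "a \<in> carrier (U_eps \<epsilon>)" "b \<in> carrier (U_eps \<epsilon>)" "x \<in> carrier N"
  then obtain y where "y \<in> carrier M" "x = h y"
    by (metis h_surj)
  then show "(a \<oplus>\<^bsub>U_eps \<epsilon>\<^esub> b) \<odot>\<^bsub>N\<^esub> x = a \<odot>\<^bsub>N\<^esub> x \<oplus>\<^bsub>N\<^esub> b \<odot>\<^bsub>N\<^esub> x"
    and "(a \<otimes>\<^bsub>U_eps \<epsilon>\<^esub> b) \<odot>\<^bsub>N\<^esub> x = a \<odot>\<^bsub>N\<^esub> (b \<odot>\<^bsub>N\<^esub> x)"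
    using ab by (simp_all add: h_smult[symmetric] h_add[symmetric] M.smult_closed M.smult_l_distr M.smult_assoc1)
next
  fix a x y assume a: "a \<in> carrier (U_eps \<epsilon>)" and "x \<in> carrier N" "y \<in> carrier N"
  then obtain u v where "u \<in> carrier M" "v \<in> carrier M" "x = h u" "y = h v"
    by (metis h_surj)
  then show "a \<odot>\<^bsub>N\<^esub> (x \<oplus>\<^bsub>N\<^esub> y) = a \<odot>\<^bsub>N\<^esub> x \<oplus>\<^bsub>N\<^esub> a \<odot>\<^bsub>N\<^esub> y"
    using a by (simp add: h_smult[symmetric] h_add[symmetric] M.smult_closed M.smult_r_distr)
next
  fix x assume "x \<in> carrier N"
  then obtain y where "y \<in> carrier M" "x = h y"
    by (metis h_surj)
  then show "\<one>\<^bsub>U_eps \<epsilon>\<^esub> \<odot>\<^bsub>N\<^esub> x = x"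
    by (simp add: h_smult[symmetric] M.smult_one)
qed

lemma submodule_vimage:
  assumes "submodule P (U_eps \<epsilon>) N"
  shows "submodule {x \<in> carrier M. h x \<in> P} (U_eps \<epsilon>) M"
proof -
  interpret N: eps_module \<epsilon> N
    using left_module_image by (rule eps_moduleI)
  note P = N.submoduleD[OF assms]
  show ?thesis
    by (rule M.submoduleI) (auto simp: h_zero h_add h_smult P)
qed

lemma generator_image:
  assumes "highest_weight_generator \<epsilon> p l M v" "h v \<noteq> \<zero>\<^bsub>N\<^esub>"
  shows "highest_weight_generator \<epsilon> p l N (h v)"
proof -
  interpret N: eps_module \<epsilon> N
    using left_module_image by (rule eps_moduleI)
  have v: "v \<in> carrier M"
    using assms by (auto simp: highest_weight_generator_def generated_by_def)
  have r: "cls \<epsilon> uK \<in> carrier (U_eps \<epsilon>)" "cls \<epsilon> (Kbinom p) \<in> carrier (U_eps \<epsilon>)"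
    "cls \<epsilon> (divE n) \<in> carrier (U_eps \<epsilon>)" for n
    by (simp_all add: res_form.K Kbinom_eq_Kb res_form_Kb res_form_divE)
  have "h v \<in> weight_space \<epsilon> p N l"
    using assms v r M.cscal_carrier unfolding highest_weight_generator_def weight_space_def
    by (auto simp: h_closed simp flip: h_smult)
  moreover have "cls \<epsilon> (divE n) \<odot>\<^bsub>N\<^esub> h v = \<zero>\<^bsub>N\<^esub>" if "cls \<epsilon> (divE n) \<odot>\<^bsub>M\<^esub> v = \<zero>\<^bsub>M\<^esub>" for n
    using that v r by (simp add: h_zero flip: h_smult)
  moreover have "generated_by (U_eps \<epsilon>) N (h v)"
    unfolding generated_by_def
  proof (intro conjI allI impI)
    show "h v \<in> carrier N"
      using v by (simp add: h_closed)
    fix P assume P: "submodule P (U_eps \<epsilon>) N \<and> h v \<in> P"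
    then have "{x \<in> carrier M. h x \<in> P} = carrier M"
      using assms submodule_vimage v unfolding highest_weight_generator_def generated_by_def by blast
    then have "carrier N \<subseteq> P"
      by (auto elim!: h_surj)
    then show "P = carrier N"
      using N.submoduleD(1) P by blast
  qed
  ultimately show ?thesis
    using assms unfolding highest_weight_generator_def by blast
qed

end

locale eps_isomorphism = eps_epimorphism +
  assumes inj: "inj_on h (carrier M)"
begin

lemma h_eq_iff: "x \<in> carrier M \<Longrightarrow> y \<in> carrier M \<Longrightarrow> h x = h y \<longleftrightarrow> x = y"
  using inj by (auto simp: inj_on_def)

lemma irreducible_image:
  assumes "irreducible_module (U_eps \<epsilon>) M"
  shows "irreducible_module (U_eps \<epsilon>) N"
proof -
  interpret N: eps_module \<epsilon> N
    using left_module_image by (rule eps_moduleI)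
  have nonzero: "carrier N \<noteq> {\<zero>\<^bsub>N\<^esub>}"
  proof
    assume N: "carrier N = {\<zero>\<^bsub>N\<^esub>}"
    have "x = \<zero>\<^bsub>M\<^esub>" if "x \<in> carrier M" for x
      using h_closed[OF that] that h_eq_iff[of x "\<zero>\<^bsub>M\<^esub>"] unfolding N by (simp add: h_zero)
    then show False
      using assms unfolding irreducible_module_def by auto
  qed
  have "P = {\<zero>\<^bsub>N\<^esub>} \<or> P = carrier N" if P: "submodule P (U_eps \<epsilon>) N" for P
  proof -
    let ?Q = "{x \<in> carrier M. h x \<in> P}"
    have im: "P = h ` ?Q"
      using N.submoduleD(1)[OF P] by (auto elim!: h_surj)
    have "?Q = {\<zero>\<^bsub>M\<^esub>} \<or> ?Q = carrier M"
      using assms submodule_vimage[OF P] unfolding irreducible_module_def by blast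
    then show ?thesis
      using im surj by (auto simp: h_zero)
  qed
  then show ?thesis
    using nonzero unfolding irreducible_module_def by blast
qed

end

text \<open>The copy represents a vector by the set of all algebra elements that take the generator to it. These
  sets are nonempty and disjoint.\<close>

lemma highest_weight_module_copy:
  fixes M :: "(uq set, 'm) module"
  assumes root: "odd_root_of_unity p \<epsilon>"
    and M: "highest_weight_module \<epsilon> p l M" "irreducible_module (U_eps \<epsilon>) M"
  shows "\<exists>N :: (uq set, uq set set) module.
    highest_weight_module \<epsilon> p l N \<and> irreducible_module (U_eps \<epsilon>) N"
proof -
  obtain v where v: "highest_weight_generator \<epsilon> p l M v" and "left_module (U_eps \<epsilon>) M"
    using M(1) unfolding highest_weight_module_iff type_1_def by blast
  then interpret M: eps_module \<epsilon> M
    by (intro eps_moduleI)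
  define h where "h m = {a \<in> carrier (U_eps \<epsilon>). a \<odot>\<^bsub>M\<^esub> v = m}" for m
  have gen: "generated_by (U_eps \<epsilon>) M v"
    using v by (simp add: highest_weight_generator_def)
  have inj: "inj_on h (carrier M)"
  proof (rule inj_onI)
    fix x y assume x: "x \<in> carrier M" and xy: "h x = h y"
    obtain a where "a \<in> res_form" "x = cls \<epsilon> a \<odot>\<^bsub>M\<^esub> v"
      using x by (rule M.generator_orbit[OF gen])
    then have "cls \<epsilon> a \<in> h x"
      by (simp add: h_def)
    then have "cls \<epsilon> a \<in> h x \<inter> h y"
      unfolding xy by simp
    then show "x = y"
      by (auto simp: h_def)
  qed
  define g where "g = inv_into (carrier M) h"
  define N :: "(uq set, uq set set) module" where "N = \<lparr>carrier = h ` carrier M, mult = undefined, one = undefined, zero = h \<zero>\<^bsub>M\<^esub>,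
     add = \<lambda>X Y. h (g X \<oplus>\<^bsub>M\<^esub> g Y), smult = \<lambda>a X. h (a \<odot>\<^bsub>M\<^esub> g X)\<rparr>"
  have g: "g (h x) = x" if "x \<in> carrier M" for x
    unfolding g_def using inj that by (rule inv_into_f_f)
  interpret eps_isomorphism \<epsilon> M N h
    by unfold_locales (use inj g in \<open>auto simp: N_def\<close>)
  interpret N: eps_module \<epsilon> N
    using left_module_image by (rule eps_moduleI)
  have "highest_weight_generator \<epsilon> p l N (h v)"
    using v v[THEN M.generator_carrier] v[unfolded highest_weight_generator_def] by (intro generator_image) (simp_all add: h_eq_iff flip: h_zero)
  then have "highest_weight_module \<epsilon> p l N"
    using N.generator_type_1[OF root] unfolding highest_weight_module_iff by blast
  then show ?thesis
    using irreducible_image[OF M(2)] by blast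
qed

lemma module_iso_V_res:
  assumes root: "odd_root_of_unity p \<epsilon>"
    and M: "highest_weight_module \<epsilon> p l M" "irreducible_module (U_eps \<epsilon>) M"
  shows "module_iso (U_eps \<epsilon>) M (V_res \<epsilon> p l)"
proof -
  have "highest_weight_module \<epsilon> p l (V_res \<epsilon> p l) \<and> irreducible_module (U_eps \<epsilon>) (V_res \<epsilon> p l)"
    unfolding V_res_def by (rule someI_ex[OF highest_weight_module_copy[OF assms]])
  then show ?thesis
    using highest_weight_module_unique[OF root M] by blast
qed

section \<open>The quantum group acting on functions\<close>

text \<open>A function on pairs of natural numbers stands for the formal, possibly infinite, combination of the
  \<open>g(a,b)\<close> with these coefficients. The generators act on infinite combinations as well, because a
  coefficient of the image depends on a single coefficient of the argument.\<close>

fun gen_op :: "gen \<Rightarrow> (nat \<times> nat \<Rightarrow> cq) \<Rightarrow> nat \<times> nat \<Rightarrow> cq" where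
  "gen_op GenE \<phi> (a, b) = qint (int (Suc b)) * \<phi> (Suc a, Suc b)"
| "gen_op GenF \<phi> (a, b) = (if a = 0 \<or> b = 0 then 0 else - qint (int a) * \<phi> (a - 1, b - 1))"
| "gen_op GenK \<phi> (a, b) = qq powi (- int (Suc (a + b))) * \<phi> (a, b)"
| "gen_op GenKinv \<phi> (a, b) = qq powi int (Suc (a + b)) * \<phi> (a, b)"

lemma gen_op_add: "gen_op g (\<lambda>i. \<phi> i + \<psi> i) = (\<lambda>i. gen_op g \<phi> i + gen_op g \<psi> i)"
proof
  fix i show "gen_op g (\<lambda>i. \<phi> i + \<psi> i) i = gen_op g \<phi> i + gen_op g \<psi> i"
    by (cases g; cases i) (simp_all add: algebra_simps)
qed

lemma gen_op_scale: "gen_op g (\<lambda>i. c * \<phi> i) = (\<lambda>i. c * gen_op g \<phi> i)"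
proof
  fix i show "gen_op g (\<lambda>i. c * \<phi> i) i = c * gen_op g \<phi> i"
    by (cases g; cases i) simp_all
qed

definition word_op :: "word \<Rightarrow> (nat \<times> nat \<Rightarrow> cq) \<Rightarrow> nat \<times> nat \<Rightarrow> cq" where
  "word_op w \<phi> = foldr gen_op (letters w) \<phi>"

lemma word_op_plus: "word_op (v + w) \<phi> = word_op v (word_op w \<phi>)"
  by (simp add: word_op_def plus_word_def)

lemma word_op_zero: "word_op 0 \<phi> = \<phi>"
  by (simp add: word_op_def zero_word_def)

lemma word_op_add: "word_op w (\<lambda>i. \<phi> i + \<psi> i) = (\<lambda>i. word_op w \<phi> i + word_op w \<psi> i)"
proof -
  have "foldr gen_op gs (\<lambda>i. \<phi> i + \<psi> i) = (\<lambda>i. foldr gen_op gs \<phi> i + foldr gen_op gs \<psi> i)" for gs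
    by (induction gs) (simp_all add: gen_op_add)
  then show ?thesis
    by (simp add: word_op_def)
qed

lemma word_op_scale: "word_op w (\<lambda>i. c * \<phi> i) = (\<lambda>i. c * word_op w \<phi> i)"
proof -
  have "foldr gen_op gs (\<lambda>i. c * \<phi> i) = (\<lambda>i. c * foldr gen_op gs \<phi> i)" for gs
    by (induction gs) (simp_all add: gen_op_scale)
  then show ?thesis
    by (simp add: word_op_def)
qed

definition free_op :: "free_alg \<Rightarrow> (nat \<times> nat \<Rightarrow> cq) \<Rightarrow> nat \<times> nat \<Rightarrow> cq" where
  "free_op x \<phi> i = (\<Sum>w\<in>keys x. lookup x w * word_op w \<phi> i)"

lemma free_op_superset:
  assumes "finite S" "keys x \<subseteq> S"
  shows "free_op x \<phi> i = (\<Sum>w\<in>S. lookup x w * word_op w \<phi> i)"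
  unfolding free_op_def using assms
  by (intro sum.mono_neutral_left) (auto simp: not_in_keys_iff_lookup_eq_zero)

lemma free_op_plus: "free_op (x + y) \<phi> i = free_op x \<phi> i + free_op y \<phi> i"
proof -
  let ?S = "keys x \<union> keys y"
  have "free_op (x + y) \<phi> i = (\<Sum>w\<in>?S. lookup (x + y) w * word_op w \<phi> i)"
    using keys_add[of x y] by (intro free_op_superset) auto
  also have "\<dots> = (\<Sum>w\<in>?S. lookup x w * word_op w \<phi> i) + (\<Sum>w\<in>?S. lookup y w * word_op w \<phi> i)"
    by (simp add: lookup_add distrib_right sum.distrib)
  also have "\<dots> = free_op x \<phi> i + free_op y \<phi> i"
    using free_op_superset[of ?S x \<phi> i] free_op_superset[of ?S y \<phi> i] by simp
  finally show ?thesis .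
qed

lemma free_op_single: "free_op (single w c) \<phi> i = c * word_op w \<phi> i"
  by (simp add: free_op_def)

lemma free_op_add: "free_op x (\<lambda>i. \<phi> i + \<psi> i) = (\<lambda>i. free_op x \<phi> i + free_op x \<psi> i)"
  by (rule ext) (simp add: free_op_def word_op_add distrib_left sum.distrib)

lemma free_op_scale: "free_op x (\<lambda>i. c * \<phi> i) = (\<lambda>i. c * free_op x \<phi> i)"
  by (rule ext) (simp add: free_op_def word_op_scale sum_distrib_left mult_ac)

lemma free_op_times: "free_op (x * y) \<phi> = free_op x (free_op y \<phi>)"
proof (induction x rule: poly_mapping_additive_induct)
  case (single v c)
  show ?case
  proof (induction y rule: poly_mapping_additive_induct)
    case (single w d)
    have "free_op (single w d) \<phi> = (\<lambda>i. d * word_op w \<phi> i)"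
      by (rule ext) (rule free_op_single)
    then show ?case
      by (intro ext) (simp add: mult_single free_op_single word_op_plus word_op_scale)
  next
    case (add y z)
    have "free_op (y + z) \<phi> = (\<lambda>i. free_op y \<phi> i + free_op z \<phi> i)"
      by (rule ext) (rule free_op_plus)
    then show ?case
      using add by (intro ext) (simp add: distrib_left free_op_plus free_op_add)
  qed
next
  case (add x y)
  then show ?case
    by (intro ext) (simp add: distrib_right free_op_plus)
qed

lemma free_op_0: "free_op 0 \<phi> i = 0"
  by (simp add: free_op_def)

lemma free_op_minus: "free_op (x - y) \<phi> i = free_op x \<phi> i - free_op y \<phi> i"
  using free_op_plus[of "x - y" y \<phi> i] by simp

lemma free_op_1: "free_op 1 \<phi> = \<phi>"
  by (rule ext) (simp add: free_op_single word_op_zero flip: single_one)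

lemma free_op_gen: "free_op (free_gen g) \<phi> = gen_op g \<phi>"
  by (rule ext) (simp add: free_gen_def free_op_single word_op_def)

lemma free_op_scal: "free_op (free_scal c) \<phi> = (\<lambda>i. c * \<phi> i)"
  by (rule ext) (simp add: free_scal_def free_op_single word_op_zero)

lemma free_op_zero_fun: "free_op x (\<lambda>i. 0) = (\<lambda>i. 0)"
  using free_op_scale[of x 0 "\<lambda>i. 0"] by simp

lemma qint_mult_diff: "qint (a + 1) * qint (b + 1) - qint a * qint b = qint (a + b + 1)"
proof -
  have "(a * q - inverse (a * q)) * (b * q - inverse (b * q)) - (a - inverse a) * (b - inverse b)
     = (a * b * q - inverse (a * b * q)) * (q - inverse q)" if "a \<noteq> 0" "b \<noteq> 0" "q \<noteq> 0" for a b q :: cq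
    using that by (simp add: field_simps)
  from this[of "qq powi a" "qq powi b" qq]
  have "(qq powi (a + 1) - inverse (qq powi (a + 1))) * (qq powi (b + 1) - inverse (qq powi (b + 1)))
     - (qq powi a - inverse (qq powi a)) * (qq powi b - inverse (qq powi b))
     = (qq powi (a + b + 1) - inverse (qq powi (a + b + 1))) * (qq - inverse qq)"
    by (simp add: qq_powi_add)
  moreover have "x * inverse d * (y * inverse d) - z * inverse d * (w * inverse d) = u * inverse d"
    if "x * y - z * w = u * d" "d \<noteq> 0" for x y z w u d :: cq
    using that by (simp add: field_simps)
  ultimately show ?thesis
    unfolding qint_alt using qq_minus_inverse_nonzero(1) by blast
qed

lemma free_op_relator:
  assumes "r \<in> uq_relators"
  shows "free_op r \<phi> (a, b) = 0"
proof -
  let ?n = "int (Suc (a + b))"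
  have shift: "u * (x * (v * y)) = (u * v) * (x * y)" for u x v y :: cq
    by (simp only: mult_ac)
  have inv: "qq powi (- n) * (qq powi n * y) = y" "qq powi n * (qq powi (- n) * y) = y" for n y
    by (simp_all add: qq_powi_uminus)
  have E: "qq powi (- ?n) * (x * (qq powi int (Suc (Suc a + Suc b)) * y)) = qq powi 2 * (x * y)" for x y
  proof -
    have "qq powi (- ?n) * qq powi int (Suc (Suc a + Suc b)) = qq powi 2"
      by (subst qq_powi_add[symmetric]) (simp add: algebra_simps)
    then show ?thesis
      unfolding shift by (rule arg_cong)
  qed
  have F: "qq powi (- ?n) * (x * (qq powi int (Suc (a - 1 + (b - 1))) * y)) = qq powi (- 2) * (x * y)"
    if "a \<noteq> 0" "b \<noteq> 0" for x y
  proof -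
    have "- ?n + int (Suc (a - 1 + (b - 1))) = - 2"
      using that by simp
    then have "qq powi (- ?n) * qq powi int (Suc (a - 1 + (b - 1))) = qq powi (- 2)"
      by (subst qq_powi_add[symmetric]) simp
    then show ?thesis
      unfolding shift by (rule arg_cong)
  qed
  have EF: "- (qint (int (Suc b)) * qint (int (Suc a))) + qint (int a) * qint (int b) =
     inverse (qq - inverse qq) * (qq powi (- ?n) - qq powi ?n)"
  proof -
    have "- (qint (int (Suc b)) * qint (int (Suc a))) + qint (int a) * qint (int b) = - qint ?n"
      using qint_mult_diff[of "int a" "int b"] by (simp add: algebra_simps)
    also have "\<dots> = inverse (qq - inverse qq) * (qq powi (- ?n) - qq powi ?n)"
    proof -
      have "- ((u - v) / d) = inverse d * (v - u)" for u v d :: cq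
        by (simp add: divide_inverse algebra_simps)
      then show ?thesis
        unfolding qint_def .
    qed
    finally show ?thesis .
  qed
  consider "r = free_gen GenK * free_gen GenKinv - 1" | "r = free_gen GenKinv * free_gen GenK - 1"
    | "r = free_gen GenK * free_gen GenE * free_gen GenKinv - free_scal (qq powi 2) * free_gen GenE"
    | "r = free_gen GenK * free_gen GenF * free_gen GenKinv - free_scal (qq powi (- 2)) * free_gen GenF"
    | "r = free_gen GenE * free_gen GenF - free_gen GenF * free_gen GenE
         - free_scal (inverse (qq - inverse qq)) * (free_gen GenK - free_gen GenKinv)"
    using assms unfolding uq_relators_def Let_def by blast
  then show ?thesis
  proof cases
    case 1
    then show ?thesis
      by (simp only: free_op_minus free_op_times free_op_gen free_op_1 gen_op.simps inv diff_self)
  next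
    case 2
    then show ?thesis
      by (simp only: free_op_minus free_op_times free_op_gen free_op_1 gen_op.simps inv diff_self)
  next
    case 3
    then show ?thesis
      by (simp only: free_op_minus free_op_times free_op_gen free_op_scal gen_op.simps E) simp
  next
    case 4
    show ?thesis
    proof (cases "a = 0 \<or> b = 0")
      case True
      then show ?thesis
        unfolding 4 by (simp add: free_op_minus free_op_times free_op_gen free_op_scal)
    next
      case False
      then have nz: "(a = 0 \<or> b = 0) = False" "a \<noteq> 0" "b \<noteq> 0"
        by auto
      show ?thesis
        by (simp only: 4 free_op_minus free_op_times free_op_gen free_op_scal gen_op.simps nz(1) if_False
          F[OF nz(2,3)] diff_self)
    qed
  next
    case 5
    have "gen_op GenE (gen_op GenF \<phi>) (a, b) = - (qint (int (Suc b)) * qint (int (Suc a))) * \<phi> (a, b)"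
      by (simp del: of_nat_Suc)
    moreover have "gen_op GenF (gen_op GenE \<phi>) (a, b) = - (qint (int a) * qint (int b)) * \<phi> (a, b)"
      by (cases a; cases b) (simp_all del: of_nat_Suc)
    ultimately have "free_op r \<phi> (a, b) =
        (- (qint (int (Suc b)) * qint (int (Suc a))) + qint (int a) * qint (int b)) * \<phi> (a, b)
        - inverse (qq - inverse qq) * (qq powi (- ?n) * \<phi> (a, b) - qq powi ?n * \<phi> (a, b))"
      unfolding 5 free_op_minus free_op_times free_op_gen free_op_scal by (simp add: algebra_simps)
    then show ?thesis
      unfolding EF by (simp add: algebra_simps)
  qed
qed

lemma free_op_ideal: "x \<in> uq_ideal \<Longrightarrow> free_op x \<phi> = (\<lambda>i. 0)"
proof (induction arbitrary: \<phi> rule: uq_ideal.induct)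
  case zero
  then show ?case
    by (intro ext) (rule free_op_0)
next
  case (gen r a b)
  have "free_op r \<psi> = (\<lambda>i. 0)" for \<psi>
    using free_op_relator[OF gen] by (intro ext) auto
  then show ?case
    by (simp add: free_op_times free_op_zero_fun)
next
  case (add x y)
  then show ?case
    by (intro ext) (simp add: free_op_plus)
qed

lift_definition uq_op :: "uq \<Rightarrow> (nat \<times> nat \<Rightarrow> cq) \<Rightarrow> nat \<times> nat \<Rightarrow> cq" is free_op
proof -
  fix x y assume "uq_cong x y"
  then have "free_op (x - y) \<phi> i = 0" for \<phi> i
    unfolding uq_cong_def by (simp add: free_op_ideal)
  then show "free_op x = free_op y"
    by (intro ext) (simp add: free_op_minus)
qed

lemma uq_op_plus: "uq_op (x + y) \<phi> i = uq_op x \<phi> i + uq_op y \<phi> i"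
  by transfer (rule free_op_plus)

lemma uq_op_times: "uq_op (x * y) \<phi> = uq_op x (uq_op y \<phi>)"
  by transfer (rule free_op_times)

lemma uq_op_1: "uq_op 1 \<phi> = \<phi>"
  by transfer (rule free_op_1)

lemma uq_op_scal: "uq_op (scal c) \<phi> = (\<lambda>i. c * \<phi> i)"
  by transfer (rule free_op_scal)

lemma uq_op_add: "uq_op x (\<lambda>i. \<phi> i + \<psi> i) = (\<lambda>i. uq_op x \<phi> i + uq_op x \<psi> i)"
  by transfer (rule free_op_add)

lemma uq_op_scale: "uq_op x (\<lambda>i. c * \<phi> i) = (\<lambda>i. c * uq_op x \<phi> i)"
  by transfer (rule free_op_scale)

lemma uq_op_gen: "uq_op uE = gen_op GenE" "uq_op uF = gen_op GenF" "uq_op uK = gen_op GenK" "uq_op uKinv = gen_op GenKinv"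
  by (rule ext, transfer, rule free_op_gen)+

lemma uF_divF: "uF * divF r = scal (qint (int (Suc r))) * divF (Suc r)"
proof -
  have "qint (int (Suc r)) * inverse (qfact (Suc r)) = inverse (qfact r)"
    by (simp add: qfact_Suc)
  then show ?thesis
    by (simp only: divF_def U.c_left_commute[of uF] U.c_c power_Suc)
qed

lemma qbinom_absorb:
  "qint (int (Suc r)) * qbinom (int (b + Suc r)) (int (Suc r)) = qint (int (Suc b)) * qbinom (int (Suc b + r)) (int r)"
  "qint (int (Suc r)) * qbinom (int (b + Suc r)) (int (Suc r)) = qint (int (b + Suc r)) * qbinom (int (b + r)) (int r)"
  unfolding qbinom_nat by (simp_all add: qfact_Suc field_simps del: of_nat_Suc of_nat_add)

lemma uq_op_divE: "uq_op (divE r) \<phi> (a, b) = qbinom (int (b + r)) (int r) * \<phi> (a + r, b + r)"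
proof (induction r arbitrary: a b)
  case 0
  then show ?case
    by (simp add: uq_op_1)
next
  case (Suc r)
  have "qint (int (Suc r)) * uq_op (divE (Suc r)) \<phi> (a, b) = uq_op (uE * divE r) \<phi> (a, b)"
    unfolding uE_divE uq_op_times uq_op_scal ..
  also have "\<dots> = qint (int (Suc b)) * (qbinom (int (Suc b + r)) (int r) * \<phi> (Suc a + r, Suc b + r))"
    unfolding uq_op_times uq_op_gen gen_op.simps Suc ..
  also have "\<dots> = qint (int (Suc r)) * (qbinom (int (b + Suc r)) (int (Suc r)) * \<phi> (a + Suc r, b + Suc r))"
    using qbinom_absorb(1)[of r b] by (simp del: of_nat_Suc of_nat_add add: mult.assoc[symmetric])
  finally show ?case
    by (simp del: of_nat_Suc of_nat_add)
qed

lemma uq_op_divF: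
  "uq_op (divF r) \<phi> (a, b) = (if a < r \<or> b < r then 0 else (- 1) ^ r * qbinom (int a) (int r) * \<phi> (a - r, b - r))"
proof (induction r arbitrary: a b)
  case 0
  then show ?case
    by (simp add: uq_op_1)
next
  case (Suc r)
  have eq: "qint (int (Suc r)) * uq_op (divF (Suc r)) \<phi> (a, b) = gen_op GenF (uq_op (divF r) \<phi>) (a, b)"
    by (simp only: uq_op_gen(2)[symmetric] uq_op_times[symmetric] uF_divF) (simp only: uq_op_times uq_op_scal)
  show ?case
  proof (cases "a < Suc r \<or> b < Suc r")
    case True
    then have "gen_op GenF (uq_op (divF r) \<phi>) (a, b) = 0"
      by (auto simp: Suc)
    then show ?thesis
      using eq True by simp
  next
    case False
    define c where "c = a - Suc r"
    have a: "a = c + Suc r" "a - 1 = c + r" "a - 1 - r = a - Suc r" "b - 1 - r = b - Suc r"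
      using False by (auto simp: c_def)
    have "gen_op GenF (uq_op (divF r) \<phi>) (a, b) =
      - qint (int a) * ((- 1) ^ r * qbinom (int (a - 1)) (int r) * \<phi> (a - 1 - r, b - 1 - r))"
      using False by (auto simp: Suc)
    also have "\<dots> = (- 1) ^ Suc r * (qint (int (c + Suc r)) * qbinom (int (c + r)) (int r)) * \<phi> (a - Suc r, b - Suc r)"
      unfolding a by simp
    also have "\<dots> = qint (int (Suc r)) * ((- 1) ^ Suc r * qbinom (int a) (int (Suc r)) * \<phi> (a - Suc r, b - Suc r))"
      unfolding qbinom_absorb(2)[symmetric] a(1) by (simp only: mult_ac)
    finally have "qint (int (Suc r)) * uq_op (divF (Suc r)) \<phi> (a, b) =
       qint (int (Suc r)) * ((- 1) ^ Suc r * qbinom (int a) (int (Suc r)) * \<phi> (a - Suc r, b - Suc r))"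
      unfolding eq .
    moreover have "qint (int (Suc r)) \<noteq> 0"
      by simp
    ultimately have "uq_op (divF (Suc r)) \<phi> (a, b) =
       (- 1) ^ Suc r * qbinom (int a) (int (Suc r)) * \<phi> (a - Suc r, b - Suc r)"
      using mult_left_cancel by blast
    then show ?thesis
      using False by (simp only: if_False simp_thms)
  qed
qed

section \<open>The specialized action on the q-Fock space\<close>

lemma lookup_fock_scale: "lookup (fock_scale c v) i = c * lookup v i"
  by (simp add: fock_scale_def map.rep_eq when_def)

context odd_root_of_unity
begin

definition regular_fun :: "(nat \<times> nat \<Rightarrow> cq) set" where
  "regular_fun = {\<phi>. \<forall>i. \<phi> i \<in> regular \<epsilon>}"

lemma regular_funI: "(\<And>a b. \<phi> (a, b) \<in> regular \<epsilon>) \<Longrightarrow> \<phi> \<in> regular_fun"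
  by (auto simp: regular_fun_def)

lemma regular_funD: "\<phi> \<in> regular_fun \<Longrightarrow> \<phi> i \<in> regular \<epsilon>"
  by (simp add: regular_fun_def del: split_paired_All)

lemma res_form_regular_fun:
  "x \<in> res_form \<Longrightarrow> \<phi> \<in> regular_fun \<Longrightarrow> uq_op x \<phi> \<in> regular_fun"
proof (induction arbitrary: \<phi> rule: res_form.induct)
  case (scal a)
  then show ?case
    by (auto simp: uq_op_scal intro!: regular_funI regular_mult(1) laurent_regular[of \<epsilon> a] dest: regular_funD)
next
  case K
  then show ?case
    using qq_powi_unit by (auto simp: uq_op_gen unit_at_def simp del: of_nat_Suc
      intro!: regular_funI regular_mult dest: regular_funD)
next
  case Kinv
  then show ?case
    using qq_powi_unit
    by (auto simp: uq_op_gen unit_at_def simp del: of_nat_Suc power_int_of_nat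
      intro!: regular_funI regular_mult dest: regular_funD)
next
  case (divE r)
  then show ?case
    by (auto simp: uq_op_divE simp del: of_nat_add
      intro!: regular_funI regular_mult qbinom_regular dest: regular_funD)
next
  case (divF r)
  then show ?case
    by (auto simp: uq_op_divF
      intro!: regular_funI regular_mult regular_power regular_uminus qbinom_regular dest: regular_funD)
next
  case (add x y)
  then show ?case
    by (auto simp: uq_op_plus intro!: regular_funI regular_add dest: regular_funD)
next
  case (mult x y)
  then show ?case
    by (simp add: uq_op_times)
qed

definition eps_op :: "uq \<Rightarrow> (nat \<times> nat \<Rightarrow> complex) \<Rightarrow> nat \<times> nat \<Rightarrow> complex" where
  "eps_op x \<psi> i = at_eps \<epsilon> (uq_op x (\<lambda>j. const_cq (\<psi> j)) i)"

lemma const_regular_fun: "(\<lambda>j. const_cq (\<psi> j)) \<in> regular_fun"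
  by (simp add: regular_funI)

lemma uq_op_const_regular: "x \<in> res_form \<Longrightarrow> uq_op x (\<lambda>j. const_cq (\<psi> j)) i \<in> regular \<epsilon>"
  by (intro regular_funD res_form_regular_fun const_regular_fun)

text \<open>A regular function differs from its value by a multiple of \<open>q - \<epsilon>\<close>, and its image from the image of the
  value by a multiple of \<open>q - \<epsilon>\<close> again. So the value of the image depends only on the value of the
  function, which makes the specialized operators multiplicative.\<close>

lemma at_eps_uq_op:
  assumes "x \<in> res_form" "\<phi> \<in> regular_fun"
  shows "at_eps \<epsilon> (uq_op x \<phi> i) = eps_op x (\<lambda>j. at_eps \<epsilon> (\<phi> j)) i"
proof -
  let ?c = "\<lambda>j. const_cq (at_eps \<epsilon> (\<phi> j))"
  have "\<exists>z. z \<in> regular \<epsilon> \<and> \<phi> j - ?c j = (qq - const_cq \<epsilon>) * z" for j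
  proof -
    have "\<phi> j - ?c j \<in> regular \<epsilon>" "at_eps \<epsilon> (\<phi> j - ?c j) = 0"
      using regular_funD[OF assms(2), of j] by (auto simp: at_eps_diff intro!: regular_diff)
    then show ?thesis
      using at_eps_eq_0D by metis
  qed
  then obtain \<chi> where \<chi>: "\<And>j. \<chi> j \<in> regular \<epsilon>" "\<And>j. \<phi> j - ?c j = (qq - const_cq \<epsilon>) * \<chi> j"
    by metis
  have \<phi>: "\<phi> = (\<lambda>j. ?c j + (qq - const_cq \<epsilon>) * \<chi> j)"
    by (rule ext) (simp flip: \<chi>(2))
  have "uq_op x \<phi> i = uq_op x (\<lambda>j. ?c j + (qq - const_cq \<epsilon>) * \<chi> j) i"
    using \<phi> by (rule arg_cong)
  also have "\<dots> = uq_op x ?c i + (qq - const_cq \<epsilon>) * uq_op x \<chi> i"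
    by (simp only: uq_op_add uq_op_scale)
  finally have eq: "uq_op x \<phi> i = uq_op x ?c i + (qq - const_cq \<epsilon>) * uq_op x \<chi> i" .
  have "uq_op x \<chi> i \<in> regular \<epsilon>"
    by (rule regular_funD[OF res_form_regular_fun[OF assms(1) regular_funI]]) (rule \<chi>(1))
  then have "at_eps \<epsilon> ((qq - const_cq \<epsilon>) * uq_op x \<chi> i) = 0" "(qq - const_cq \<epsilon>) * uq_op x \<chi> i \<in> regular \<epsilon>"
    by (simp_all add: at_eps_mult at_eps_diff regular_diff(1) regular_mult(1))
  then show ?thesis
    unfolding eq eps_op_def using uq_op_const_regular[OF assms(1)] by (simp add: at_eps_add)
qed

lemma eps_op_times:
  assumes "x \<in> res_form" "y \<in> res_form"
  shows "eps_op (x * y) \<psi> = eps_op x (eps_op y \<psi>)"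
proof
  fix i
  have "eps_op (x * y) \<psi> i = at_eps \<epsilon> (uq_op x (uq_op y (\<lambda>j. const_cq (\<psi> j))) i)"
    by (simp add: eps_op_def uq_op_times)
  also have "\<dots> = eps_op x (\<lambda>j. at_eps \<epsilon> (uq_op y (\<lambda>j. const_cq (\<psi> j)) j)) i"
    using assms by (intro at_eps_uq_op res_form_regular_fun const_regular_fun)
  also have "(\<lambda>j. at_eps \<epsilon> (uq_op y (\<lambda>j. const_cq (\<psi> j)) j)) = eps_op y \<psi>"
    by (rule ext) (rule eps_op_def[symmetric])
  finally show "eps_op (x * y) \<psi> i = eps_op x (eps_op y \<psi>) i" .
qed

lemma eps_op_plus:
  assumes "x \<in> res_form" "y \<in> res_form"
  shows "eps_op (x + y) \<psi> i = eps_op x \<psi> i + eps_op y \<psi> i"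
  unfolding eps_op_def uq_op_plus using assms by (intro at_eps_add uq_op_const_regular)

lemma eps_op_add:
  assumes "x \<in> res_form"
  shows "eps_op x (\<lambda>j. \<psi> j + \<psi>' j) i = eps_op x \<psi> i + eps_op x \<psi>' i"
  unfolding eps_op_def const_cq_add uq_op_add using assms by (intro at_eps_add uq_op_const_regular)

lemma eps_op_scal: "a \<in> laurent \<Longrightarrow> eps_op (scal a) \<psi> i = at_eps \<epsilon> a * \<psi> i"
  unfolding eps_op_def uq_op_scal by (simp add: at_eps_mult laurent_regular)

lemma eps_op_1: "eps_op 1 \<psi> = \<psi>"
  by (rule ext) (simp add: eps_op_def uq_op_1)

lemma eps_op_cls:
  assumes "x \<in> res_form" "y \<in> res_form" "cls \<epsilon> x = cls \<epsilon> y"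
  shows "eps_op x \<psi> = eps_op y \<psi>"
proof
  fix i
  obtain z where z: "z \<in> res_form" "x = y + shifted_q \<epsilon> * z"
    using assms cls_eq_iff by blast
  have "eps_op (shifted_q \<epsilon> * z) \<psi> i = 0"
    using z(1) by (simp add: eps_op_times eps_op_scal laurent_diff at_eps_diff)
  then show "eps_op x \<psi> i = eps_op y \<psi> i"
    using z assms(2) by (simp add: eps_op_plus res_form.mult)
qed

lemma uq_op_finite_support:
  "x \<in> res_form \<Longrightarrow> finite {i. \<phi> i \<noteq> 0} \<Longrightarrow> finite {i. uq_op x \<phi> i \<noteq> 0}"
proof (induction arbitrary: \<phi> rule: res_form.induct)
  case (scal a)
  show ?case
    by (rule finite_subset[OF _ scal(2)]) (auto simp: uq_op_scal)
next
  case K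
  show ?case
    by (rule finite_subset[OF _ K]) (auto simp: uq_op_gen)
next
  case Kinv
  show ?case
    by (rule finite_subset[OF _ Kinv]) (auto simp: uq_op_gen)
next
  case (divE r)
  have "{i. uq_op (divE r) \<phi> i \<noteq> 0} \<subseteq> (\<lambda>(a, b). (a - r, b - r)) ` {i. \<phi> i \<noteq> 0}"
  proof
    fix i assume i: "i \<in> {i. uq_op (divE r) \<phi> i \<noteq> 0}"
    obtain a b where ab: "i = (a, b)"
      by (cases i)
    then show "i \<in> (\<lambda>(a, b). (a - r, b - r)) ` {i. \<phi> i \<noteq> 0}"
      using i by (intro image_eqI[of _ _ "(a + r, b + r)"]) (auto simp: uq_op_divE)
  qed
  then show ?case
    using divE(2) finite_surj by blast
next
  case (divF r)
  have "{i. uq_op (divF r) \<phi> i \<noteq> 0} \<subseteq> (\<lambda>(a, b). (a + r, b + r)) ` {i. \<phi> i \<noteq> 0}"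
  proof
    fix i assume i: "i \<in> {i. uq_op (divF r) \<phi> i \<noteq> 0}"
    obtain a b where ab: "i = (a, b)"
      by (cases i)
    then show "i \<in> (\<lambda>(a, b). (a + r, b + r)) ` {i. \<phi> i \<noteq> 0}"
      using i by (intro image_eqI[of _ _ "(a - r, b - r)"]) (auto simp: uq_op_divF split: if_splits)
  qed
  then show ?case
    using divF(2) finite_surj by blast
next
  case (add x y)
  have "finite ({i. uq_op x \<phi> i \<noteq> 0} \<union> {i. uq_op y \<phi> i \<noteq> 0})"
    using add by simp
  then show ?case
    by (rule rev_finite_subset) (auto simp: uq_op_plus)
next
  case (mult x y)
  then show ?case
    by (simp add: uq_op_times)
qed

definition fock_act :: "uq set \<Rightarrow> fock \<Rightarrow> fock" where
  "fock_act X v = Abs_poly_mapping (eps_op (SOME x. x \<in> res_form \<and> X = cls \<epsilon> x) (lookup v))"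

lemma lookup_fock_act:
  assumes "x \<in> res_form"
  shows "lookup (fock_act (cls \<epsilon> x) v) = eps_op x (lookup v)"
proof -
  define y where "y = (SOME y. y \<in> res_form \<and> cls \<epsilon> x = cls \<epsilon> y)"
  have y: "y \<in> res_form \<and> cls \<epsilon> x = cls \<epsilon> y"
    unfolding y_def by (rule someI[of _ x]) (simp add: assms)
  have "{i. const_cq (lookup v i) \<noteq> 0} = {i. lookup v i \<noteq> 0}"
    by simp
  then have "finite {i. uq_op x (\<lambda>j. const_cq (lookup v j)) i \<noteq> 0}"
    using assms by (intro uq_op_finite_support) simp_all
  then have "finite {i. eps_op x (lookup v) i \<noteq> 0}"
    by (rule rev_finite_subset) (auto simp: eps_op_def)
  moreover have "fock_act (cls \<epsilon> x) v = Abs_poly_mapping (eps_op x (lookup v))"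
    unfolding fock_act_def y_def[symmetric] using y assms eps_op_cls by metis
  ultimately show ?thesis
    by simp
qed

lemma abelian_group_fock: "abelian_group (fock_module_of act)"
proof (rule abelian_groupI)
  fix x assume "x \<in> carrier (fock_module_of act)"
  show "\<exists>y\<in>carrier (fock_module_of act). y \<oplus>\<^bsub>fock_module_of act\<^esub> x = \<zero>\<^bsub>fock_module_of act\<^esub>"
    by (rule bexI[of _ "- x"]) (simp_all add: fock_module_of_def)
qed (simp_all add: fock_module_of_def add_ac)

lemma left_module_fock_act: "left_module (U_eps \<epsilon>) (fock_module_of fock_act)"
proof (intro left_module.intro left_module_axioms.intro)
  show "ring (U_eps \<epsilon>)"
    by (rule ring_U_eps)
  show "abelian_group (fock_module_of fock_act)"
    by (rule abelian_group_fock)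
next
  fix a x show "a \<odot>\<^bsub>fock_module_of fock_act\<^esub> x \<in> carrier (fock_module_of fock_act)"
    by (simp add: fock_module_of_def)
next
  fix a b x assume "a \<in> carrier (U_eps \<epsilon>)" "b \<in> carrier (U_eps \<epsilon>)"
  then obtain a' b' where ab: "a' \<in> res_form" "b' \<in> res_form" "a = cls \<epsilon> a'" "b = cls \<epsilon> b'"
    by (metis cls_surj)
  then have "fock_act (cls \<epsilon> (a' + b')) x = fock_act (cls \<epsilon> a') x + fock_act (cls \<epsilon> b') x"
    "fock_act (cls \<epsilon> (a' * b')) x = fock_act (cls \<epsilon> a') (fock_act (cls \<epsilon> b') x)"
    by (auto intro!: poly_mapping_eqI simp: lookup_fock_act lookup_add eps_op_plus eps_op_times res_form.add res_form.mult)
  then show "(a \<oplus>\<^bsub>U_eps \<epsilon>\<^esub> b) \<odot>\<^bsub>fock_module_of fock_act\<^esub> x =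
      a \<odot>\<^bsub>fock_module_of fock_act\<^esub> x \<oplus>\<^bsub>fock_module_of fock_act\<^esub> b \<odot>\<^bsub>fock_module_of fock_act\<^esub> x"
    and "(a \<otimes>\<^bsub>U_eps \<epsilon>\<^esub> b) \<odot>\<^bsub>fock_module_of fock_act\<^esub> x =
      a \<odot>\<^bsub>fock_module_of fock_act\<^esub> (b \<odot>\<^bsub>fock_module_of fock_act\<^esub> x)"
    using ab by (simp_all add: fock_module_of_def cls_add cls_mult)
next
  fix a and x y :: fock assume "a \<in> carrier (U_eps \<epsilon>)"
  then obtain a' where a: "a' \<in> res_form" "a = cls \<epsilon> a'"
    by (metis cls_surj)
  have "lookup (x + y) = (\<lambda>i. lookup x i + lookup y i)"
    by (rule ext) (rule lookup_add)
  then have "fock_act (cls \<epsilon> a') (x + y) = fock_act (cls \<epsilon> a') x + fock_act (cls \<epsilon> a') y"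
    using a by (intro poly_mapping_eqI) (simp add: lookup_fock_act lookup_add eps_op_add)
  then show "a \<odot>\<^bsub>fock_module_of fock_act\<^esub> (x \<oplus>\<^bsub>fock_module_of fock_act\<^esub> y) =
      a \<odot>\<^bsub>fock_module_of fock_act\<^esub> x \<oplus>\<^bsub>fock_module_of fock_act\<^esub> a \<odot>\<^bsub>fock_module_of fock_act\<^esub> y"
    using a by (simp add: fock_module_of_def)
next
  fix x
  have "fock_act (cls \<epsilon> 1) x = x"
    by (rule poly_mapping_eqI) (simp add: lookup_fock_act eps_op_1)
  then show "\<one>\<^bsub>U_eps \<epsilon>\<^esub> \<odot>\<^bsub>fock_module_of fock_act\<^esub> x = x"
    by (simp add: fock_module_of_def cls_1)
qed

lemma fock_g_nat: "fock_g (int a) (int b) = single (a, b) 1"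
  by (simp add: fock_g_def)

lemma is_fock_action_fock_act: "is_fock_action \<epsilon> fock_act"
  unfolding is_fock_action_def
proof (intro conjI allI impI left_module_fock_act)
  show "fock_act (cscal \<epsilon> c) x = fock_scale c x" for c x
    by (rule poly_mapping_eqI)
       (simp add: cscal_def lookup_fock_act res_form.scal eps_op_scal lookup_fock_scale)
next
  fix r1 r2 :: int assume "0 \<le> r1" "0 \<le> r2"
  then obtain a b where ab: "r1 = int a" "r2 = int b"
    by (metis nonneg_int_cases)
  have n: "- (int a + int b + 1) = - int (Suc (a + b))" "int a + int b + 1 = int (Suc (a + b))"
    by simp_all
  show "fock_act (cls \<epsilon> uK) (fock_g r1 r2) = fock_scale (\<epsilon> powi - (r1 + r2 + 1)) (fock_g r1 r2)"
  proof (rule poly_mapping_eqI)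
    fix i :: "nat \<times> nat" obtain c d where i: "i = (c, d)" by (cases i)
    show "lookup (fock_act (cls \<epsilon> uK) (fock_g r1 r2)) i =
      lookup (fock_scale (\<epsilon> powi - (r1 + r2 + 1)) (fock_g r1 r2)) i"
      unfolding ab n fock_g_nat i
      by (simp add: lookup_fock_act res_form.K eps_op_def uq_op_gen lookup_fock_scale lookup_single when_def
          at_eps_powi del: of_nat_Suc)
  qed
  show "fock_act (cls \<epsilon> uKinv) (fock_g r1 r2) = fock_scale (\<epsilon> powi (r1 + r2 + 1)) (fock_g r1 r2)"
  proof (rule poly_mapping_eqI)
    fix i :: "nat \<times> nat" obtain c d where i: "i = (c, d)" by (cases i)
    show "lookup (fock_act (cls \<epsilon> uKinv) (fock_g r1 r2)) i =
      lookup (fock_scale (\<epsilon> powi (r1 + r2 + 1)) (fock_g r1 r2)) i"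
      unfolding ab n fock_g_nat i
      by (simp add: lookup_fock_act res_form.Kinv eps_op_def uq_op_gen lookup_fock_scale lookup_single when_def
          at_eps_powi del: of_nat_Suc power_int_of_nat)
  qed
  fix r :: nat
  show "fock_act (cls \<epsilon> (divE r)) (fock_g r1 r2) =
      fock_scale (qbinom_eps \<epsilon> r2 (r2 - int r)) (fock_g (r1 - int r) (r2 - int r))"
  proof (rule poly_mapping_eqI)
    fix i :: "nat \<times> nat" obtain c d where i: "i = (c, d)" by (cases i)
    have l: "lookup (fock_act (cls \<epsilon> (divE r)) (fock_g r1 r2)) i =
       (if a = c + r \<and> b = d + r then qbinom_eps \<epsilon> (int (d + r)) (int r) else 0)"
      unfolding ab fock_g_nat i
      by (auto simp: lookup_fock_act res_form_divE eps_op_def uq_op_divE lookup_single when_def qbinom_eps_def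
          simp del: of_nat_add)
    show "lookup (fock_act (cls \<epsilon> (divE r)) (fock_g r1 r2)) i =
      lookup (fock_scale (qbinom_eps \<epsilon> r2 (r2 - int r)) (fock_g (r1 - int r) (r2 - int r))) i"
    proof (cases "a \<ge> r \<and> b \<ge> r")
      case True
      then obtain a' b' where a': "a = a' + r" "b = b' + r"
        by (metis add.commute le_Suc_ex)
      have diff: "r1 - int r = int a'" "r2 - int r = int b'"
        by (simp_all add: ab a')
      have "qbinom_eps \<epsilon> r2 (int b') = qbinom_eps \<epsilon> (int (b' + r)) (int r)"
        unfolding qbinom_eps_def ab a' using qbinom_symmetric[of b' r] by simp
      then show ?thesis
        unfolding l diff fock_g_nat lookup_fock_scale lookup_single
        by (auto simp: i a' when_def)
    next
      case False
      then have "fock_g (r1 - int r) (r2 - int r) = 0"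
        by (auto simp: fock_g_def ab)
      then show ?thesis
        using False by (auto simp: l lookup_fock_scale)
    qed
  qed
  show "fock_act (cls \<epsilon> (divF r)) (fock_g r1 r2) =
      fock_scale ((- 1) ^ r * qbinom_eps \<epsilon> (int r + r1) (int r)) (fock_g (r1 + int r) (r2 + int r))"
  proof (rule poly_mapping_eqI)
    fix i :: "nat \<times> nat" obtain c d where i: "i = (c, d)" by (cases i)
    have sign: "(- 1) ^ r = const_cq ((- 1) ^ r)"
      by (induction r) (simp_all add: const_cq_uminus)
    have l: "lookup (fock_act (cls \<epsilon> (divF r)) (fock_g r1 r2)) i =
       (if c = a + r \<and> d = b + r then (- 1) ^ r * qbinom_eps \<epsilon> (int c) (int r) else 0)"
      unfolding ab fock_g_nat i sign
      by (auto simp: lookup_fock_act res_form_divF eps_op_def uq_op_divF lookup_single when_def qbinom_eps_def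
          sign at_eps_mult qbinom_regular simp del: of_nat_add)
    have sum: "r1 + int r = int (a + r)" "r2 + int r = int (b + r)" "int r + r1 = int (a + r)"
      by (simp_all add: ab)
    show "lookup (fock_act (cls \<epsilon> (divF r)) (fock_g r1 r2)) i =
      lookup (fock_scale ((- 1) ^ r * qbinom_eps \<epsilon> (int r + r1) (int r))
        (fock_g (r1 + int r) (r2 + int r))) i"
      unfolding l sum fock_g_nat lookup_fock_scale lookup_single
      by (auto simp: i when_def)
  qed
qed

end

section \<open>Quotient modules\<close>

context eps_module
begin

lemma left_module_submodule:
  assumes "submodule N (U_eps \<epsilon>) M"
  shows "left_module (U_eps \<epsilon>) (M\<lparr>carrier := N\<rparr>)"
proof (intro left_module.intro left_module_axioms.intro)
  note N = submoduleD[OF assms]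
  have sub: "x \<in> carrier M" if "x \<in> N" for x
    using N(1) that by blast
  show "ring (U_eps \<epsilon>)"
    by (rule ring_U_eps)
  show "abelian_group (M\<lparr>carrier := N\<rparr>)"
  proof (rule abelian_groupI)
    fix x assume x: "x \<in> carrier (M\<lparr>carrier := N\<rparr>)"
    have "act (- 1) x \<in> N"
      using x by (intro N(4)) (simp_all add: res_form_uminus)
    moreover have "act (- 1) x \<oplus> x = \<zero>"
      using x sub by (simp add: act_uminus act_1 M.l_neg)
    ultimately show "\<exists>y\<in>carrier (M\<lparr>carrier := N\<rparr>). y \<oplus>\<^bsub>M\<lparr>carrier := N\<rparr>\<^esub> x = \<zero>\<^bsub>M\<lparr>carrier := N\<rparr>\<^esub>"
      by auto
  qed (auto simp: N sub M.a_ac)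
qed (use submoduleD[OF assms] in \<open>auto simp: subset_iff smult_l_distr smult_r_distr smult_assoc1 smult_one\<close>)

lemma quotient_epimorphism:
  assumes "submodule N (U_eps \<epsilon>) M"
  shows "eps_epimorphism \<epsilon> M (quot_module M N) (\<lambda>x. N +>\<^bsub>M\<^esub> x)"
    and "x \<in> carrier M \<Longrightarrow> N +>\<^bsub>M\<^esub> x = \<zero>\<^bsub>quot_module M N\<^esub> \<longleftrightarrow> x \<in> N"
proof -
  note N = submoduleD[OF assms]
  have "additive_subgroup N M"
    using assms by (auto simp: submodule_def intro: additive_subgroupI)
  then interpret N: abelian_subgroup N M
    by (intro abelian_subgroupI3 M.abelian_group_axioms)
  show "N +>\<^bsub>M\<^esub> x = \<zero>\<^bsub>quot_module M N\<^esub> \<longleftrightarrow> x \<in> N" if "x \<in> carrier M" for x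
    using that N.a_rcos_const N.a_rcos_self by (auto simp: quot_module_def)
  show "eps_epimorphism \<epsilon> M (quot_module M N) (\<lambda>x. N +>\<^bsub>M\<^esub> x)"
  proof unfold_locales
    show "(\<lambda>x. N +>\<^bsub>M\<^esub> x) ` carrier M = carrier (quot_module M N)"
      by (auto simp: quot_module_def A_RCOSETS_def')
    show "N +>\<^bsub>M\<^esub> \<zero> = \<zero>\<^bsub>quot_module M N\<^esub>"
      using N.a_subset by (simp add: quot_module_def)
    show "N +>\<^bsub>M\<^esub> (x \<oplus> y) = (N +>\<^bsub>M\<^esub> x) \<oplus>\<^bsub>quot_module M N\<^esub> (N +>\<^bsub>M\<^esub> y)"
      if "x \<in> carrier M" "y \<in> carrier M" for x y
      using N.a_rcos_sum[OF that] by (simp add: quot_module_def)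
    show "N +>\<^bsub>M\<^esub> (a \<odot> x) = a \<odot>\<^bsub>quot_module M N\<^esub> (N +>\<^bsub>M\<^esub> x)"
      if a: "a \<in> carrier (U_eps \<epsilon>)" and x: "x \<in> carrier M" for a x
    proof -
      have "N +>\<^bsub>M\<^esub> (a \<odot> y) = N +>\<^bsub>M\<^esub> (a \<odot> x)" if y: "y \<in> N +>\<^bsub>M\<^esub> x" for y
      proof -
        obtain n where n: "n \<in> N" "y = n \<oplus> x"
          using y by (auto simp: a_r_coset_def')
        then have "a \<odot> y = a \<odot> n \<oplus> a \<odot> x"
          using a x N(1) by (auto simp: smult_r_distr)
        moreover have "a \<odot> n \<in> N"
          using a n by (intro N(4))
        ultimately have "a \<odot> y \<in> N +>\<^bsub>M\<^esub> (a \<odot> x)"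
          by (auto simp: a_r_coset_def')
        then show ?thesis
          using a x M.a_repr_independence smult_closed N.a_subgroup by metis
      qed
      moreover have "N +>\<^bsub>M\<^esub> x \<noteq> {}"
        using N.a_rcos_self[OF x] by blast
      ultimately have "(\<Union>y\<in>N +>\<^bsub>M\<^esub> x. N +>\<^bsub>M\<^esub> (a \<odot> y)) = N +>\<^bsub>M\<^esub> (a \<odot> x)"
        by (intro SUP_eq_const)
      then show ?thesis
        by (simp add: quot_module_def)
    qed
  qed
qed

text \<open>For equal exponents the only term of the commutation formula without a positive divided power of \<open>e\<close>
  is \<open>[K;0;t]\<close>. This yields the action of \<open>[K;0;p]\<close> on the Fock space, which is described in terms of divided
  powers and \<open>K\<close> only.\<close>

lemma Kb_act:
  assumes v: "v \<in> carrier M" and e: "\<And>r. r > 0 \<Longrightarrow> act (divE r) v = \<zero>"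
  shows "act (U.Kb 0 t) v = act (divE t) (act (divF t) v)"
proof -
  define g where "g j = dF (int t - int j) * U.Kb (2 * int j - int t - int t) j * divE (t - j)" for j
  have g: "g j \<in> res_form" for j
    unfolding g_def by (intro res_form.mult res_form_dF res_form_Kb res_form_divE)
  have "act (\<Sum>j<n. g j) v = \<zero>" if "n \<le> t" for n
    using that
  proof (induction n)
    case (Suc n)
    have "act (g n) v = \<zero>"
      unfolding g_def using v Suc.prems
      by (simp add: act_mult e act_zero res_form.mult res_form_dF res_form_Kb res_form_divE)
    then show ?case
      using Suc v g by (simp add: act_add res_form_sum)
  qed (simp add: act_0 v)
  then have "act (\<Sum>j<t. g j) v = \<zero>"
    by simp
  then have "act (divE t * divF t) v = act (U.Kb 0 t) v"
    unfolding divE_divF_same g_def[symmetric] using v g by (simp add: act_add res_form_sum res_form_Kb)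
  then show ?thesis
    using v by (simp add: act_mult res_form_divE res_form_divF)
qed

end

section \<open>The quotient is an irreducible highest weight module\<close>

interpretation fock: vector_space fock_scale
  by standard
     (auto intro!: poly_mapping_eqI simp: lookup_fock_scale lookup_add algebra_simps)

context odd_root_of_unity
begin

lemma is_fock_action_SOME: "is_fock_action \<epsilon> (SOME act. is_fock_action \<epsilon> act)"
  by (rule someI[of "is_fock_action \<epsilon>", OF is_fock_action_fock_act])

abbreviation F where "F \<equiv> fock_module \<epsilon>"

lemma F_simps [simp]: "carrier F = UNIV" "x \<oplus>\<^bsub>F\<^esub> y = x + y" "\<zero>\<^bsub>F\<^esub> = 0"
  by (simp_all add: fock_module_def fock_module_of_def)

lemma F_smult: "a \<odot>\<^bsub>F\<^esub> x = (SOME act. is_fock_action \<epsilon> act) a x"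
  by (simp add: fock_module_def fock_module_of_def)

lemma eps_module_F: "eps_module \<epsilon> F"
  unfolding fock_module_def
  by (intro eps_moduleI is_fock_action_def[THEN iffD1, OF is_fock_action_SOME, THEN conjunct1])

sublocale F: eps_module \<epsilon> F
  by (rule eps_module_F)

lemma v_vec_eq: "v_vec s m = single (m, m + s) 1"
  using fock_g_nat[of m "m + s"] by (simp add: v_vec_def)

lemma F_cscal: "cscal \<epsilon> c \<odot>\<^bsub>F\<^esub> x = fock_scale c x"
  unfolding F_smult using is_fock_action_SOME
  by (rule is_fock_action_def[THEN iffD1, THEN conjunct2, THEN conjunct1, rule_format])

lemma F_gen:
  fixes a b r :: nat
  shows "F.act uK (fock_g a b) = fock_scale (\<epsilon> powi (- (int a + int b + 1))) (fock_g a b)"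
    and "F.act uKinv (fock_g a b) = fock_scale (\<epsilon> powi (int a + int b + 1)) (fock_g a b)"
    and "r \<ge> 1 \<Longrightarrow> F.act (divE r) (fock_g a b) =
      fock_scale (qbinom_eps \<epsilon> b (b - int r)) (fock_g (a - int r) (b - int r))"
    and "r \<ge> 1 \<Longrightarrow> F.act (divF r) (fock_g a b) =
      fock_scale ((- 1) ^ r * qbinom_eps \<epsilon> (int r + int a) (int r)) (fock_g (a + int r) (b + int r))"
  unfolding F_smult using is_fock_action_def[THEN iffD1, OF is_fock_action_SOME, THEN conjunct2, THEN conjunct2,
    rule_format, of "int a" "int b"]
  by simp_all

lemma F_K: "F.act uK (v_vec s m) = fock_scale (\<epsilon> powi (- (2 * int m + int s + 1))) (v_vec s m)"
  and F_Kinv: "F.act uKinv (v_vec s m) = fock_scale (\<epsilon> powi (2 * int m + int s + 1)) (v_vec s m)"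
  using F_gen(1,2)[of m "m + s"] unfolding v_vec_def by (simp_all add: algebra_simps)

lemma F_divF:
  assumes "r \<ge> 1"
  shows "F.act (divF r) (v_vec s m) = fock_scale ((- 1) ^ r * qbinom_eps \<epsilon> (int (m + r)) (int r)) (v_vec s (m + r))"
  using F_gen(4)[of r m "m + s"] assms unfolding v_vec_def by (simp add: algebra_simps)

lemma F_divE_0:
  assumes "r \<ge> 1" "m < r"
  shows "F.act (divE r) (v_vec s m) = 0"
proof -
  have "fock_g (int m - int r) (int m + int s - int r) = 0"
    using assms by (simp add: fock_g_def)
  then show ?thesis
    using F_gen(3)[of r m "m + s"] assms unfolding v_vec_def by simp
qed

lemma F_divE:
  assumes "r \<ge> 1"
  shows "F.act (divE r) (v_vec s (n + r)) = fock_scale (qbinom_eps \<epsilon> (int ((n + s) + r)) (int r)) (v_vec s n)"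
proof -
  have "n + r + s = (n + s) + r" "int ((n + s) + r) - int r = int (n + s)" "int (n + r) - int r = int n"
    "v_vec s (n + r) = fock_g (int (n + r)) (int (n + r + s))"
    by (simp_all add: v_vec_def)
  then have "F.act (divE r) (v_vec s (n + r)) =
      fock_scale (qbinom_eps \<epsilon> (int ((n + s) + r)) (int (n + s))) (v_vec s n)"
    using F_gen(3)[of r "n + r" "n + r + s"] assms unfolding v_vec_def[of s n] by (simp only:) simp
  then show ?thesis
    unfolding qbinom_eps_def qbinom_symmetric[of "n + s" r] .
qed

lemma fock_span_v_vec:
  "fock_span {v_vec s m | m. m \<in> S} = {x. keys x \<subseteq> {(m, m + s) | m. m \<in> S}}"
proof -
  let ?V = "{x. keys x \<subseteq> {(m, m + s) | m. m \<in> S}} :: fock set"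
  have "fock.span {v_vec s m | m. m \<in> S} \<subseteq> ?V"
  proof (rule fock.span_minimal)
    show "{v_vec s m | m. m \<in> S} \<subseteq> ?V"
      by (auto simp: v_vec_eq)
    show "fock.subspace ?V"
    proof (rule fock.subspaceI)
      fix x y :: fock assume "x \<in> ?V" "y \<in> ?V"
      then show "x + y \<in> ?V"
        using keys_add[of x y] by auto
    next
      fix c and x :: fock assume "x \<in> ?V"
      moreover have "keys (fock_scale c x) \<subseteq> keys x"
        by (auto simp: in_keys_iff lookup_fock_scale)
      ultimately show "fock_scale c x \<in> ?V"
        by auto
    qed simp
  qed
  moreover have "?V \<subseteq> fock.span {v_vec s m | m. m \<in> S}"
  proof
    fix x assume x: "x \<in> ?V"
    have "single k (lookup x k) \<in> fock.span {v_vec s m | m. m \<in> S}"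
      if k: "k \<in> keys x" for k
    proof -
      obtain m where m: "m \<in> S" "k = (m, m + s)"
        using x k by auto
      have "single k (lookup x k) = fock_scale (lookup x k) (v_vec s m)"
        by (rule poly_mapping_eqI) (simp add: lookup_fock_scale v_vec_eq m lookup_single when_def)
      moreover have "v_vec s m \<in> fock.span {v_vec s m | m. m \<in> S}"
        using m by (intro fock.span_base) blast
      ultimately show ?thesis
        by (simp add: fock.span_scale)
    qed
    then show "x \<in> fock.span {v_vec s m | m. m \<in> S}"
      by (subst poly_mapping_sum_single) (rule fock.span_sum)
  qed
  ultimately show ?thesis
    unfolding fock_span_def by blast
qed

lemma F_act_linear:
  assumes "x \<in> res_form"
  shows "F.act x (fock_scale c v + w) = fock_scale c (F.act x v) + F.act x w"
  using assms F.smult_r_distr[of "cls \<epsilon> x" "fock_scale c v" w] F.act_cscal_commute[of x v c]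
  by (simp add: F_cscal)

text \<open>Each divided power takes a basis vector to a multiple of a single basis vector, so it suffices that the
  coefficients leading out of the span vanish.\<close>

lemma submodule_fock_span:
  assumes "\<And>m r. m \<in> S \<Longrightarrow> m + r \<notin> S \<Longrightarrow> qbinom_eps \<epsilon> (int (m + r)) (int r) = 0"
    and "\<And>n r. n + r \<in> S \<Longrightarrow> n \<notin> S \<Longrightarrow> qbinom_eps \<epsilon> (int ((n + s) + r)) (int r) = 0"
  shows "submodule (fock_span {v_vec s m | m. m \<in> S}) (U_eps \<epsilon>) F"
proof (rule F.submoduleI)
  let ?V = "fock.span {v_vec s m | m. m \<in> S}"
  have scale: "fock_scale c (v_vec s m) \<in> ?V" if "m \<in> S \<or> c = 0" for c m
  proof (cases "c = 0")
    case True
    then show ?thesis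
      by (simp add: fock.span_zero)
  next
    case False
    then show ?thesis
      using that by (intro fock.span_scale fock.span_base) blast
  qed
  have extend: "F.act x v \<in> ?V"
    if "x \<in> res_form" "v \<in> ?V" "\<And>m. m \<in> S \<Longrightarrow> F.act x (v_vec s m) \<in> ?V" for x v
    using that(2)
  proof (induction rule: fock.span_induct_alt)
    case base
    then show ?case
      using F.act_zero[OF that(1)] fock.span_zero by simp
  next
    case (step c v w)
    then show ?case
      unfolding F_act_linear[OF that(1)] using that(3)
      by (auto intro!: fock.span_add fock.span_scale)
  qed
  fix x v assume x: "x \<in> res_form" and v: "v \<in> fock_span {v_vec s m | m. m \<in> S}"
  have "\<forall>v\<in>?V. F.act x v \<in> ?V"
    using x
  proof (induction)
    case (scal a)
    then show ?case
      by (simp add: cls_scal F_cscal fock.span_scale)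
  next
    case K
    have "F.act uK (v_vec s m) \<in> ?V" if "m \<in> S" for m
      unfolding F_K using that by (intro scale) simp
    then show ?case
      using extend[OF res_form.K] by blast
  next
    case Kinv
    have "F.act uKinv (v_vec s m) \<in> ?V" if "m \<in> S" for m
      unfolding F_Kinv using that by (intro scale) simp
    then show ?case
      using extend[OF res_form.Kinv] by blast
  next
    case (divE r)
    have "F.act (divE r) (v_vec s m) \<in> ?V" if m: "m \<in> S" for m
    proof (cases "m < r")
      case True
      then show ?thesis
        using F_divE_0 divE fock.span_zero by simp
    next
      case False
      then obtain n where "m = n + r"
        by (metis add.commute le_Suc_ex not_less)
      show ?thesis
        unfolding \<open>m = n + r\<close> F_divE[OF divE] using assms(2)[of n r] m \<open>m = n + r\<close>
        by (intro scale) auto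
    qed
    then show ?case
      using extend[OF res_form.divE[OF divE]] by blast
  next
    case (divF r)
    have "F.act (divF r) (v_vec s m) \<in> ?V" if m: "m \<in> S" for m
      unfolding F_divF[OF divF] using assms(1)[of m r] m by (intro scale) auto
    then show ?case
      using extend[OF res_form.divF[OF divF]] by blast
  next
    case (add x y)
    then show ?case
      by (simp add: F.act_add fock.span_add)
  next
    case (mult x y)
    then show ?case
      by (simp add: F.act_mult)
  qed
  then show "F.act x v \<in> fock_span {v_vec s m | m. m \<in> S}"
    using v unfolding fock_span_def by blast
qed (simp_all add: fock_span_def fock.span_zero fock.span_add)

lemma Vs_eq: "Vs s = {x. keys x \<subseteq> {(m, m + s) | m. True}}"
  using fock_span_v_vec[of s UNIV] by (simp add: Vs_def)

text \<open>In this form the condition says that a carry occurs in the lowest digit of \<open>m + s\<close>.\<close>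

lemma carry_iff: "p - s mod p \<le> m mod p \<longleftrightarrow> p \<le> m mod p + s mod p"
  by linarith

lemma Vs'_eq: "Vs' p s = {x. keys x \<subseteq> {(m, m + s) | m. p \<le> m mod p + s mod p}}"
  using fock_span_v_vec[of s "{m. p \<le> m mod p + s mod p}"] by (simp add: Vs'_def carry_iff)

lemma submodule_Vs: "submodule (Vs s) (U_eps \<epsilon>) F"
  using submodule_fock_span[of UNIV s] by (simp add: Vs_def)

lemma mod_add_no_carry: "a mod p + b mod p < p \<Longrightarrow> (a + b) mod p = a mod p + b mod p"
  by (metis mod_add_eq mod_less)

text \<open>Without a carry the lowest digits add up. If \<open>m + s\<close> has a carry, but \<open>(m + r) + s\<close> has none, then \<open>m + r\<close>
  has one, as otherwise the lowest digit of \<open>m + r\<close> would be at least that of \<open>m\<close>. The argument for the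
  divided powers of \<open>e\<close> is similar.\<close>

lemma submodule_Vs': "submodule (Vs' p s) (U_eps \<epsilon>) F"
proof -
  have "submodule (fock_span {v_vec s m | m. m \<in> {m. p \<le> m mod p + s mod p}}) (U_eps \<epsilon>) F"
  proof (rule submodule_fock_span)
    fix m r
    assume m: "m \<in> {m. p \<le> m mod p + s mod p}" "m + r \<notin> {m. p \<le> m mod p + s mod p}"
    then have "p \<le> m mod p + r mod p"
      using mod_add_no_carry[of m r] by (rule_tac ccontr) auto
    then show "qbinom_eps \<epsilon> (int (m + r)) (int r) = 0"
      by (simp only: qbinom_eps_eq_0_iff)
  next
    fix n r
    assume n: "n + r \<in> {m. p \<le> m mod p + s mod p}" "n \<notin> {m. p \<le> m mod p + s mod p}"
    then have "(n + s) mod p = n mod p + s mod p"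
      using mod_add_no_carry[of n s] by auto
    then have "p \<le> (n + s) mod p + r mod p"
      using n mod_add_no_carry[of n r] by (rule_tac ccontr) auto
    then show "qbinom_eps \<epsilon> (int ((n + s) + r)) (int r) = 0"
      by (simp only: qbinom_eps_eq_0_iff)
  qed
  then show ?thesis
    by (simp add: Vs'_def carry_iff)
qed

abbreviation V where "V s \<equiv> F\<lparr>carrier := Vs s\<rparr>"

lemma eps_module_V: "eps_module \<epsilon> (V s)"
  by (intro eps_moduleI F.left_module_submodule submodule_Vs)

lemma v_vec_Vs: "v_vec s m \<in> Vs s"
  by (auto simp: Vs_eq v_vec_eq)

text \<open>The coefficient of \<open>v_m\<close> in \<open>f^(m) v_0\<close> is \<open>(-1)^m\<close> times the binomial of \<open>m\<close> over \<open>m\<close>, hence a sign.\<close>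

lemma v_0_generates: "generated_by (U_eps \<epsilon>) (V s) (v_vec s 0)"
  unfolding generated_by_def
proof (intro conjI allI impI)
  interpret V: eps_module \<epsilon> "V s"
    by (rule eps_module_V)
  show "v_vec s 0 \<in> carrier (V s)"
    by (simp add: v_vec_Vs)
  fix N assume "submodule N (U_eps \<epsilon>) (V s) \<and> v_vec s 0 \<in> N"
  then have sub: "submodule N (U_eps \<epsilon>) (V s)" and v0: "v_vec s 0 \<in> N"
    by auto
  note N = V.submoduleD[OF sub, simplified]
  have scale: "fock_scale c x \<in> N" if "x \<in> N" for c x
    using N(4)[OF F.cscal_carrier that, of c] by (simp add: F_cscal)
  have "v_vec s m \<in> N" for m
  proof (cases "m = 0")
    case False
    have "F.act (divF m) (v_vec s 0) = fock_scale ((- 1) ^ m) (v_vec s m)"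
      using False F_divF[of m s 0] by (simp add: qbinom_eps_def)
    then have "fock_scale ((- 1) ^ m) (v_vec s m) \<in> N"
      using N(4)[OF cls_closed[OF res_form_divF] v0, of m] by simp
    then have "fock_scale ((- 1) ^ m) (fock_scale ((- 1) ^ m) (v_vec s m)) \<in> N"
      by (rule scale)
    then show ?thesis
      by simp
  qed (simp add: v0)
  moreover have "fock.subspace N"
    using N scale by (intro fock.subspaceI) auto
  ultimately have "Vs s \<subseteq> N"
    unfolding Vs_def fock_span_def by (intro fock.span_minimal) auto
  then show "N = carrier (V s)"
    using N(1) by auto
qed

lemma at_eps_sign: "at_eps \<epsilon> ((- 1) ^ n * x) = (- 1) ^ n * at_eps \<epsilon> x" if "x \<in> regular \<epsilon>"
proof -
  have "(- 1) ^ n = const_cq ((- 1) ^ n)"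
    by (induction n) (simp_all add: const_cq_uminus)
  then show ?thesis
    using at_eps_mult[OF const_cq_regular that, of "(- 1) ^ n"] by simp
qed

text \<open>By \<open>Kb_act\<close>, \<open>[K;0;p]\<close> acts on \<open>v_0\<close> as \<open>e^(p) f^(p)\<close>, that is by \<open>(-1)^p\<close> times the binomial of \<open>s + p\<close> over
  \<open>p\<close>, which is the binomial of \<open>-(s + 1)\<close> over \<open>p\<close>.\<close>

lemma v_0_highest_weight: "highest_weight_generator \<epsilon> p (- (int s + 1)) (V s) (v_vec s 0)"
  unfolding highest_weight_generator_def
proof (intro conjI v_0_generates)
  have e: "F.act (divE r) (v_vec s 0) = 0" if "r > 0" for r
    using that F_divE_0[of r 0] by simp
  show "v_vec s 0 \<noteq> \<zero>\<^bsub>V s\<^esub>"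
    by (simp add: v_vec_eq flip: keys_eq_empty)
  show "cls \<epsilon> (divE 1) \<odot>\<^bsub>V s\<^esub> v_vec s 0 = \<zero>\<^bsub>V s\<^esub>" "cls \<epsilon> (divE p) \<odot>\<^bsub>V s\<^esub> v_vec s 0 = \<zero>\<^bsub>V s\<^esub>"
    using e[of 1] e[of p] p_gt_1 by simp_all
  have "F.act (Kbinom p) (v_vec s 0) = F.act (divE p) (F.act (divF p) (v_vec s 0))"
    unfolding Kbinom_eq_Kb using e by (intro F.Kb_act) simp_all
  also have "\<dots> = F.act (divE p) (cscal \<epsilon> ((- 1) ^ p) \<odot>\<^bsub>F\<^esub> v_vec s p)"
    using F_divF[of p s 0] p_gt_1 by (simp add: F_cscal qbinom_eps_def)
  also have "\<dots> = cscal \<epsilon> ((- 1) ^ p) \<odot>\<^bsub>F\<^esub> (F.act (divE p) (v_vec s p))"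
    by (intro F.act_cscal_commute res_form_divE) simp
  also have "\<dots> = fock_scale ((- 1) ^ p * qbinom_eps \<epsilon> (int (s + p)) (int p)) (v_vec s 0)"
    using F_divE[of p s 0] p_gt_1 by (simp add: F_cscal)
  also have "(- 1) ^ p * qbinom_eps \<epsilon> (int (s + p)) (int p) = qbinom_eps \<epsilon> (- (int s + 1)) (int p)"
    unfolding qbinom_eps_def qbinom_uminus using qbinom_regular by (simp only: at_eps_sign)
  finally show "v_vec s 0 \<in> weight_space \<epsilon> p (V s) (- (int s + 1))"
    using F_K[of s 0] by (simp add: weight_space_def v_vec_Vs F_cscal)
qed

text \<open>Modulo the smaller subspace only the \<open>v_m\<close> without a carry remain. The highest of them that
  occurs, \<open>v_m\<close> say, is taken by \<open>e^(m)\<close> to a multiple of \<open>v_0\<close>, which is nonzero because there is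
  no carry, and the lower ones are killed.\<close>

lemma submodule_contains_v_0:
  assumes N: "submodule N (U_eps \<epsilon>) (V s)" "Vs' p s \<subseteq> N" and x: "x \<in> N" "x \<notin> Vs' p s"
  shows "v_vec s 0 \<in> N"
proof -
  interpret V: eps_module \<epsilon> "V s"
    by (rule eps_module_V)
  note N' = V.submoduleD[OF N(1), simplified]
  have scale: "fock_scale c y \<in> N" if "y \<in> N" for c y
    using N'(4)[OF F.cscal_carrier that, of c] by (simp add: F_cscal)
  have keys_x: "keys x \<subseteq> {(m, m + s) | m. True}"
    using x(1) N'(1) by (auto simp: Vs_eq)
  define G where "G = {m. m mod p + s mod p < p \<and> (m, m + s) \<in> keys x}"
  \<comment> \<open>the part of \<open>x\<close> outside the smaller subspace\<close>
  define y where "y = (\<Sum>m\<in>G. fock_scale (lookup x (m, m + s)) (v_vec s m))"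
  have finG: "finite G"
  proof -
    have "G \<subseteq> fst ` keys x"
      unfolding G_def by force
    then show ?thesis
      by (rule finite_subset) simp
  qed
  have lookup_y: "lookup y (m, n) = (if m \<in> G \<and> n = m + s then lookup x (m, n) else 0)" for m n
  proof -
    have "lookup y (m, n) =
        (\<Sum>k\<in>G. lookup x (k, k + s) * (if k = m \<and> k + s = n then 1 else 0))"
      unfolding y_def by (simp add: lookup_sum lookup_fock_scale v_vec_eq lookup_single when_def)
    also have "\<dots> = (\<Sum>k\<in>G. if k = m then (if n = m + s then lookup x (m, n) else 0) else 0)"
      by (intro sum.cong refl) auto
    finally show ?thesis
      using finG by simp
  qed
  have "x - y \<in> Vs' p s"
    unfolding Vs'_eq
  proof (rule CollectI, rule subsetI)
    fix k assume k: "k \<in> keys (x - y)"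
    obtain m n where mn: "k = (m, n)"
      by (cases k)
    have ne: "lookup x (m, n) \<noteq> lookup y (m, n)"
      using k by (simp add: mn in_keys_iff lookup_minus)
    then have "(m, n) \<in> keys x"
      by (auto simp: in_keys_iff lookup_y split: if_splits)
    moreover then have "n = m + s"
      using keys_x by auto
    ultimately show "k \<in> {(m, m + s) | m. p \<le> m mod p + s mod p}"
      using ne by (auto simp: mn lookup_y G_def not_less[symmetric])
  qed
  then have "fock_scale (- 1) (x - y) \<in> N"
    using N(2) scale by blast
  then have "x + fock_scale (- 1) (x - y) \<in> N"
    using x(1) N'(3) by blast
  moreover have "x + fock_scale (- 1) (x - y) = y"
    by (rule poly_mapping_eqI) (simp add: lookup_add lookup_fock_scale lookup_minus)
  ultimately have y: "y \<in> N"
    by simp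
  have "G \<noteq> {}"
    using x(2) keys_x by (force simp: Vs'_eq G_def not_less)
  define m where "m = Max G"
  have m: "m \<in> G" "\<And>k. k \<in> G \<Longrightarrow> k \<le> m"
    using finG \<open>G \<noteq> {}\<close> by (auto simp: m_def)
  define c where "c = lookup x (m, m + s)"
  have c: "c \<noteq> 0"
    using m(1) by (simp add: c_def G_def in_keys_iff)
  have kill: "F.act (divE m) (\<Sum>k\<in>S. fock_scale (lookup x (k, k + s)) (v_vec s k)) = 0"
    if "finite S" "\<And>k. k \<in> S \<Longrightarrow> k < m" for S
    using that
  proof (induction S)
    case empty
    then show ?case
      using F.act_zero[OF res_form_divE] by simp
  next
    case (insert k S)
    then have "k < m"
      by simp
    then have "F.act (divE m) (v_vec s k) = 0"
      by (intro F_divE_0) simp_all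
    then show ?case
      using insert by (simp add: F_act_linear[OF res_form_divE])
  qed
  let ?b = "qbinom_eps \<epsilon> (int (s + m)) (int m)"
  have "y = fock_scale c (v_vec s m) + (\<Sum>k\<in>G - {m}. fock_scale (lookup x (k, k + s)) (v_vec s k))"
    unfolding y_def c_def using finG m(1) by (rule sum.remove)
  then have "F.act (divE m) y = fock_scale c (F.act (divE m) (v_vec s m))"
    using kill[of "G - {m}"] finG m(2) by (simp add: F_act_linear[OF res_form_divE] le_neq_implies_less)
  also have "F.act (divE m) (v_vec s m) = fock_scale ?b (v_vec s 0)"
  proof (cases "m = 0")
    case True
    then show ?thesis
      using F.act_1[of "v_vec s 0"] by (simp add: qbinom_eps_def)
  next
    case False
    then show ?thesis
      using F_divE[of m s 0] by simp
  qed
  finally have "fock_scale (c * ?b) (v_vec s 0) \<in> N"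
    using N'(4)[OF cls_closed[OF res_form_divE] y, of m] by simp
  then have "fock_scale (inverse (c * ?b)) (fock_scale (c * ?b) (v_vec s 0)) \<in> N"
    by (rule scale)
  moreover have "?b \<noteq> 0"
    using m(1) unfolding qbinom_eps_eq_0_iff by (simp add: G_def add.commute not_le)
  with c have "c * ?b \<noteq> 0"
    by simp
  ultimately show ?thesis
    by (simp only: fock.scale_scale left_inverse fock.scale_one not_False_eq_True)
qed

lemma Vs'_subset: "Vs' p s \<subseteq> Vs s"
  by (auto simp: Vs_eq Vs'_eq)

lemma submodule_Vs'_V: "submodule (Vs' p s) (U_eps \<epsilon>) (V s)"
proof -
  interpret V: eps_module \<epsilon> "V s"
    by (rule eps_module_V)
  show ?thesis
    using F.submoduleD[OF submodule_Vs'[of s]] Vs'_subset[of s] by (intro V.submoduleI) simp_all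
qed

lemma v_0_notin_Vs': "v_vec s 0 \<notin> Vs' p s"
  using p_gt_1 by (auto simp: Vs'_eq v_vec_eq not_le)

lemma highest_weight_Vs_quot: "highest_weight_module \<epsilon> p (- (int s + 1)) (Vs_quot \<epsilon> p s)"
  and irreducible_Vs_quot: "irreducible_module (U_eps \<epsilon>) (Vs_quot \<epsilon> p s)"
proof -
  let ?h = "\<lambda>x. Vs' p s +>\<^bsub>V s\<^esub> x" and ?Q = "Vs_quot \<epsilon> p s"
  interpret V: eps_module \<epsilon> "V s"
    by (rule eps_module_V)
  interpret Q: eps_epimorphism \<epsilon> "V s" ?Q ?h
    unfolding Vs_quot_def by (rule V.quotient_epimorphism(1)[OF submodule_Vs'_V])
  interpret Q': eps_module \<epsilon> ?Q
    by (rule eps_moduleI[OF Q.left_module_image])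
  have zero: "?h x = \<zero>\<^bsub>?Q\<^esub> \<longleftrightarrow> x \<in> Vs' p s" if "x \<in> Vs s" for x
    using V.quotient_epimorphism(2)[OF submodule_Vs'_V, of x] that unfolding Vs_quot_def by simp
  have gen: "highest_weight_generator \<epsilon> p (- (int s + 1)) ?Q (?h (v_vec s 0))"
    using zero[OF v_vec_Vs] v_0_notin_Vs' by (intro Q.generator_image v_0_highest_weight) simp
  then show "highest_weight_module \<epsilon> p (- (int s + 1)) ?Q"
    using Q'.generator_type_1[OF odd_root_of_unity_axioms] unfolding highest_weight_module_iff by blast
  show "irreducible_module (U_eps \<epsilon>) ?Q"
    unfolding irreducible_module_def
  proof (intro conjI allI impI)
    show "carrier ?Q \<noteq> {\<zero>\<^bsub>?Q\<^esub>}"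
      using gen Q'.generator_carrier[OF gen] unfolding highest_weight_generator_def by blast
    fix P assume P: "submodule P (U_eps \<epsilon>) ?Q"
    note P' = Q'.submoduleD[OF P]
    let ?N = "{x \<in> carrier (V s). ?h x \<in> P}"
    have N: "submodule ?N (U_eps \<epsilon>) (V s)"
      using P by (rule Q.submodule_vimage)
    have sub: "Vs' p s \<subseteq> ?N"
    proof
      fix x assume x: "x \<in> Vs' p s"
      then have "x \<in> Vs s"
        using Vs'_subset by blast
      moreover then have "?h x = \<zero>\<^bsub>?Q\<^esub>"
        using x zero by blast
      ultimately show "x \<in> ?N"
        using P'(2) by simp
    qed
    show "P = {\<zero>\<^bsub>?Q\<^esub>} \<or> P = carrier ?Q"
    proof (cases "?N \<subseteq> Vs' p s")
      case True
      have "y = \<zero>\<^bsub>?Q\<^esub>" if "y \<in> P" for y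
      proof -
        have "y \<in> carrier ?Q"
          using that P'(1) by (rule rev_subsetD)
        then obtain x where x: "x \<in> carrier (V s)" "y = ?h x"
          by (rule Q.h_surj)
        then have "x \<in> ?N"
          using that by simp
        then have "x \<in> Vs' p s"
          using True by (rule rev_subsetD)
        moreover have "x \<in> Vs s"
          using x(1) by simp
        ultimately show ?thesis
          unfolding x(2) using zero by blast
      qed
      then show ?thesis
        using P'(2) by blast
    next
      case False
      then obtain x where "x \<in> ?N" "x \<notin> Vs' p s"
        by blast
      then have "v_vec s 0 \<in> ?N"
        by (rule submodule_contains_v_0[OF N sub])
      then have "?N = carrier (V s)"
        using v_0_generates N unfolding generated_by_def by blast
      then have "carrier ?Q \<subseteq> P"
        unfolding Q.surj[symmetric] by blast
      then show ?thesis
        using P'(1) by blast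
    qed
  qed
qed

end

theorem mainTheorem4:
  fixes p s :: nat and \<epsilon> :: complex
  assumes "p > 1" and "odd p"
    and "\<epsilon> ^ p = 1" and "\<And>k. 0 < k \<Longrightarrow> k < p \<Longrightarrow> \<epsilon> ^ k \<noteq> 1"
    and "s > 0" and "s mod p \<noteq> 0"
  shows "module_iso (U_eps \<epsilon>) (Vs_quot \<epsilon> p s) (V_res \<epsilon> p (- (int s + 1)))"
proof -
  interpret odd_root_of_unity p \<epsilon>
    using assms(1-4) by unfold_locales
  show ?thesis
    using odd_root_of_unity_axioms highest_weight_Vs_quot irreducible_Vs_quot by (rule module_iso_V_res)
qed

end
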